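(* Let $\Bbbk$ be a unital commutative ring and let $\mathsf{X}=\Bbbk\mathsf{X}_0$ be a weakly projective linearized $\mathsf{E}$-bicomodule that is cosymmetric. Then the Koszul complex $K^*(\mathsf{X})$, with its cup product, is isomorphic as an algebra to the cohomology algebra $H^*(\mathsf{X})=H^*(\mathsf{X},\mathsf{E})$. In particular, $H^*(\mathsf{X})$ is graded commutative.
   Context: A (linear) species is a functor from finite sets and bijections to $\Bbbk$-modules; $\mathsf{X}[n]$ is its value on $[n]=\{1,\ldots,n\}$. A decomposition of $I$ is a tuple of pairwise disjoint, possibly empty, subsets with union $I$. The Cauchy product is $(\mathsf{X}\cdot\mathsf{Y})[I]=\bigoplus_{(S,T)}\mathsf{X}[S]\otimes\mathsf{Y}[T]$ over decompositions $(S,T)$. The exponential species $\mathsf{E}$, $\mathsf{E}[I]=\Bbbk e_I$, is a coalgebra with coproduct $e_I\mapsto e_S\otimes e_T$. An $\mathsf{E}$-bicomodule has compatible coactions $\lambda(z)=\sum e_S\otimes z/\!/T$ and $\rho(z)=\sum z\backslash\!\backslash S\otimes e_T$; it is linearized if $\mathsf{X}[I]$ is free on $\mathsf{X}_0[I]$ for a set species $\mathsf{X}_0$ and the restrictions $z\mapsto z/\!/T$, $z\mapsto z\backslash\!\backslash S$ come from maps of sets; cosymmetric if $z/\!/S=z\backslash\!\backslash S$ for all $z\in\mathsf{X}[I]$, $S\subseteq I$; weakly projective if each $\mathsf{X}[j]$ is a projective $\Bbbk S_j$-module. $C^n(\mathsf{X})=\operatorname{Hom}(\mathsf{X},\mathsf{E}^{\cdot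 n})$; a cochain is given by coefficients $\alpha(F_1,\ldots,F_n)(z)\in\Bbbk$, for $(F_1,\ldots,F_n)$ a decomposition of $I$ and $z\in\mathsf{X}[I]$. The differential is $\delta=\sum_{i=0}^{n+1}(-1)^id^i$ with $(d^0\alpha)(F_0,\ldots,F_n)(z)=\alpha(F_1,\ldots,F_n)(z/\!/F_0^c)$, $(d^i\alpha)(F_0,\ldots,F_n)(z)=\alpha(F_0,\ldots,F_{i-1}\cup F_i,\ldots,F_n)(z)$ for $0<i<n+1$, $(d^{n+1}\alpha)(F_0,\ldots,F_n)(z)=\alpha(F_0,\ldots,F_{n-1})(z\backslash\!\backslash F_n^c)$. $H^*(\mathsf{X},\mathsf{E})$ is its cohomology, an algebra under the product induced by $(\alpha\smile\beta)(F_1,\ldots,F_{p+q})(z)=\alpha(F_1,\ldots,F_p)(z\backslash\!\backslash(F_1\cup\cdots\cup F_p))\,\beta(F_{p+1},\ldots,F_{p+q})(z/\!/(F_{p+1}\cup\cdots\cup F_{p+q}))$ for $z\in\mathsf{X}_0[I]$. The Koszul complex has $K^p(\mathsf{X})=\operatorname{Hom}_{S_p}(\mathsf{X}[p],\operatorname{sgn}_p)$, differential $df(z)=\sum_{i=1}^{p+1}(-1)^{i-1}(f(z\backslash\!\backslash([p+1]\setminus i))-f(z/\!/([p+1]\setminus i)))$ for $z\in\mathsf{X}[p+1]$ (transporting along order-preserving bijections $[p+1]\setminus i\to[p]$; it vanishes when $\mathsf{X}$ is cosymmetric), and cup product $(f\smile g)(z)=\sum_{(S,T)}(-1)^{\operatorname{sch}(S,T)}f(\lambda_S(z\backslash\!\backslash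 S))g(\lambda_T(z/\!/T))$ for $z\in\mathsf{X}_0[p+q]$, over decompositions of $[p+q]$ with $\#S=p,\#T=q$, where $\lambda_S,\lambda_T$ are the order-preserving bijections $S\to[p]$, $T\to[q]$ and $\operatorname{sch}(S,T)=\#\{(s,t)\in S\times T:s>t\}$. *)

theory Defs
  imports "HOL-Library.Poly_Mapping" "HOL-Combinatorics.Permutations"
begin

(* The ground ring is a type of sort {comm_ring, comm_monoid_mult}: a commutative ring with 1.
   The class comm_ring_1 would in addition exclude the zero ring. *)

section \<open>Free modules\<close>

(* The free module on a set A of elements of type 'x consists of the v :: 'x \<Rightarrow>\<^sub>0 'k with
   keys v \<subseteq> A; the basis vector of x is single x 1. *)

definition free_module :: "'x set \<Rightarrow> ('x \<Rightarrow>\<^sub>0 'k::zero) set" where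
  "free_module A = {v. Poly_Mapping.keys v \<subseteq> A}"

definition scale :: "'k::{comm_ring,comm_monoid_mult} \<Rightarrow> ('x \<Rightarrow>\<^sub>0 'k) \<Rightarrow> ('x \<Rightarrow>\<^sub>0 'k)" where
  "scale c v = Poly_Mapping.map (\<lambda>a. c * a) v"

definition basis :: "'x \<Rightarrow> ('x \<Rightarrow>\<^sub>0 'k::{comm_ring,comm_monoid_mult})" where
  "basis x = Poly_Mapping.single x 1"

definition push :: "('x \<Rightarrow> 'y) \<Rightarrow> ('x \<Rightarrow>\<^sub>0 'k::{comm_ring,comm_monoid_mult}) \<Rightarrow> ('y \<Rightarrow>\<^sub>0 'k)" where
  "push h v = (\<Sum>x\<in>Poly_Mapping.keys v. Poly_Mapping.single (h x) (Poly_Mapping.lookup v x))"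

(* Linear forms on the free module on A. They are set to 0 off this module, so that equality of
   functions is equality of forms. *)
definition linear_forms :: "'x set \<Rightarrow> (('x \<Rightarrow>\<^sub>0 'k::{comm_ring,comm_monoid_mult}) \<Rightarrow> 'k) set" where
  "linear_forms A = {f.
     (\<forall>v\<in>free_module A. \<forall>w\<in>free_module A. f (v + w) = f v + f w) \<and>
     (\<forall>c. \<forall>v\<in>free_module A. f (scale c v) = c * f v) \<and>
     (\<forall>v. v \<notin> free_module A \<longrightarrow> f v = 0)}"

definition linear_extension ::
    "'x set \<Rightarrow> ('x \<Rightarrow> 'k) \<Rightarrow> ('x \<Rightarrow>\<^sub>0 'k::{comm_ring,comm_monoid_mult}) \<Rightarrow> 'k" where
  "linear_extension A h v =
     (if v \<in> free_module A
      then \<Sum>x\<in>Poly_Mapping.keys v. Poly_Mapping.lookup v x * h x else 0)"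


section \<open>Linearized bicomodules over the exponential species\<close>

(* Finite sets are finite sets of natural numbers; these form a full subcategory of finite sets
   and bijections that is equivalent to the whole category and contains all the sets {1..n}.
   A bijection out of I is given by any function that is injective on I.
     obj X I         the set X_0[I]
     trans X I s     X_0[s] : X_0[I] -> X_0[s ` I], for s injective on I
     lres X I T z    z // T,  for z in X_0[I] and T a subset of I
     rres X I S z    z \ \ S, for z in X_0[I] and S a subset of I *)

record 'x set_bicomodule =
  obj :: "nat set \<Rightarrow> 'x set"
  trans :: "nat set \<Rightarrow> (nat \<Rightarrow> nat) \<Rightarrow> 'x \<Rightarrow> 'x"
  lres :: "nat set \<Rightarrow> nat set \<Rightarrow> 'x \<Rightarrow> 'x"
  rres :: "nat set \<Rightarrow> nat set \<Rightarrow> 'x \<Rightarrow> 'x"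

definition set_species :: "'x set_bicomodule \<Rightarrow> bool" where
  "set_species X \<longleftrightarrow>
     (\<forall>I \<sigma>. finite I \<longrightarrow> inj_on \<sigma> I \<longrightarrow> (\<forall>z\<in>obj X I. trans X I \<sigma> z \<in> obj X (\<sigma> ` I))) \<and>
     (\<forall>I \<sigma> \<tau>. finite I \<longrightarrow> inj_on \<sigma> I \<longrightarrow> (\<forall>i\<in>I. \<sigma> i = \<tau> i) \<longrightarrow>
        (\<forall>z\<in>obj X I. trans X I \<sigma> z = trans X I \<tau> z)) \<and>
     (\<forall>I. finite I \<longrightarrow> (\<forall>z\<in>obj X I. trans X I id z = z)) \<and>
     (\<forall>I \<sigma> \<tau>. finite I \<longrightarrow> inj_on \<sigma> I \<longrightarrow> inj_on \<tau> (\<sigma> ` I) \<longrightarrow>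
        (\<forall>z\<in>obj X I. trans X (\<sigma> ` I) \<tau> (trans X I \<sigma> z) = trans X I (\<tau> \<circ> \<sigma>) z))"

(* One coaction: res is natural, counital and coassociative. Because the coproduct of E sends e_I
   to the sum of all e_S \<otimes> e_T, left and right coactions satisfy the same conditions. *)
definition restriction ::
    "'x set_bicomodule \<Rightarrow> (nat set \<Rightarrow> nat set \<Rightarrow> 'x \<Rightarrow> 'x) \<Rightarrow> bool" where
  "restriction X res \<longleftrightarrow>
     (\<forall>I T. finite I \<longrightarrow> T \<subseteq> I \<longrightarrow> (\<forall>z\<in>obj X I. res I T z \<in> obj X T)) \<and>
     (\<forall>I T \<sigma>. finite I \<longrightarrow> T \<subseteq> I \<longrightarrow> inj_on \<sigma> I \<longrightarrow>
        (\<forall>z\<in>obj X I. res (\<sigma> ` I) (\<sigma> ` T) (trans X I \<sigma> z) = trans X T \<sigma> (res I T z))) \<and>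
     (\<forall>I. finite I \<longrightarrow> (\<forall>z\<in>obj X I. res I I z = z)) \<and>
     (\<forall>I T U. finite I \<longrightarrow> T \<subseteq> I \<longrightarrow> U \<subseteq> T \<longrightarrow>
        (\<forall>z\<in>obj X I. res T U (res I T z) = res I U z))"

(* The last condition is the compatibility of the two coactions, evaluated at a decomposition
   (A, M, B) of I. *)
definition linearized_bicomodule :: "'x set_bicomodule \<Rightarrow> bool" where
  "linearized_bicomodule X \<longleftrightarrow>
     set_species X \<and> restriction X (lres X) \<and> restriction X (rres X) \<and>
     (\<forall>A M B. finite (A \<union> M \<union> B) \<longrightarrow> A \<inter> M = {} \<longrightarrow> A \<inter> B = {} \<longrightarrow> M \<inter> B = {} \<longrightarrow>
        (\<forall>z\<in>obj X (A \<union> M \<union> B).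
           lres X (A \<union> M) M (rres X (A \<union> M \<union> B) (A \<union> M) z) =
           rres X (M \<union> B) M (lres X (A \<union> M \<union> B) (M \<union> B) z)))"


(* lin X I is X[I]; llres and lrres extend the restrictions z // T and z \ \ S to it linearly *)
abbreviation lin :: "'x set_bicomodule \<Rightarrow> nat set \<Rightarrow> ('x \<Rightarrow>\<^sub>0 'k::{comm_ring,comm_monoid_mult}) set" where
  "lin X I \<equiv> free_module (obj X I)"

definition ltrans :: "'x set_bicomodule \<Rightarrow> nat set \<Rightarrow> (nat \<Rightarrow> nat) \<Rightarrow>
    ('x \<Rightarrow>\<^sub>0 'k::{comm_ring,comm_monoid_mult}) \<Rightarrow> ('x \<Rightarrow>\<^sub>0 'k)" where
  "ltrans X I \<sigma> = push (trans X I \<sigma>)"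

definition llres :: "'x set_bicomodule \<Rightarrow> nat set \<Rightarrow> nat set \<Rightarrow>
    ('x \<Rightarrow>\<^sub>0 'k::{comm_ring,comm_monoid_mult}) \<Rightarrow> ('x \<Rightarrow>\<^sub>0 'k)" where
  "llres X I T = push (lres X I T)"

definition lrres :: "'x set_bicomodule \<Rightarrow> nat set \<Rightarrow> nat set \<Rightarrow>
    ('x \<Rightarrow>\<^sub>0 'k::{comm_ring,comm_monoid_mult}) \<Rightarrow> ('x \<Rightarrow>\<^sub>0 'k)" where
  "lrres X I S = push (rres X I S)"

definition cosymmetric :: "'k::{comm_ring,comm_monoid_mult} itself \<Rightarrow> 'x set_bicomodule \<Rightarrow> bool" where
  "cosymmetric _ X \<longleftrightarrow>
     (\<forall>I S. finite I \<longrightarrow> S \<subseteq> I \<longrightarrow>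
        (\<forall>v::'x \<Rightarrow>\<^sub>0 'k. v \<in> lin X I \<longrightarrow> llres X I S v = lrres X I S v))"


section \<open>Weak projectivity\<close>

(* A module over the group ring of S_j is a k-module (here: a submodule of some 'a \<Rightarrow>\<^sub>0 'k) with a
   linear action of the permutations of {1..j}, and a homomorphism is an equivariant linear map. *)
definition equivariant_hom :: "nat \<Rightarrow>
    ('a \<Rightarrow>\<^sub>0 'k::{comm_ring,comm_monoid_mult}) set \<Rightarrow> ((nat \<Rightarrow> nat) \<Rightarrow> ('a \<Rightarrow>\<^sub>0 'k) \<Rightarrow> ('a \<Rightarrow>\<^sub>0 'k)) \<Rightarrow>
    ('b \<Rightarrow>\<^sub>0 'k) set \<Rightarrow> ((nat \<Rightarrow> nat) \<Rightarrow> ('b \<Rightarrow>\<^sub>0 'k) \<Rightarrow> ('b \<Rightarrow>\<^sub>0 'k)) \<Rightarrow>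
    (('a \<Rightarrow>\<^sub>0 'k) \<Rightarrow> ('b \<Rightarrow>\<^sub>0 'k)) \<Rightarrow> bool" where
  "equivariant_hom j M act N act' h \<longleftrightarrow>
     (\<forall>v\<in>M. h v \<in> N) \<and>
     (\<forall>v\<in>M. \<forall>w\<in>M. h (v + w) = h v + h w) \<and>
     (\<forall>c. \<forall>v\<in>M. h (scale c v) = scale c (h v)) \<and>
     (\<forall>\<sigma>. \<sigma> permutes {1..j} \<longrightarrow> (\<forall>v\<in>M. h (act \<sigma> v) = act' \<sigma> (h v)))"

(* the free module over the group ring of S_j with basis B: its k-basis is S_j \<times> B *)
definition free_sym_module :: "nat \<Rightarrow> 'b set \<Rightarrow>
    ((nat \<Rightarrow> nat) \<times> 'b \<Rightarrow>\<^sub>0 'k::{comm_ring,comm_monoid_mult}) set" where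
  "free_sym_module j B = free_module ({\<sigma>. \<sigma> permutes {1..j}} \<times> B)"

definition free_sym_action :: "(nat \<Rightarrow> nat) \<Rightarrow>
    ((nat \<Rightarrow> nat) \<times> 'b \<Rightarrow>\<^sub>0 'k::{comm_ring,comm_monoid_mult}) \<Rightarrow> ((nat \<Rightarrow> nat) \<times> 'b \<Rightarrow>\<^sub>0 'k)" where
  "free_sym_action \<sigma> = push (\<lambda>(\<tau>, b). (\<sigma> \<circ> \<tau>, b))"

(* Projective: a direct summand of a free module. Restricting the bases B to subsets of the type
   of the elements of M loses nothing: a projective M is a direct summand of the free module on
   the underlying set of M. *)
definition projective_sym_module :: "nat \<Rightarrow>
    ('a \<Rightarrow>\<^sub>0 'k::{comm_ring,comm_monoid_mult}) set \<Rightarrow> ((nat \<Rightarrow> nat) \<Rightarrow> ('a \<Rightarrow>\<^sub>0 'k) \<Rightarrow> ('a \<Rightarrow>\<^sub>0 'k)) \<Rightarrow> bool" where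
  "projective_sym_module j M act \<longleftrightarrow>
     (\<exists>(B :: ('a \<Rightarrow>\<^sub>0 'k) set) s r.
        equivariant_hom j M act (free_sym_module j B) free_sym_action s \<and>
        equivariant_hom j (free_sym_module j B) free_sym_action M act r \<and>
        (\<forall>v\<in>M. r (s v) = v))"

definition weakly_projective :: "'k::{comm_ring,comm_monoid_mult} itself \<Rightarrow> 'x set_bicomodule \<Rightarrow> bool" where
  "weakly_projective _ X \<longleftrightarrow>
     (\<forall>j. projective_sym_module j (lin X {1..j} :: ('x \<Rightarrow>\<^sub>0 'k) set) (ltrans X {1..j}))"


section \<open>Graded algebras\<close>

(* A graded algebra is given by its homogeneous components and the operations on them. *)
record ('k, 'a) graded_algebra =
  gcarrier :: "nat \<Rightarrow> 'a set"
  gadd :: "nat \<Rightarrow> 'a \<Rightarrow> 'a \<Rightarrow> 'a"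
  gscale :: "nat \<Rightarrow> 'k \<Rightarrow> 'a \<Rightarrow> 'a"
  gmult :: "nat \<Rightarrow> nat \<Rightarrow> 'a \<Rightarrow> 'a \<Rightarrow> 'a"
  gone :: "'a"

definition graded_algebra_iso ::
    "('k, 'a) graded_algebra \<Rightarrow> ('k, 'b) graded_algebra \<Rightarrow> (nat \<Rightarrow> 'a \<Rightarrow> 'b) \<Rightarrow> bool" where
  "graded_algebra_iso A B \<phi> \<longleftrightarrow>
     (\<forall>p. bij_betw (\<phi> p) (gcarrier A p) (gcarrier B p)) \<and>
     (\<forall>p. \<forall>a\<in>gcarrier A p. \<forall>b\<in>gcarrier A p.
        gadd A p a b \<in> gcarrier A p \<and> \<phi> p (gadd A p a b) = gadd B p (\<phi> p a) (\<phi> p b)) \<and>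
     (\<forall>p c. \<forall>a\<in>gcarrier A p.
        gscale A p c a \<in> gcarrier A p \<and> \<phi> p (gscale A p c a) = gscale B p c (\<phi> p a)) \<and>
     (\<forall>p q. \<forall>a\<in>gcarrier A p. \<forall>b\<in>gcarrier A q.
        gmult A p q a b \<in> gcarrier A (p + q) \<and>
        \<phi> (p + q) (gmult A p q a b) = gmult B p q (\<phi> p a) (\<phi> q b)) \<and>
     gone A \<in> gcarrier A 0 \<and> \<phi> 0 (gone A) = gone B"

definition isomorphic_graded_algebras ::
    "('k, 'a) graded_algebra \<Rightarrow> ('k, 'b) graded_algebra \<Rightarrow> bool" where
  "isomorphic_graded_algebras A B \<longleftrightarrow> (\<exists>\<phi>. graded_algebra_iso A B \<phi>)"

definition graded_commutative :: "('k::{comm_ring,comm_monoid_mult}, 'a) graded_algebra \<Rightarrow> bool" where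
  "graded_commutative A \<longleftrightarrow>
     (\<forall>p q. \<forall>a\<in>gcarrier A p. \<forall>b\<in>gcarrier A q.
        gmult A p q a b = gscale A (p + q) ((- 1) ^ (p * q)) (gmult A q p b a))"


section \<open>Cohomology\<close>

definition decomposition :: "nat set \<Rightarrow> nat set list \<Rightarrow> bool" where
  "decomposition I F \<longleftrightarrow>
     \<Union>(set F) = I \<and> (\<forall>i<length F. \<forall>j<length F. i \<noteq> j \<longrightarrow> F ! i \<inter> F ! j = {})"

definition decompositions :: "nat \<Rightarrow> nat set list set" where
  "decompositions n = {F. length F = n \<and> (\<exists>I. finite I \<and> decomposition I F)}"

type_synonym ('x, 'k) cochain = "nat set list \<Rightarrow> ('x \<Rightarrow>\<^sub>0 'k) \<Rightarrow> 'k"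

(* Hom (X, E^n): \<alpha> [F_1, ..., F_n] v is the coefficient of e_{F_1} \<otimes> ... \<otimes> e_{F_n} in the image of
   v \<in> X[I]. The set I is the union of the F_i, so it need not be recorded. *)
definition cochains :: "'x set_bicomodule \<Rightarrow> nat \<Rightarrow> ('x, 'k::{comm_ring,comm_monoid_mult}) cochain set" where
  "cochains X n = {\<alpha>.
     (\<forall>F\<in>decompositions n. \<alpha> F \<in> linear_forms (obj X (\<Union>(set F)))) \<and>
     (\<forall>F. F \<notin> decompositions n \<longrightarrow> \<alpha> F = (\<lambda>v. 0)) \<and>
     (\<forall>F\<in>decompositions n. \<forall>\<sigma>. inj_on \<sigma> (\<Union>(set F)) \<longrightarrow>
        (\<forall>v\<in>lin X (\<Union>(set F)).
           \<alpha> (map (\<lambda>S. \<sigma> ` S) F) (ltrans X (\<Union>(set F)) \<sigma> v) = \<alpha> F v))}"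

definition coface :: "'x set_bicomodule \<Rightarrow> nat \<Rightarrow> nat \<Rightarrow>
    ('x, 'k::{comm_ring,comm_monoid_mult}) cochain \<Rightarrow> ('x, 'k) cochain" where
  "coface X n i \<alpha> F v =
     (let I = \<Union>(set F) in
      if i = 0 then \<alpha> (tl F) (llres X I (I - hd F) v)
      else if i = n + 1 then \<alpha> (butlast F) (lrres X I (I - last F) v)
      else \<alpha> (take (i - 1) F @ (F ! (i - 1) \<union> F ! i) # drop (i + 1) F) v)"

definition coboundary :: "'x set_bicomodule \<Rightarrow> nat \<Rightarrow>
    ('x, 'k::{comm_ring,comm_monoid_mult}) cochain \<Rightarrow> ('x, 'k) cochain" where
  "coboundary X n \<alpha> F v =
     (if F \<in> decompositions (n + 1) \<and> v \<in> lin X (\<Union>(set F))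
      then \<Sum>i\<le>n + 1. (- 1) ^ i * coface X n i \<alpha> F v else 0)"

definition cocycles :: "'x set_bicomodule \<Rightarrow> nat \<Rightarrow> ('x, 'k::{comm_ring,comm_monoid_mult}) cochain set" where
  "cocycles X n = {\<alpha> \<in> cochains X n. coboundary X n \<alpha> = (\<lambda>F v. 0)}"

fun coboundaries :: "'x set_bicomodule \<Rightarrow> nat \<Rightarrow> ('x, 'k::{comm_ring,comm_monoid_mult}) cochain set" where
  "coboundaries X 0 = {\<lambda>F v. 0}"
| "coboundaries X (Suc n) = coboundary X n ` cochains X n"

definition cup :: "'x set_bicomodule \<Rightarrow> nat \<Rightarrow> nat \<Rightarrow>
    ('x, 'k::{comm_ring,comm_monoid_mult}) cochain \<Rightarrow> ('x, 'k) cochain \<Rightarrow> ('x, 'k) cochain" where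
  "cup X p q \<alpha> \<beta> F =
     (if F \<in> decompositions (p + q)
      then let I = \<Union>(set F); S = \<Union>(set (take p F)); T = \<Union>(set (drop p F)) in
        linear_extension (obj X I)
          (\<lambda>z. \<alpha> (take p F) (basis (rres X I S z)) * \<beta> (drop p F) (basis (lres X I T z)))
      else (\<lambda>v. 0))"

definition cup_unit :: "'x set_bicomodule \<Rightarrow> ('x, 'k::{comm_ring,comm_monoid_mult}) cochain" where
  "cup_unit X F = (if F = [] then linear_extension (obj X {}) (\<lambda>z. 1) else (\<lambda>v. 0))"

definition cohomologous :: "'x set_bicomodule \<Rightarrow> nat \<Rightarrow>
    (('x, 'k::{comm_ring,comm_monoid_mult}) cochain \<times> ('x, 'k) cochain) set" where
  "cohomologous X n =
     {(\<alpha>, \<beta>). \<alpha> \<in> cocycles X n \<and> \<beta> \<in> cocycles X n \<and> (\<lambda>F v. \<alpha> F v - \<beta> F v) \<in> coboundaries X n}"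

definition cohomology_algebra :: "'x set_bicomodule \<Rightarrow>
    ('k::{comm_ring,comm_monoid_mult}, ('x, 'k) cochain set) graded_algebra" where
  "cohomology_algebra X =
     \<lparr> gcarrier = (\<lambda>n. cocycles X n // cohomologous X n),
       gadd = (\<lambda>n a b. \<Union>\<alpha>\<in>a. \<Union>\<beta>\<in>b. cohomologous X n `` {\<lambda>F v. \<alpha> F v + \<beta> F v}),
       gscale = (\<lambda>n c a. \<Union>\<alpha>\<in>a. cohomologous X n `` {\<lambda>F v. c * \<alpha> F v}),
       gmult = (\<lambda>p q a b. \<Union>\<alpha>\<in>a. \<Union>\<beta>\<in>b. cohomologous X (p + q) `` {cup X p q \<alpha> \<beta>}),
       gone = cohomologous X 0 `` {cup_unit X} \<rparr>"


section \<open>The Koszul complex\<close>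

(* Hom_{S_p} (X[p], sgn_p) *)
definition koszul :: "'x set_bicomodule \<Rightarrow> nat \<Rightarrow>
    (('x \<Rightarrow>\<^sub>0 'k::{comm_ring,comm_monoid_mult}) \<Rightarrow> 'k) set" where
  "koszul X p = {f \<in> linear_forms (obj X {1..p}).
     \<forall>\<sigma>. \<sigma> permutes {1..p} \<longrightarrow>
       (\<forall>v\<in>lin X {1..p}. f (ltrans X {1..p} \<sigma> v) = (if evenperm \<sigma> then f v else - f v))}"

(* the order-preserving bijection from a finite set S onto {1..card S} *)
definition std_bij :: "nat set \<Rightarrow> nat \<Rightarrow> nat" where
  "std_bij S x = card {y \<in> S. y \<le> x}"

definition koszul_differential :: "'x set_bicomodule \<Rightarrow> nat \<Rightarrow>
    (('x \<Rightarrow>\<^sub>0 'k::{comm_ring,comm_monoid_mult}) \<Rightarrow> 'k) \<Rightarrow> ('x \<Rightarrow>\<^sub>0 'k) \<Rightarrow> 'k" where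
  "koszul_differential X p f v =
     (if v \<in> lin X {1..p+1}
      then \<Sum>i=1..p+1. let S = {1..p+1} - {i} in
        (- 1) ^ (i - 1) * (f (ltrans X S (std_bij S) (lrres X {1..p+1} S v))
                         - f (ltrans X S (std_bij S) (llres X {1..p+1} S v)))
      else 0)"

(* So for cosymmetric X the Koszul complex is just a graded module. *)
lemma koszul_differential_zero:
  fixes X :: "'x set_bicomodule"
    and f :: "('x \<Rightarrow>\<^sub>0 'k::{comm_ring,comm_monoid_mult}) \<Rightarrow> 'k"
  assumes "cosymmetric TYPE('k) X"
  shows "koszul_differential X p f = (\<lambda>v. 0)"
proof
  fix v :: "'x \<Rightarrow>\<^sub>0 'k"
  have eq: "llres X {1..p+1} ({1..p+1} - {i}) v = lrres X {1..p+1} ({1..p+1} - {i}) v"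
    if "v \<in> lin X {1..p+1}" for i
    using assms[unfolded cosymmetric_def, rule_format, OF finite_atLeastAtMost Diff_subset that] .
  show "koszul_differential X p f v = 0"
    unfolding koszul_differential_def Let_def by (simp only: eq diff_self mult_zero_right sum.neutral_const if_cancel cong: if_cong)
qed

definition sch :: "nat set \<Rightarrow> nat set \<Rightarrow> nat" where
  "sch S T = card {(s, t). s \<in> S \<and> t \<in> T \<and> s > t}"

definition koszul_cup :: "'x set_bicomodule \<Rightarrow> nat \<Rightarrow> nat \<Rightarrow>
    (('x \<Rightarrow>\<^sub>0 'k::{comm_ring,comm_monoid_mult}) \<Rightarrow> 'k) \<Rightarrow> (('x \<Rightarrow>\<^sub>0 'k) \<Rightarrow> 'k) \<Rightarrow> ('x \<Rightarrow>\<^sub>0 'k) \<Rightarrow> 'k" where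
  "koszul_cup X p q f g =
     (let I = {1..p+q} in
      linear_extension (obj X I)
        (\<lambda>z. \<Sum>(S, T) \<in> {(S, T). decomposition I [S, T] \<and> card S = p \<and> card T = q}.
           (- 1) ^ sch S T * (f (basis (trans X S (std_bij S) (rres X I S z)))
                            * g (basis (trans X T (std_bij T) (lres X I T z))))))"

definition koszul_algebra :: "'x set_bicomodule \<Rightarrow>
    ('k::{comm_ring,comm_monoid_mult}, ('x \<Rightarrow>\<^sub>0 'k) \<Rightarrow> 'k) graded_algebra" where
  "koszul_algebra X =
     \<lparr> gcarrier = koszul X,
       gadd = (\<lambda>p f g v. f v + g v),
       gscale = (\<lambda>p c f v. c * f v),
       gmult = koszul_cup X,
       gone = linear_extension (obj X {}) (\<lambda>z. 1) \<rparr>"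

end

theory Submission
  imports Defs "HOL-Combinatorics.Multiset_Permutations"
begin

text \<open>
  The isomorphism is induced by alternation. For a cochain \<open>\<alpha>\<close> of degree \<open>p\<close> and \<open>z\<close> in \<open>X[p]\<close>,
  its alternation is the sum of \<open>\<alpha>({x\<^sub>1}, ..., {x\<^sub>p})(z)\<close> over all orderings
  \<open>x\<^sub>1, ..., x\<^sub>p\<close> of \<open>{1..p}\<close>, with the sign of the ordering; it belongs to the Koszul complex.
  Alternation is strictly multiplicative: cutting an ordering of \<open>{1..p+q}\<close> after \<open>p\<close> entries gives a
  pair \<open>(S, T)\<close> with an ordering of each part, and the inversions between the parts are counted by
  \<open>sch S T\<close> (\<open>koszul_cup_alternation\<close>). It kills coboundaries: an inner face takes the same
  value on two orderings that differ by an exchange of neighbours, and the two outer faces are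
  exchanged by rotating the ordering, because \<open>X\<close> is cosymmetric (\<open>alternation_coboundary\<close>).

  It remains to see that on cocycles alternation is onto (\<open>alternation_surjective\<close>) and that its
  kernel consists of coboundaries (\<open>cocycle_is_coboundary\<close>). Two cocycles are then cohomologous
  exactly if they have the same alternation, so that the cohomology algebra with all its operations is
  the Koszul complex, and graded commutativity follows from \<open>sch S T + sch T S = p q\<close>. Both
  statements use projectivity in the form of Higman's criterion: there is a linear endomorphism \<open>\<theta>\<close>
  of \<open>X[n]\<close> such that the sum of all \<open>\<sigma> \<theta> \<sigma>\<^sup>-\<^sup>1\<close> is the identity
  (\<open>projective_sym_module_trace\<close>).

  For surjectivity, a linear form \<open>h\<close> on \<open>X[p]\<close> defines a cochain by summing the values of \<open>h\<close> on
  the restrictions of \<open>z\<close> to all transversals of the blocks. This is a cocycle by telescoping, again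
  because \<open>X\<close> is cosymmetric, and for \<open>h = f \<circ> \<theta>\<close> its alternation is \<open>f\<close>.

  For the kernel, let \<open>\<alpha>\<close> be a cocycle that vanishes on sets with fewer than \<open>m\<close> elements. On a set
  with \<open>m\<close> elements an outer face then counts only if it removes an empty block, and \<open>\<alpha>\<close> gives,
  for each basis element of \<open>X[m]\<close>, a cocycle in a complex of functions on colourings of \<open>{1..m}\<close>:
  the reduced cochains of the smash product of \<open>m\<close> circles. This complex has cohomology in degree \<open>m\<close>
  only, where it is detected by alternation (\<open>colour_complex_exact\<close>). Primitives chosen separately
  for the basis elements are made equivariant by means of \<open>\<theta>\<close>, and subtracting the coboundary of
  the result from \<open>\<alpha>\<close> raises \<open>m\<close>. The corrections for different \<open>m\<close> live on sets of different
  sizes, so that they can all be added up.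

  Throughout, a decomposition of \<open>I\<close> into \<open>n\<close> blocks is treated as a colouring \<open>\<phi>\<close> of \<open>I\<close> with the
  colours \<open>1, ..., n\<close>. If elements with other colours are discarded by restriction, then every face
  map, inner or outer, is composition of \<open>\<phi>\<close> with one function \<open>merge k\<close>.
\<close>

section \<open>Signs and inversions of lists\<close>

text \<open>
  The factor \<open>(- 1) ^ n\<close>, for values in an abelian group without multiplication.
\<close>

definition signed :: "nat \<Rightarrow> 'a::ab_group_add \<Rightarrow> 'a" where
  "signed n a = (if even n then a else - a)"

lemma signed_0 [simp]: "signed 0 a = a"
  by (simp add: signed_def)

lemma signed_Suc [simp]: "signed (Suc n) a = - signed n a"
  by (simp add: signed_def)

lemma signed_zero [simp]: "signed n 0 = 0"
  by (simp add: signed_def)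

lemma signed_plus: "signed n (a + b) = signed n a + signed n b"
  by (simp add: signed_def)

lemma signed_minus [simp]: "signed n (- a) = - signed n a"
  by (simp add: signed_def)

lemma signed_signed [simp]: "signed m (signed n a) = signed (m + n) a"
  by (auto simp: signed_def)

lemma signed_parity: "even m = even n \<Longrightarrow> signed m a = signed n a"
  by (simp add: signed_def)

lemma signed_sum: "signed n (sum f A) = (\<Sum>x\<in>A. signed n (f x))"
  by (simp add: signed_def sum_negf)

lemma signed_mult_left: "signed n a * b = signed n (a * b)"
  for a b :: "'k::{comm_ring,comm_monoid_mult}"
  by (simp add: signed_def)

lemma signed_mult_right: "a * signed n b = signed n (a * b)"
  for a b :: "'k::{comm_ring,comm_monoid_mult}"
  by (simp add: signed_def)

lemma minus_one_power_mult: "(- 1) ^ n * a = signed n a"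
  for a :: "'k::{comm_ring,comm_monoid_mult}"
  by (induction n) (simp_all add: mult.assoc)

text \<open>
  Over a ring in which 2 is not invertible, \<open>sum f S = - sum f S\<close> does not give
  \<open>sum f S = 0\<close>; the predicate \<open>P\<close> picks one element from each orbit of the involution.
\<close>

lemma sum_sign_reversing_involution:
  fixes f :: "'b \<Rightarrow> 'a::ab_group_add"
  assumes "finite S"
    and g: "\<And>x. x \<in> S \<Longrightarrow> g x \<in> S" "\<And>x. x \<in> S \<Longrightarrow> g (g x) = x"
    and P: "\<And>x. x \<in> S \<Longrightarrow> P (g x) = (\<not> P x)"
    and f: "\<And>x. x \<in> S \<Longrightarrow> f (g x) = - f x"
  shows "sum f S = 0"
proof -
  have "sum f {x \<in> S. \<not> P x} = (\<Sum>x\<in>{x \<in> S. P x}. - f x)"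
    by (rule sum.reindex_bij_witness[of _ g g]) (auto simp: g P f)
  moreover have "sum f S = sum f {x \<in> S. P x} + sum f {x \<in> S. \<not> P x}"
  proof -
    have "sum f S = sum f ({x \<in> S. P x} \<union> {x \<in> S. \<not> P x})"
      by (rule sum.cong) auto
    also have "\<dots> = sum f {x \<in> S. P x} + sum f {x \<in> S. \<not> P x}"
      using \<open>finite S\<close> by (intro sum.union_disjoint) auto
    finally show ?thesis .
  qed
  ultimately show ?thesis
    by (simp add: sum_negf)
qed

fun inversions :: "nat list \<Rightarrow> nat" where
  "inversions [] = 0"
| "inversions (x # xs) = length (filter (\<lambda>y. y < x) xs) + inversions xs"

definition cross_inversions :: "nat list \<Rightarrow> nat list \<Rightarrow> nat" where
  "cross_inversions xs ys = (\<Sum>x\<leftarrow>xs. length (filter (\<lambda>y. y < x) ys))"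

lemma cross_inversions_simps [simp]:
  "cross_inversions [] ys = 0"
  "cross_inversions (x # xs) ys = length (filter (\<lambda>y. y < x) ys) + cross_inversions xs ys"
  "cross_inversions xs [] = 0"
  by (simp_all add: cross_inversions_def)

lemma cross_inversions_append_right:
  "cross_inversions xs (ys @ zs) = cross_inversions xs ys + cross_inversions xs zs"
  by (induction xs) auto

lemma cross_inversions_Cons_right:
  "cross_inversions xs (y # zs) = cross_inversions xs [y] + cross_inversions xs zs"
  using cross_inversions_append_right[of xs "[y]" zs] by simp

lemma inversions_append:
  "inversions (xs @ ys) = inversions xs + inversions ys + cross_inversions xs ys"
  by (induction xs) auto

lemma cross_inversions_sch:
  assumes "distinct xs" "distinct ys"
  shows "cross_inversions xs ys = sch (set xs) (set ys)"
proof -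
  have "cross_inversions xs ys = (\<Sum>x\<in>set xs. card {t \<in> set ys. t < x})"
    unfolding cross_inversions_def using assms
    by (simp add: sum_list_distinct_conv_sum_set distinct_length_filter Int_def conj_commute)
  also have "\<dots> = card (SIGMA x:set xs. {t \<in> set ys. t < x})"
    by (simp add: card_SigmaI)
  also have "(SIGMA x:set xs. {t \<in> set ys. t < x}) = {(s, t). s \<in> set xs \<and> t \<in> set ys \<and> s > t}"
    by auto
  finally show ?thesis
    by (simp add: sch_def)
qed

lemma filter_less_add_cross:
  "a \<notin> set ys \<Longrightarrow> length (filter (\<lambda>y. y < a) ys) + cross_inversions ys [a] = length ys"
  by (induction ys) auto

lemma sch_add_sch_swap:
  assumes "finite S" "finite T" "S \<inter> T = {}"
  shows "sch S T + sch T S = card S * card T"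
proof -
  let ?A = "{(s, t). s \<in> S \<and> t \<in> T \<and> s > t}" and ?B = "{(s, t). s \<in> S \<and> t \<in> T \<and> s < t}"
  have "sch T S = card ?B"
    unfolding sch_def by (rule bij_betw_same_card[of prod.swap]) (auto simp: bij_betw_def inj_on_def image_def)
  moreover have "card ?A + card ?B = card (?A \<union> ?B)"
    by (rule card_Un_disjoint[symmetric])
      (use assms in \<open>auto intro: finite_subset[of _ "S \<times> T"]\<close>)
  moreover have "?A \<union> ?B = S \<times> T"
    using assms(3) by (auto simp: neq_iff)
  ultimately show ?thesis
    by (simp add: sch_def card_cartesian_product)
qed

text \<open>
  Exchanging two entries \<open>a\<close> and \<open>b\<close> reverses their own order, and the inversions that one of
  them forms with an entry between them are complementary before and after the exchange.
\<close>

lemma inversions_swap: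
  assumes "distinct (u @ a # v @ b # w)"
  shows "even (inversions (u @ b # v @ a # w)) \<longleftrightarrow> odd (inversions (u @ a # v @ b # w))"
proof -
  have "a \<notin> set v" "b \<notin> set v" "a \<noteq> b"
    using assms by auto
  then have "length (filter (\<lambda>y. y < a) v) + cross_inversions v [a]
      = length (filter (\<lambda>y. y < b) v) + cross_inversions v [b]"
    by (simp add: filter_less_add_cross)
  then have "even (length (filter (\<lambda>y. y < a) v) + cross_inversions v [a] +
      (length (filter (\<lambda>y. y < b) v) + cross_inversions v [b]))"
    by simp
  then have parity: "even (K + (length (filter (\<lambda>y. y < b) v) + cross_inversions v [a] + q)) \<longleftrightarrow>
      odd (K + (length (filter (\<lambda>y. y < a) v) + cross_inversions v [b] + p))" if "p + q = 1" for K p q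
    using that by presburger
  define K where "K = inversions u + inversions v + inversions w + cross_inversions u v +
    cross_inversions u w + cross_inversions v w + cross_inversions u [a] + cross_inversions u [b] +
    cross_inversions [a] w + cross_inversions [b] w"
  have "inversions (u @ a # v @ b # w) =
      K + (length (filter (\<lambda>z. z < a) v) + cross_inversions v [b] + (if b < a then 1 else 0))"
    using inversions_append[of u "a # v @ b # w"] inversions_append[of v "b # w"]
    by (simp add: K_def cross_inversions_append_right cross_inversions_Cons_right[of u a "v @ b # w"]
        cross_inversions_Cons_right[of u b w] cross_inversions_Cons_right[of v b w])
  moreover have "inversions (u @ b # v @ a # w) =
      K + (length (filter (\<lambda>z. z < b) v) + cross_inversions v [a] + (if a < b then 1 else 0))"
    using inversions_append[of u "b # v @ a # w"] inversions_append[of v "a # w"]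
    by (simp add: K_def cross_inversions_append_right cross_inversions_Cons_right[of u b "v @ a # w"]
        cross_inversions_Cons_right[of u a w] cross_inversions_Cons_right[of v a w])
  moreover have "(if b < a then 1 else 0) + (if a < b then 1 else 0) = (1::nat)"
    using \<open>a \<noteq> b\<close> by auto
  ultimately show ?thesis
    using parity by presburger
qed

lemma inversions_map_transpose:
  assumes "distinct xs" "a \<in> set xs" "b \<in> set xs" "a \<noteq> b"
  shows "even (inversions (map (transpose a b) xs)) \<longleftrightarrow> odd (inversions xs)"
proof -
  have *: "even (inversions (map (transpose a b) xs)) \<longleftrightarrow> odd (inversions xs)"
    if xs: "xs = u @ a # v @ b # w" for a b u v w
  proof -
    have "map (transpose a b) u = u" "map (transpose a b) v = v" "map (transpose a b) w = w"
      using assms(1) unfolding xs by (auto intro!: map_idI simp: transpose_def)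
    then have "map (transpose a b) xs = u @ b # v @ a # w"
      by (simp add: xs)
    then show ?thesis
      using inversions_swap[of u a v b w] assms(1) xs by simp
  qed
  obtain u r where ur: "xs = u @ a # r"
    using assms(2) split_list by metis
  show ?thesis
  proof (cases "b \<in> set r")
    case True
    then obtain v w where "r = v @ b # w"
      using split_list by metis
    then show ?thesis
      using * ur by simp
  next
    case False
    then have "b \<in> set u"
      using ur assms(3,4) by auto
    then obtain v w where "u = v @ b # w"
      using split_list by metis
    then have "xs = v @ b # w @ a # r"
      using ur by simp
    then show ?thesis
      using *[of v b w a r] by (simp add: transpose_commute)
  qed
qed

text \<open>
  Composing \<open>\<sigma>\<close> with a transposition changes both sides, so they agree along a factorization of
  \<open>\<sigma>\<close> into transpositions.
\<close>

lemma inversions_map_permutes: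
  assumes "\<sigma> permutes set xs" "distinct xs"
  shows "even (inversions (map \<sigma> xs)) \<longleftrightarrow> (even (inversions xs) \<longleftrightarrow> evenperm \<sigma>)"
  using assms(1) finite_set
proof (induction rule: permutes_induct)
  case id
  then show ?case by simp
next
  case (swap a b p)
  have p: "permutation p"
    using \<open>p permutes set xs\<close> finite_set permutation_permutes by blast
  have "set (map p xs) = set xs"
    using \<open>p permutes set xs\<close> by (simp add: permutes_image)
  moreover have "distinct (map p xs)"
    using assms(2) \<open>p permutes set xs\<close> by (simp add: distinct_map permutes_inj_on)
  ultimately have "even (inversions (map (transpose a b \<circ> p) xs)) \<longleftrightarrow> odd (inversions (map p xs))"
    using inversions_map_transpose[of "map p xs" a b] swap.hyps by simp
  moreover have "evenperm (transpose a b \<circ> p) \<longleftrightarrow> \<not> evenperm p"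
    using swap.hyps by (simp add: evenperm_comp permutation_swap_id p evenperm_swap)
  ultimately show ?case
    using swap.IH by blast
qed

lemma inversions_map_strict_mono_on:
  assumes "strict_mono_on (set xs) f"
  shows "inversions (map f xs) = inversions xs"
  using assms
proof (induction xs)
  case (Cons x xs)
  have "strict_mono_on (set xs) f"
    using Cons.prems by (auto simp: monotone_on_def)
  moreover have "filter (\<lambda>y. f y < f x) xs = filter (\<lambda>y. y < x) xs"
    using Cons.prems by (intro filter_cong refl) (auto simp: strict_mono_on_less)
  ultimately show ?case
    using Cons.IH by (simp add: filter_map o_def)
qed simp


section \<open>Positions in a list\<close>

text \<open>
  Positions are counted from 1, as are the colours below. With the value 1 on the empty list,
  \<open>position_append\<close> holds for elements that occur in neither list as well.
\<close>

fun position :: "'a list \<Rightarrow> 'a \<Rightarrow> nat" where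
  "position [] y = 1"
| "position (x # xs) y = (if y = x then 1 else Suc (position xs y))"

definition entry :: "'a list \<Rightarrow> nat \<Rightarrow> 'a" where
  "entry xs k = xs ! (k - 1)"

lemma position_append:
  "position (xs @ ys) y = (if y \<in> set xs then position xs y else length xs + position ys y)"
  by (induction xs) auto

lemma position_ge_1: "1 \<le> position xs y"
  by (induction xs) auto

lemma position_le_length: "y \<in> set xs \<Longrightarrow> position xs y \<le> length xs"
  by (induction xs) auto

lemma position_mem: "y \<in> set xs \<Longrightarrow> position xs y \<in> {1..length xs}"
  using position_le_length[of y xs] position_ge_1[of xs y] by auto

lemma entry_position: "y \<in> set xs \<Longrightarrow> entry xs (position xs y) = y"
proof (induction xs)
  case (Cons x xs)
  then show ?case
    using position_ge_1[of xs y] by (auto simp: entry_def nth_Cons')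
qed simp

lemma position_entry:
  assumes "distinct xs" "k \<in> {1..length xs}"
  shows "position xs (entry xs k) = k"
  using assms
proof (induction xs arbitrary: k)
  case (Cons x xs)
  show ?case
  proof (cases "k = 1")
    case False
    then have k: "k - 1 \<in> {1..length xs}"
      using Cons.prems by auto
    then have "entry (x # xs) k = entry xs (k - 1)"
      using False Cons.prems(2) by (auto simp: entry_def nth_Cons')
    moreover have "entry xs (k - 1) \<in> set xs"
      using k by (auto simp: entry_def)
    ultimately show ?thesis
      using Cons.IH[of "k - 1"] Cons.prems k by auto
  qed (simp add: entry_def)
qed simp

lemma entry_mem: "k \<in> {1..length xs} \<Longrightarrow> entry xs k \<in> set xs"
  by (auto simp: entry_def)

lemma bij_betw_position: "distinct xs \<Longrightarrow> bij_betw (position xs) (set xs) {1..length xs}"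
  by (intro bij_betw_byWitness[where f' = "entry xs"] ballI image_subsetI)
    (rule entry_position position_entry position_mem entry_mem; assumption)+

lemma bij_betw_entry: "distinct xs \<Longrightarrow> bij_betw (entry xs) {1..length xs} (set xs)"
  by (intro bij_betw_byWitness[where f' = "position xs"] ballI image_subsetI)
    (rule entry_position position_entry position_mem entry_mem; assumption)+

lemma inj_on_position: "distinct xs \<Longrightarrow> inj_on (position xs) (set xs)"
  by (rule bij_betw_imp_inj_on[OF bij_betw_position])

lemma position_image: "distinct xs \<Longrightarrow> position xs ` set xs = {1..length xs}"
  by (rule bij_betw_imp_surj_on[OF bij_betw_position])

lemma inj_on_entry: "distinct xs \<Longrightarrow> inj_on (entry xs) {1..length xs}"
  by (rule bij_betw_imp_inj_on[OF bij_betw_entry])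

lemma entry_image: "distinct xs \<Longrightarrow> entry xs ` {1..length xs} = set xs"
  by (rule bij_betw_imp_surj_on[OF bij_betw_entry])

lemma position_map:
  "inj_on f (insert y (set xs)) \<Longrightarrow> position (map f xs) (f y) = position xs y"
proof (induction xs)
  case (Cons x xs)
  then have "inj_on f (insert y (set xs))" "f y = f x \<longleftrightarrow> y = x"
    by (auto simp: inj_on_def)
  then show ?case
    using Cons.IH by simp
qed simp

lemma permutations_of_set_iff:
  "finite A \<Longrightarrow> xs \<in> permutations_of_set A \<longleftrightarrow> set xs = A \<and> distinct xs"
  by (auto simp: permutations_of_set_def)

lemma permutations_of_setD:
  assumes "xs \<in> permutations_of_set A"
  shows "set xs = A" "distinct xs" "length xs = card A"
  using assms distinct_card[of xs] by (auto simp: permutations_of_set_def)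

lemma sum_permutations_of_set_image:
  assumes "inj_on \<sigma> A"
  shows "(\<Sum>xs\<in>permutations_of_set (\<sigma> ` A). g xs) = (\<Sum>xs\<in>permutations_of_set A. g (map \<sigma> xs))"
proof -
  have "inj_on (map \<sigma>) (permutations_of_set A)"
    using assms by (intro inj_on_mapI) (simp add: permutations_of_set_def)
  then show ?thesis
    by (simp add: permutations_of_set_image_inj[OF assms] sum.reindex)
qed

lemma sum_permutations_of_set_permutes:
  assumes "\<sigma> permutes A"
  shows "(\<Sum>xs\<in>permutations_of_set A. g xs) = (\<Sum>xs\<in>permutations_of_set A. g (map \<sigma> xs))"
  using sum_permutations_of_set_image[of \<sigma> A g] assms
  by (simp add: permutes_image permutes_inj_on)


(* Index ranges that end in Suc n are split by hand, often at both ends. *)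
declare sum.atMost_Suc [simp del] sum.cl_ivl_Suc [simp del]

section \<open>The complex of colourings\<close>

text \<open>
  This identifies the colours \<open>k\<close> and \<open>k + 1\<close>. Colours outside \<open>{1..n}\<close> stand for the base
  point, so \<open>merge 0\<close> and \<open>merge (n + 1)\<close> send the first and the last of \<open>n + 1\<close> colours to it.
\<close>

definition merge :: "nat \<Rightarrow> nat \<Rightarrow> nat" where
  "merge k v = (if v \<le> k then v else v - 1)"

text \<open>
  A function on the colourings \<open>J \<rightarrow> {1..n}\<close>, extended by zero. As the circle has \<open>n\<close> simplices of
  dimension \<open>n\<close> other than the base point, these are the reduced cochains of the smash product of
  circles indexed by \<open>J\<close>.
\<close>

definition colour_cochain :: "nat set \<Rightarrow> nat \<Rightarrow> ((nat \<Rightarrow> nat) \<Rightarrow> 'a::ab_group_add) \<Rightarrow> bool" where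
  "colour_cochain J n c \<longleftrightarrow>
     (\<forall>\<phi> \<psi>. (\<forall>i\<in>J. \<phi> i = \<psi> i) \<longrightarrow> c \<phi> = c \<psi>) \<and> (\<forall>\<phi>. \<not> \<phi> ` J \<subseteq> {1..n} \<longrightarrow> c \<phi> = 0)"

definition colour_diff :: "nat \<Rightarrow> ((nat \<Rightarrow> nat) \<Rightarrow> 'a::ab_group_add) \<Rightarrow> (nat \<Rightarrow> nat) \<Rightarrow> 'a" where
  "colour_diff n c \<phi> = (\<Sum>k\<le>Suc n. signed k (c (merge k \<circ> \<phi>)))"

lemma colour_cochain_cong: "colour_cochain J n c \<Longrightarrow> (\<And>i. i \<in> J \<Longrightarrow> \<phi> i = \<psi> i) \<Longrightarrow> c \<phi> = c \<psi>"
  by (auto simp: colour_cochain_def)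

lemma colour_cochain_outside: "colour_cochain J n c \<Longrightarrow> i \<in> J \<Longrightarrow> \<phi> i \<notin> {1..n} \<Longrightarrow> c \<phi> = 0"
  unfolding colour_cochain_def by blast

lemma merge_merge: "k \<le> l \<Longrightarrow> merge l (merge k v) = merge k (merge (Suc l) v)"
  by (auto simp: merge_def)

text \<open>
  The identity \<open>merge_merge\<close> matches the terms with \<open>k \<le> l\<close> with those with \<open>l < k\<close>, which have the
  opposite sign. All squares of differentials below vanish for this reason.
\<close>

lemma alternating_merge_merge_sum:
  fixes a :: "(nat \<Rightarrow> nat) \<Rightarrow> 'a::ab_group_add"
  shows "(\<Sum>k\<le>Suc (Suc n). \<Sum>l\<le>Suc n. signed (k + l) (a (merge l \<circ> (merge k \<circ> \<phi>)))) = 0"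
proof -
  let ?f = "\<lambda>(k, l). signed (k + l) (a (merge l \<circ> (merge k \<circ> \<phi>)))"
  let ?A = "{(k, l). k \<le> l \<and> l \<le> Suc n}" and ?B = "{(k, l). l < k \<and> k \<le> Suc (Suc n)}"
  have fin: "finite ?A" "finite ?B"
    by (auto intro: finite_subset[of _ "{..Suc (Suc n)} \<times> {..Suc (Suc n)}"])
  have merge_swap: "merge (l - Suc 0) \<circ> (merge k \<circ> \<phi>) = merge k \<circ> (merge l \<circ> \<phi>)" if "k < l" for k l
    using merge_merge[of k "l - 1"] that by (auto simp: fun_eq_iff)
  have "(\<Sum>k\<le>Suc (Suc n). \<Sum>l\<le>Suc n. signed (k + l) (a (merge l \<circ> (merge k \<circ> \<phi>)))) =
      sum ?f ({..Suc (Suc n)} \<times> {..Suc n})"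
    by (simp add: sum.cartesian_product)
  also have "{..Suc (Suc n)} \<times> {..Suc n} = ?A \<union> ?B"
    by auto
  also have "sum ?f (?A \<union> ?B) = sum ?f ?A + sum ?f ?B"
    using fin by (intro sum.union_disjoint) auto
  also have "sum ?f ?B = (\<Sum>x\<in>?A. - ?f x)"
    by (rule sum.reindex_bij_witness[of _ "\<lambda>(k, l). (Suc l, k)" "\<lambda>(k, l). (l, k - 1)"])
      (auto simp: merge_swap add.commute simp flip: signed_Suc)
  finally show ?thesis
    by (simp only: sum_negf right_minus)
qed

lemma colour_diff_colour_diff [simp]: "colour_diff (Suc n) (colour_diff n c) = (\<lambda>\<phi>. 0)"
proof
  fix \<phi> :: "nat \<Rightarrow> nat"
  show "colour_diff (Suc n) (colour_diff n c) \<phi> = 0"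
    unfolding colour_diff_def signed_sum signed_signed
    using alternating_merge_merge_sum[of c \<phi> n] by simp
qed

lemma colour_diff_zero [simp]: "colour_diff n (\<lambda>\<phi>. 0) = (\<lambda>\<phi>. 0)"
  by (simp add: colour_diff_def fun_eq_iff)

lemma colour_diff_add: "colour_diff n (\<lambda>\<phi>. c \<phi> + c' \<phi>) = (\<lambda>\<phi>. colour_diff n c \<phi> + colour_diff n c' \<phi>)"
  by (simp add: colour_diff_def fun_eq_iff signed_plus sum.distrib)

lemma colour_diff_uminus: "colour_diff n (\<lambda>\<phi>. - c \<phi>) = (\<lambda>\<phi>. - colour_diff n c \<phi>)"
  by (simp add: colour_diff_def fun_eq_iff sum_negf)

lemma colour_diff_diff: "colour_diff n (\<lambda>\<phi>. c \<phi> - c' \<phi>) = (\<lambda>\<phi>. colour_diff n c \<phi> - colour_diff n c' \<phi>)"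
  using colour_diff_add[of n c "\<lambda>\<phi>. - c' \<phi>"] by (simp add: colour_diff_uminus)

lemma merge_in_range: "merge k v \<in> {1..n} \<Longrightarrow> k \<le> Suc n \<Longrightarrow> v \<in> {1..Suc n}"
  by (auto simp: merge_def split: if_splits)

lemma colour_cochain_colour_diff:
  assumes "colour_cochain J n c"
  shows "colour_cochain J (Suc n) (colour_diff n c)"
  unfolding colour_cochain_def
proof (intro conjI allI impI)
  fix \<phi> \<psi> :: "nat \<Rightarrow> nat"
  assume "\<forall>i\<in>J. \<phi> i = \<psi> i"
  then have "c (merge k \<circ> \<phi>) = c (merge k \<circ> \<psi>)" for k
    by (intro colour_cochain_cong[OF assms]) simp
  then show "colour_diff n c \<phi> = colour_diff n c \<psi>"
    by (simp add: colour_diff_def)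
next
  fix \<phi> :: "nat \<Rightarrow> nat"
  assume "\<not> \<phi> ` J \<subseteq> {1..Suc n}"
  then obtain i where i: "i \<in> J" "\<phi> i \<notin> {1..Suc n}"
    by blast
  have "c (merge k \<circ> \<phi>) = 0" if "k \<le> Suc n" for k
    using i(2) merge_in_range[of k "\<phi> i" n] that
    by (intro colour_cochain_outside[OF assms i(1)]) auto
  then show "colour_diff n c \<phi> = 0"
    by (simp add: colour_diff_def)
qed

text \<open>
  The factor of the smash product that belongs to \<open>x\<close> is split off as follows. Inserting a new colour
  for \<open>x\<close> in all possible places is a shuffle map (\<open>extract_colour\<close>), and \<open>append_colour\<close> is the
  product with the fundamental class of the circle. The homotopy inserts the colour of \<open>x\<close> only
  in front of its present place; its values have to be set to zero when \<open>x\<close> is out of range.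
\<close>

definition insert_colour :: "'b \<Rightarrow> nat \<Rightarrow> ('b \<Rightarrow> nat) \<Rightarrow> 'b \<Rightarrow> nat" where
  "insert_colour x m \<phi> = (\<lambda>i. if i = x then m else if \<phi> i < m then \<phi> i else Suc (\<phi> i))"

definition homotopy :: "nat \<Rightarrow> nat \<Rightarrow> ((nat \<Rightarrow> nat) \<Rightarrow> 'a::ab_group_add) \<Rightarrow> (nat \<Rightarrow> nat) \<Rightarrow> 'a" where
  "homotopy n x c \<phi> = (if \<phi> x \<le> n then \<Sum>m=1..\<phi> x. signed m (c (insert_colour x m \<phi>)) else 0)"

definition extract_colour :: "nat \<Rightarrow> nat \<Rightarrow> ((nat \<Rightarrow> nat) \<Rightarrow> 'a::ab_group_add) \<Rightarrow> (nat \<Rightarrow> nat) \<Rightarrow> 'a" where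
  "extract_colour n x c \<phi> = (\<Sum>m=1..n. signed (n + m) (c (insert_colour x m \<phi>)))"

definition append_colour ::
    "nat set \<Rightarrow> nat \<Rightarrow> nat \<Rightarrow> ((nat \<Rightarrow> nat) \<Rightarrow> 'a::ab_group_add) \<Rightarrow> (nat \<Rightarrow> nat) \<Rightarrow> 'a" where
  "append_colour J x n c \<phi> = (if \<phi> x = n \<and> (\<forall>i\<in>J. \<phi> i \<noteq> n) then c \<phi> else 0)"

lemma insert_colour_merge_less:
  "k < m \<Longrightarrow> insert_colour x m (merge k \<circ> \<phi>) = merge k \<circ> insert_colour x (Suc m) \<phi>"
  by (auto simp: insert_colour_def merge_def fun_eq_iff)

lemma insert_colour_merge_ge:
  "m \<le> k \<Longrightarrow> insert_colour x m (merge k \<circ> \<phi>) = merge (Suc k) \<circ> insert_colour x m \<phi>"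
  by (auto simp: insert_colour_def merge_def fun_eq_iff)

lemma merge_insert_colour: "merge m \<circ> insert_colour x m \<phi> = \<phi>(x := m)"
  by (auto simp: insert_colour_def merge_def fun_eq_iff)

lemma merge_insert_colour_Suc: "merge m \<circ> insert_colour x (Suc m) \<phi> = \<phi>(x := m)"
  by (auto simp: insert_colour_def merge_def fun_eq_iff)

lemma colour_cochain_homotopy:
  assumes c: "colour_cochain (insert x J) (Suc n) c"
  shows "colour_cochain (insert x J) n (homotopy n x c)"
  unfolding colour_cochain_def
proof (intro conjI allI impI)
  fix \<phi> \<psi> :: "nat \<Rightarrow> nat"
  assume *: "\<forall>i\<in>insert x J. \<phi> i = \<psi> i"
  then have "c (insert_colour x m \<phi>) = c (insert_colour x m \<psi>)" for m
    by (intro colour_cochain_cong[OF c]) (auto simp: insert_colour_def)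
  then show "homotopy n x c \<phi> = homotopy n x c \<psi>"
    using * by (simp add: homotopy_def)
next
  fix \<phi> :: "nat \<Rightarrow> nat"
  assume "\<not> \<phi> ` insert x J \<subseteq> {1..n}"
  then consider "\<phi> x = 0" | "\<phi> x > n" | i where "i \<in> J" "i \<noteq> x" "\<phi> i \<notin> {1..n}" "\<phi> x \<le> n"
    by force
  then show "homotopy n x c \<phi> = 0"
  proof cases
    case 3
    have "c (insert_colour x m \<phi>) = 0" if "m \<in> {1..\<phi> x}" for m
      using 3 that by (intro colour_cochain_outside[OF c, of i]) (auto simp: insert_colour_def)
    then show ?thesis
      by (simp add: homotopy_def)
  qed (simp_all add: homotopy_def)
qed

lemma colour_cochain_extract_colour:
  assumes c: "colour_cochain (insert x J) (Suc n) c" and "x \<notin> J"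
  shows "colour_cochain J n (extract_colour (Suc n) x c)"
  unfolding colour_cochain_def
proof (intro conjI allI impI)
  fix \<phi> \<psi> :: "nat \<Rightarrow> nat"
  assume *: "\<forall>i\<in>J. \<phi> i = \<psi> i"
  then have "c (insert_colour x m \<phi>) = c (insert_colour x m \<psi>)" for m
    by (intro colour_cochain_cong[OF c]) (auto simp add: insert_colour_def)
  then show "extract_colour (Suc n) x c \<phi> = extract_colour (Suc n) x c \<psi>"
    by (simp add: extract_colour_def)
next
  fix \<phi> :: "nat \<Rightarrow> nat"
  assume "\<not> \<phi> ` J \<subseteq> {1..n}"
  then obtain i where i: "i \<in> J" "\<phi> i \<notin> {1..n}"
    by blast
  have "c (insert_colour x m \<phi>) = 0" if "m \<in> {1..Suc n}" for m
    using i that \<open>x \<notin> J\<close> by (intro colour_cochain_outside[OF c, of i]) (auto simp: insert_colour_def)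
  then show "extract_colour (Suc n) x c \<phi> = 0"
    by (simp add: extract_colour_def)
qed

lemma colour_cochain_append_colour:
  assumes c: "colour_cochain J n c"
  shows "colour_cochain (insert x J) (Suc n) (append_colour J x (Suc n) c)"
  unfolding colour_cochain_def
proof (intro conjI allI impI)
  fix \<phi> \<psi> :: "nat \<Rightarrow> nat"
  assume *: "\<forall>i\<in>insert x J. \<phi> i = \<psi> i"
  then have "c \<phi> = c \<psi>"
    by (intro colour_cochain_cong[OF c]) auto
  then show "append_colour J x (Suc n) c \<phi> = append_colour J x (Suc n) c \<psi>"
    using * by (simp add: append_colour_def)
next
  fix \<phi> :: "nat \<Rightarrow> nat"
  assume "\<not> \<phi> ` insert x J \<subseteq> {1..Suc n}"
  then consider "\<phi> x \<notin> {1..Suc n}" | i where "i \<in> J" "\<phi> i \<notin> {1..Suc n}"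
    by blast
  then show "append_colour J x (Suc n) c \<phi> = 0"
  proof cases
    case 2
    then have "c \<phi> = 0"
      by (intro colour_cochain_outside[OF c, of i]) auto
    then show ?thesis
      by (simp add: append_colour_def)
  qed (auto simp: append_colour_def)
qed

text \<open>
  Let \<open>N = n + 1\<close>. If \<open>x\<close> has the colour \<open>N + 1\<close>, which no other element has, then the last face
  sends \<open>x\<close> to the base point and the remaining ones are the faces of \<open>c\<close>. If \<open>x\<close> has the colour \<open>N\<close>, then only
  the last two faces can contribute, and they cancel.
\<close>

lemma colour_diff_append_colour:
  assumes c: "colour_cochain J n c"
  shows "colour_diff (Suc n) (append_colour J x (Suc n) c) = append_colour J x (Suc (Suc n)) (colour_diff n c)"
proof
  fix \<phi> :: "nat \<Rightarrow> nat"
  let ?N = "Suc n"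
  let ?a = "append_colour J x ?N c"
  consider "\<phi> x = Suc ?N" "\<exists>i\<in>J. \<phi> i = Suc ?N" | "\<phi> x = Suc ?N" "\<forall>i\<in>J. \<phi> i \<noteq> Suc ?N"
    | "\<phi> x = ?N" | "\<phi> x < ?N" | "\<phi> x > Suc ?N"
    by force
  then show "colour_diff ?N ?a \<phi> = append_colour J x (Suc ?N) (colour_diff n c) \<phi>"
  proof cases
    case 1
    then obtain i where i: "i \<in> J" "\<phi> i = Suc ?N"
      by blast
    have "?a (merge k \<circ> \<phi>) = 0" if "k \<le> Suc ?N" for k
      using 1(1) i that by (auto simp: append_colour_def merge_def)
    then show ?thesis
      using 1 i by (auto simp: colour_diff_def append_colour_def)
  next
    case 2
    have *: "?a (merge k \<circ> \<phi>) = c (merge k \<circ> \<phi>)" if "k \<le> ?N" for k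
    proof (cases "\<forall>i\<in>J. merge k (\<phi> i) \<noteq> ?N")
      case True
      then show ?thesis
        using 2 that by (simp add: append_colour_def merge_def)
    next
      case False
      then obtain i where i: "i \<in> J" "merge k (\<phi> i) = ?N"
        by blast
      then have "c (merge k \<circ> \<phi>) = 0"
        by (intro colour_cochain_outside[OF c, of i]) auto
      then show ?thesis
        by (simp add: append_colour_def)
    qed
    have "?a (merge (Suc ?N) \<circ> \<phi>) = 0"
      using 2 by (simp add: append_colour_def merge_def)
    then have "colour_diff ?N ?a \<phi> = (\<Sum>k\<le>?N. signed k (?a (merge k \<circ> \<phi>)))"
      unfolding colour_diff_def by (subst sum.atMost_Suc) simp
    also have "\<dots> = colour_diff n c \<phi>"
      unfolding colour_diff_def using * by (intro sum.cong) auto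
    finally show ?thesis
      using 2 by (simp add: append_colour_def)
  next
    case 3
    have 0: "?a (merge k \<circ> \<phi>) = 0" if "k \<le> n" for k
      using 3 that by (simp add: append_colour_def merge_def)
    have "?a (merge ?N \<circ> \<phi>) = ?a (merge (Suc ?N) \<circ> \<phi>)"
    proof (cases "\<exists>i\<in>J. \<phi> i > ?N")
      case True
      then obtain i where i: "i \<in> J" "\<phi> i > ?N"
        by blast
      then have "c (merge (Suc ?N) \<circ> \<phi>) = 0"
        by (intro colour_cochain_outside[OF c, of i]) (auto simp: merge_def)
      moreover have "?a (merge ?N \<circ> \<phi>) = 0"
      proof (cases "\<phi> i = Suc ?N")
        case True
        then show ?thesis
          using i by (auto simp: append_colour_def merge_def)
      next
        case False
        then have "c (merge ?N \<circ> \<phi>) = 0"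
          using i by (intro colour_cochain_outside[OF c, of i]) (auto simp: merge_def)
        then show ?thesis
          by (simp add: append_colour_def)
      qed
      ultimately show ?thesis
        by (simp add: append_colour_def)
    next
      case False
      then have "merge ?N (\<phi> i) = merge (Suc ?N) (\<phi> i)" if "i \<in> insert x J" for i
        using 3 that by (auto simp: merge_def not_less)
      then show ?thesis
        by (intro colour_cochain_cong[OF colour_cochain_append_colour[OF c]]) simp
    qed
    with 0 have "colour_diff ?N ?a \<phi> = 0"
      by (simp add: colour_diff_def sum.atMost_Suc)
    then show ?thesis
      using 3 by (simp add: append_colour_def)
  next
    case 4
    then have "?a (merge k \<circ> \<phi>) = 0" for k
      by (auto simp: append_colour_def merge_def)
    then show ?thesis
      using 4 by (simp add: colour_diff_def append_colour_def)
  next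
    case 5
    have "?a (merge k \<circ> \<phi>) = 0" if "k \<le> Suc ?N" for k
      using 5 that by (auto simp: append_colour_def merge_def)
    then show ?thesis
      using 5 by (simp add: colour_diff_def append_colour_def)
  qed
qed

text \<open>
  Up to homotopy, a cochain is supported on the colourings in which \<open>x\<close> alone has the last colour.
  In the proof, the two terms that merge the colour inserted for \<open>x\<close> with a
  neighbouring colour telescope to \<open>c \<phi>\<close>, the merges of other colours cancel in pairs, and
  what is left comes from the last face map, which drops the last colour.
\<close>

lemma homotopy_identity:
  fixes c :: "(nat \<Rightarrow> nat) \<Rightarrow> 'a::ab_group_add"
  assumes c: "colour_cochain (insert x J) (Suc n) c" and "x \<notin> J"
    and \<phi>: "\<phi> ` insert x J \<subseteq> {1..Suc n}"
  shows "colour_diff n (homotopy n x c) \<phi> + homotopy (Suc n) x (colour_diff (Suc n) c) \<phi> =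
    c \<phi> - append_colour J x (Suc n) (extract_colour (Suc n) x c) \<phi>"
proof -
  define N where "N = Suc n"
  define i where "i = \<phi> x"
  have i: "1 \<le> i" "i \<le> N"
    using \<phi> by (auto simp: i_def N_def)
  define g where "g = (\<lambda>(m, k). signed (m + k) (c (merge k \<circ> insert_colour x m \<phi>)))"
  define low where "low = {(m, k). m \<in> {1..i} \<and> Suc k < m}"
  define high where "high = {(m, k). m \<in> {1..i} \<and> m < k \<and> k \<le> Suc N}"
  \<comment> \<open>the terms with no counterpart before the insertion, where the last face discards \<open>x\<close>\<close>
  define top where "top = (if i = N then (\<lambda>m. (m, Suc N)) ` {1..N} else {})"
  have fin: "finite low" "finite high" "finite top"
    by (rule finite_subset[of _ "{..i} \<times> {..Suc N}"]; use i in \<open>auto simp: low_def high_def top_def\<close>)+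
  have "top \<subseteq> high"
    using i by (auto simp: top_def high_def)

  \<comment> \<open>the two faces next to the inserted colour\<close>
  have near: "(\<Sum>m=1..i. g (m, m - 1) + g (m, m)) = c \<phi>"
  proof -
    have "(\<Sum>m=1..i. g (m, m - 1) + g (m, m)) = (\<Sum>m=1..i. c (\<phi>(x := m)) - c (\<phi>(x := m - 1)))"
    proof (rule sum.cong)
      fix m assume "m \<in> {1..i}"
      then obtain m' where "m = Suc m'"
        by (cases m) auto
      then show "g (m, m - 1) + g (m, m) = c (\<phi>(x := m)) - c (\<phi>(x := m - 1))"
        using signed_parity[of "Suc m' + Suc m'" 0 "c (\<phi>(x := Suc m'))"]
          signed_parity[of "m' + m'" 0 "c (\<phi>(x := m'))"]
        by (simp add: g_def merge_insert_colour merge_insert_colour_Suc)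
    qed simp
    also have "\<dots> = c (\<phi>(x := i)) - c (\<phi>(x := 0))"
      using sum_telescope''[of 0 i "\<lambda>m. c (\<phi>(x := m))"] by simp
    also have "c (\<phi>(x := 0)) = 0"
      by (rule colour_cochain_outside[OF c, of x]) auto
    finally show ?thesis
      by (simp add: i_def)
  qed

  \<comment> \<open>the remaining faces, below and above the inserted colour\<close>
  have "homotopy (Suc n) x (colour_diff (Suc n) c) \<phi> = (\<Sum>m=1..i. \<Sum>k\<le>Suc N. g (m, k))"
    using i by (simp add: homotopy_def colour_diff_def signed_sum g_def N_def flip: i_def)
  also have "\<dots> = (\<Sum>m=1..i. (g (m, m - 1) + g (m, m)) +
      ((\<Sum>k\<in>{k. Suc k < m}. g (m, k)) + (\<Sum>k\<in>{k. m < k \<and> k \<le> Suc N}. g (m, k))))"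
  proof (rule sum.cong)
    fix m assume m: "m \<in> {1..i}"
    then have "{..Suc N} = {m - 1, m} \<union> ({k. Suc k < m} \<union> {k. m < k \<and> k \<le> Suc N})"
      using i by auto
    moreover have "(\<Sum>k\<in>{m - 1, m}. g (m, k)) = g (m, m - 1) + g (m, m)"
      using m by (subst sum.insert) auto
    moreover have "finite {k. Suc k < m}" "finite {k. m < k \<and> k \<le> Suc N}"
      by (auto intro: finite_subset[of _ "{..m}"] finite_subset[of _ "{..Suc N}"])
    moreover have "(\<Sum>k\<in>{k. Suc k < m} \<union> {k. m < k \<and> k \<le> Suc N}. g (m, k)) =
        (\<Sum>k\<in>{k. Suc k < m}. g (m, k)) + (\<Sum>k\<in>{k. m < k \<and> k \<le> Suc N}. g (m, k))"
      using calculation(3,4) by (intro sum.union_disjoint) auto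
    moreover have "(\<Sum>k\<in>{m - 1, m} \<union> ({k. Suc k < m} \<union> {k. m < k \<and> k \<le> Suc N}). g (m, k)) =
        (\<Sum>k\<in>{m - 1, m}. g (m, k)) + (\<Sum>k\<in>{k. Suc k < m} \<union> {k. m < k \<and> k \<le> Suc N}. g (m, k))"
      using calculation(3,4) by (intro sum.union_disjoint) auto
    ultimately show "(\<Sum>k\<le>Suc N. g (m, k)) = (g (m, m - 1) + g (m, m)) +
      ((\<Sum>k\<in>{k. Suc k < m}. g (m, k)) + (\<Sum>k\<in>{k. m < k \<and> k \<le> Suc N}. g (m, k)))"
      by simp
  qed simp
  also have "\<dots> = c \<phi> + ((\<Sum>m=1..i. \<Sum>k\<in>{k. Suc k < m}. g (m, k)) +
      (\<Sum>m=1..i. \<Sum>k\<in>{k. m < k \<and> k \<le> Suc N}. g (m, k)))"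
    unfolding sum.distrib[symmetric] near[symmetric] by simp
  also have "(\<Sum>m=1..i. \<Sum>k\<in>{k. Suc k < m}. g (m, k)) = sum g low"
  proof -
    have "finite {k. Suc k < m}" for m
      by (rule finite_subset[of _ "{..m}"]) auto
    moreover have "low = (SIGMA m:{1..i}. {k. Suc k < m})"
      by (auto simp: low_def)
    ultimately show ?thesis
      by (simp add: sum.Sigma)
  qed
  also have "(\<Sum>m=1..i. \<Sum>k\<in>{k. m < k \<and> k \<le> Suc N}. g (m, k)) = sum g high"
  proof -
    have "finite {k. m < k \<and> k \<le> Suc N}" for m
      by (rule finite_subset[of _ "{..Suc N}"]) auto
    moreover have "high = (SIGMA m:{1..i}. {k. m < k \<and> k \<le> Suc N})"
      by (auto simp: high_def)
    ultimately show ?thesis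
      by (simp add: sum.Sigma)
  qed
  finally have hd: "homotopy (Suc n) x (colour_diff (Suc n) c) \<phi> = c \<phi> + (sum g low + sum g high)" .

  \<comment> \<open>the same faces, taken before the colour is inserted\<close>
  define f where "f = (\<lambda>(k, m). signed (k + m) (c (insert_colour x m (merge k \<circ> \<phi>))))"
  define R where "R k = (if merge k i \<le> n then {1..merge k i} else {})" for k
  define R1 where "R1 = {(k, m). k < m \<and> m < i}"
  define R2 where "R2 = {(k, m). 1 \<le> m \<and> m \<le> k \<and> k \<le> N \<and> m \<le> i \<and> \<not> (i = N \<and> k = N)}"
  have finR: "finite R1" "finite R2"
    by (rule finite_subset[of _ "{..N} \<times> {..N}"]; use i in \<open>auto simp: R1_def R2_def\<close>)+
  have "colour_diff n (homotopy n x c) \<phi> = (\<Sum>k\<le>N. \<Sum>m\<in>R k. f (k, m))"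
    unfolding colour_diff_def homotopy_def N_def[symmetric]
    by (rule sum.cong) (simp_all add: R_def f_def i_def signed_sum)
  also have "\<dots> = sum f (SIGMA k:{..N}. R k)"
    by (simp add: sum.Sigma R_def)
  also have "(SIGMA k:{..N}. R k) = R1 \<union> R2"
    using i by (auto simp: R_def R1_def R2_def N_def merge_def split: if_splits)
  also have "sum f (R1 \<union> R2) = sum f R1 + sum f R2"
    using finR by (intro sum.union_disjoint) (auto simp: R1_def R2_def)
  also have "sum f R1 = (\<Sum>p\<in>low. - g p)"
    by (rule sum.reindex_bij_witness[of _ "\<lambda>(m, k). (k, m - 1)" "\<lambda>(k, m). (Suc m, k)"])
      (auto simp: low_def R1_def f_def g_def insert_colour_merge_less add.commute)
  also have "sum f R2 = (\<Sum>p\<in>high - top. - g p)"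
    by (rule sum.reindex_bij_witness[of _ "\<lambda>(m, k). (k - 1, m)" "\<lambda>(k, m). (m, Suc k)"])
      (use i in \<open>auto simp: high_def top_def R2_def f_def g_def insert_colour_merge_ge add.commute split: if_splits\<close>)
  finally have dh: "colour_diff n (homotopy n x c) \<phi> = - sum g low - sum g (high - top)"
    by (simp add: sum_negf)

  have "sum g high = sum g (high - top) + sum g top"
    using fin \<open>top \<subseteq> high\<close> by (simp add: sum.subset_diff[of top high])
  moreover have "sum g top = - append_colour J x (Suc n) (extract_colour (Suc n) x c) \<phi>"
  proof (cases "i = N")
    case False
    then show ?thesis
      by (simp add: top_def append_colour_def i_def N_def)
  next
    case True
    have "sum g top = (\<Sum>m=1..N. g (m, Suc N))"
      unfolding top_def using True by (simp add: sum.reindex inj_on_def)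
    also have "\<dots> = (\<Sum>m=1..N. - signed (N + m) (c (insert_colour x m \<phi>)))"
    proof (rule sum.cong)
      fix m assume m: "m \<in> {1..N}"
      have "c (merge (Suc N) \<circ> insert_colour x m \<phi>) = c (insert_colour x m \<phi>)"
        using \<phi> m by (intro colour_cochain_cong[OF c]) (auto simp: merge_def insert_colour_def N_def)
      then show "g (m, Suc N) = - signed (N + m) (c (insert_colour x m \<phi>))"
        by (simp add: g_def add.commute)
    qed simp
    also have "\<dots> = - append_colour J x (Suc n) (extract_colour (Suc n) x c) \<phi>"
    proof (cases "\<forall>j\<in>J. \<phi> j \<noteq> N")
      case all: True
      then show ?thesis
        using True by (simp add: append_colour_def extract_colour_def N_def i_def sum_negf)
    next
      case False
      then obtain j where j: "j \<in> J" "\<phi> j = N"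
        by blast
      then have "c (insert_colour x m \<phi>) = 0" if "m \<in> {1..N}" for m
        using \<open>x \<notin> J\<close> that
        by (intro colour_cochain_outside[OF c, of j]) (auto simp: insert_colour_def N_def)
      then show ?thesis
        using j by (auto simp: append_colour_def N_def)
    qed
    finally show ?thesis .
  qed
  ultimately show ?thesis
    using hd dh by simp
qed


section \<open>Exactness of the complex of colourings\<close>

declare sum.nat_ivl_Suc' [simp del]

definition colour_alternation :: "nat \<Rightarrow> ((nat \<Rightarrow> nat) \<Rightarrow> 'a::ab_group_add) \<Rightarrow> 'a" where
  "colour_alternation j c =
     (\<Sum>xs\<in>permutations_of_set {1..j}. signed (inversions xs) (c (position xs)))"

definition insert_at :: "'a \<Rightarrow> nat \<Rightarrow> 'a list \<Rightarrow> 'a list" where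
  "insert_at x m ys = take (m - 1) ys @ x # drop (m - 1) ys"

lemma sum_permutations_of_set_insert:
  assumes "finite A" "x \<notin> A"
  shows "(\<Sum>xs\<in>permutations_of_set (insert x A). g xs) =
    (\<Sum>ys\<in>permutations_of_set A. \<Sum>m=1..Suc (card A). g (insert_at x m ys))"
proof -
  have "(\<Sum>ys\<in>permutations_of_set A. \<Sum>m=1..Suc (card A). g (insert_at x m ys)) =
      (\<Sum>(ys, m)\<in>permutations_of_set A \<times> {1..Suc (card A)}. g (insert_at x m ys))"
    by (simp add: sum.cartesian_product)
  also have "\<dots> = (\<Sum>xs\<in>permutations_of_set (insert x A). g xs)"
  proof (rule sum.reindex_bij_witness
      [of _ "\<lambda>xs. (remove1 x xs, position xs x)" "\<lambda>(ys, m). insert_at x m ys"])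
    fix p assume "p \<in> permutations_of_set A \<times> {1..Suc (card A)}"
    then obtain ys m where p: "p = (ys, m)" and ys: "ys \<in> permutations_of_set A"
      and m: "m \<in> {1..Suc (card A)}"
      by auto
    have "set ys = A" "distinct ys" "length ys = card A"
      using permutations_of_setD[OF ys] by auto
    moreover obtain u v where uv: "ys = u @ v" "length u = m - 1" "insert_at x m ys = u @ x # v"
      using m \<open>length ys = card A\<close>
      by (metis append_take_drop_id atLeastAtMost_iff diff_Suc_1 diff_le_mono insert_at_def length_take min.absorb2)
    ultimately show "(case p of (ys, m) \<Rightarrow> insert_at x m ys) \<in> permutations_of_set (insert x A)"
      "(\<lambda>xs. (remove1 x xs, position xs x)) (case p of (ys, m) \<Rightarrow> insert_at x m ys) = p"
      "g (case p of (ys, m) \<Rightarrow> insert_at x m ys) = (case p of (ys, m) \<Rightarrow> g (insert_at x m ys))"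
      using m assms
      by (auto simp: p permutations_of_set_iff remove1_append position_append)
  next
    fix xs assume "xs \<in> permutations_of_set (insert x A)"
    then have xs: "set xs = insert x A" "distinct xs"
      using permutations_of_setD by blast+
    then obtain u v where uv: "xs = u @ x # v" "x \<notin> set u"
      by (metis insertI1 split_list_first)
    then have "card A = length u + length v"
      using xs assms distinct_card[of "u @ v"] by (metis Diff_insert_absorb Un_commute distinct_append
        distinct_remove1 length_append remove1.simps(2) remove1_append set_append set_remove1_eq)
    moreover have "set (u @ v) = A"
      using uv xs assms(2) by auto
    ultimately show "(remove1 x xs, position xs x) \<in> permutations_of_set A \<times> {1..Suc (card A)}"
      "(case (remove1 x xs, position xs x) of (ys, m) \<Rightarrow> insert_at x m ys) = xs"
      using uv xs assms by (auto simp: insert_at_def permutations_of_set_iff remove1_append position_append)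
  qed
  finally show ?thesis ..
qed

lemma cross_inversions_Max: "(\<And>y. y \<in> set ys \<Longrightarrow> y < x) \<Longrightarrow> cross_inversions ys [x] = 0"
  by (induction ys) (auto simp: not_less intro: less_imp_le)

lemma inversions_insert_at:
  assumes "\<And>y. y \<in> set ys \<Longrightarrow> y < x" and "m \<in> {1..Suc (length ys)}"
  shows "inversions (insert_at x m ys) = inversions ys + (Suc (length ys) - m)"
proof -
  let ?u = "take (m - 1) ys" and ?v = "drop (m - 1) ys"
  have "filter (\<lambda>y. y < x) ?v = ?v"
    using assms(1) by (auto simp: filter_id_conv dest: in_set_dropD)
  moreover have "cross_inversions ?u [x] = 0"
    using assms(1) by (intro cross_inversions_Max) (auto dest: in_set_takeD)
  ultimately have "inversions (insert_at x m ys) = inversions (?u @ ?v) + length ?v"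
    using cross_inversions_Cons_right[of ?u x ?v] unfolding insert_at_def inversions_append by simp
  then show ?thesis
    using assms(2) by auto
qed

lemma position_insert_at:
  assumes "distinct ys" "x \<notin> set ys" "m \<in> {1..Suc (length ys)}" "y \<in> insert x (set ys)"
  shows "position (insert_at x m ys) y = insert_colour x m (position ys) y"
proof (cases "y = x")
  case True
  then show ?thesis
    using assms by (auto simp: insert_at_def position_append insert_colour_def dest: in_set_takeD)
next
  case False
  let ?u = "take (m - 1) ys" and ?v = "drop (m - 1) ys"
  have len: "length ?u = m - 1"
    using assms(3) by auto
  have ys: "position ys y = (if y \<in> set ?u then position ?u y else length ?u + position ?v y)"
    using position_append[of ?u ?v y] by simp
  show ?thesis
  proof (cases "y \<in> set ?u")
    case True
    then have "position ys y < m"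
      using ys position_le_length[of y ?u] len assms(3) by auto
    then show ?thesis
      using True ys \<open>y \<noteq> x\<close> by (simp add: insert_at_def position_append insert_colour_def)
  next
    case notin: False
    then have "position ys y \<ge> m"
      using ys position_ge_1[of ?v y] len assms(3) by auto
    then show ?thesis
      using notin ys \<open>y \<noteq> x\<close> len assms(3)
      by (simp add: insert_at_def position_append insert_colour_def)
  qed
qed

text \<open>
  An ordering of \<open>{1..j + 1}\<close> is obtained from one of \<open>{1..j}\<close> by inserting the largest element.
  At position \<open>m\<close> it forms an inversion with each of the \<open>j + 1 - m\<close> elements that follow it.
\<close>

lemma colour_alternation_extract_colour:
  assumes c: "colour_cochain {1..Suc j} (Suc j) c"
  shows "colour_alternation j (extract_colour (Suc j) (Suc j) c) = colour_alternation (Suc j) c"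
proof -
  let ?x = "Suc j"
  have insert: "{1..?x} = insert ?x {1..j}"
    by auto
  have "colour_alternation ?x c =
      (\<Sum>xs\<in>permutations_of_set (insert ?x {1..j}). signed (inversions xs) (c (position xs)))"
    by (simp only: colour_alternation_def insert)
  also have "\<dots> = (\<Sum>ys\<in>permutations_of_set {1..j}. \<Sum>m=1..?x.
      signed (inversions (insert_at ?x m ys)) (c (position (insert_at ?x m ys))))"
    by (subst sum_permutations_of_set_insert) (simp_all del: sum.nat_ivl_Suc')
  also have "\<dots> = (\<Sum>ys\<in>permutations_of_set {1..j}. \<Sum>m=1..?x.
      signed (inversions ys) (signed (?x + m) (c (insert_colour ?x m (position ys)))))"
  proof (intro sum.cong refl)
    fix ys m assume ys: "ys \<in> permutations_of_set {1..j}" and m: "m \<in> {1..?x}"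
    have *: "set ys = {1..j}" "distinct ys" "length ys = j"
      using permutations_of_setD[OF ys] by auto
    have "c (position (insert_at ?x m ys)) = c (insert_colour ?x m (position ys))"
      using * m by (intro colour_cochain_cong[OF c] position_insert_at) auto
    moreover have "even (inversions (insert_at ?x m ys)) = even (inversions ys + (?x + m))"
      using * m by (subst inversions_insert_at) auto
    ultimately show "signed (inversions (insert_at ?x m ys)) (c (position (insert_at ?x m ys))) =
      signed (inversions ys) (signed (?x + m) (c (insert_colour ?x m (position ys))))"
      using signed_parity by (simp only: signed_signed) blast
  qed
  finally show ?thesis
    by (simp add: colour_alternation_def extract_colour_def signed_sum)
qed

lemma append_colour_zero [simp]: "append_colour J x n (\<lambda>\<phi>. 0) = (\<lambda>\<phi>. 0)"
  by (simp add: append_colour_def fun_eq_iff)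

lemma append_colour_eq_zeroD:
  assumes c: "colour_cochain J n c" and "x \<notin> J" and zero: "append_colour J x (Suc n) c = (\<lambda>\<phi>. 0)"
  shows "c = (\<lambda>\<phi>. 0)"
proof
  fix \<phi> :: "nat \<Rightarrow> nat"
  show "c \<phi> = 0"
  proof (cases "\<phi> ` J \<subseteq> {1..n}")
    case False
    then show ?thesis
      using colour_cochain_outside[OF c] by blast
  next
    case True
    then have "\<forall>i\<in>J. (\<phi>(x := Suc n)) i \<noteq> Suc n"
    proof (intro ballI)
      fix i assume "i \<in> J"
      then have "\<phi> i \<in> {1..n}" "i \<noteq> x"
        using True \<open>x \<notin> J\<close> by blast+
      then show "(\<phi>(x := Suc n)) i \<noteq> Suc n"
        by simp
    qed
    then have "append_colour J x (Suc n) c (\<phi>(x := Suc n)) = c (\<phi>(x := Suc n))"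
      by (simp add: append_colour_def)
    also have "\<dots> = c \<phi>"
      using \<open>x \<notin> J\<close> by (intro colour_cochain_cong[OF c]) auto
    finally show ?thesis
      by (simp add: zero)
  qed
qed

lemma alternating_sum_const: "(\<Sum>k\<le>n. signed k a) = (if even n then a else 0)"
  by (induction n) (auto simp: sum.atMost_Suc signed_def)

lemma colour_cochain_add:
  assumes "colour_cochain J n c" "colour_cochain J n c'"
  shows "colour_cochain J n (\<lambda>\<phi>. c \<phi> + c' \<phi>)"
  unfolding colour_cochain_def
  using colour_cochain_cong[OF assms(1)] colour_cochain_cong[OF assms(2)]
    colour_cochain_outside[OF assms(1)] colour_cochain_outside[OF assms(2)]
  by (metis (no_types, lifting) add.right_neutral image_subsetI)

lemma colour_cochain_zero: "colour_cochain J n (\<lambda>\<phi>. 0)"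
  by (simp add: colour_cochain_def)

lemma colour_cochain_0:
  assumes c: "colour_cochain {1..j} 0 c" and "j = 0 \<Longrightarrow> colour_alternation j c = 0"
  shows "c = (\<lambda>\<phi>. 0)"
proof
  fix \<phi> :: "nat \<Rightarrow> nat"
  show "c \<phi> = 0"
  proof (cases j)
    case 0
    then have "c \<phi> = c (position [])"
      by (intro colour_cochain_cong[OF c]) auto
    then show ?thesis
      using assms(2) 0 by (simp add: colour_alternation_def)
  next
    case (Suc j')
    then show ?thesis
      by (intro colour_cochain_outside[OF c, of 1]) auto
  qed
qed

text \<open>
  Induction on \<open>j\<close>. The homotopy for \<open>x = j + 1\<close> replaces \<open>c\<close> by a cochain \<open>append_colour q\<close>,
  where \<open>q\<close> is a cocycle on \<open>{1..j}\<close> of one degree less with the same alternation.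
\<close>

theorem colour_complex_exact:
  fixes c :: "(nat \<Rightarrow> nat) \<Rightarrow> 'a::ab_group_add"
  assumes "colour_cochain {1..j} (Suc n) c" "colour_diff (Suc n) c = (\<lambda>\<phi>. 0)"
    and "Suc n = j \<Longrightarrow> colour_alternation j c = 0"
  shows "\<exists>b. colour_cochain {1..j} n b \<and> colour_diff n b = c"
  using assms
proof (induction j arbitrary: n c)
  case 0
  have const: "c \<phi> = c \<psi>" for \<phi> \<psi>
    by (rule colour_cochain_cong[OF "0.prems"(1)]) simp
  \<comment> \<open>all faces agree on the empty set, and their alternating sum has \<open>m + 2\<close> terms\<close>
  have diff: "colour_diff m (\<lambda>\<phi>. c \<phi>) = (if odd m then c else (\<lambda>\<phi>. 0))" for m
  proof
    fix \<phi>
    have "colour_diff m (\<lambda>\<phi>. c \<phi>) \<phi> = (\<Sum>k\<le>Suc m. signed k (c \<phi>))"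
      unfolding colour_diff_def by (intro sum.cong refl arg_cong[of _ _ "signed _"] const)
    then show "colour_diff m (\<lambda>\<phi>. c \<phi>) \<phi> = (if odd m then c else (\<lambda>\<phi>. 0)) \<phi>"
      by (simp add: alternating_sum_const)
  qed
  have b: "colour_cochain {1..0} n c"
    using const by (auto simp: colour_cochain_def)
  show ?case
  proof (cases "odd n")
    case True
    then show ?thesis
      using b diff[of n] by auto
  next
    case False
    then have "c = (\<lambda>\<phi>. 0)"
      using diff[of "Suc n"] "0.prems"(2) by simp
    then show ?thesis
      using colour_cochain_zero colour_diff_zero by metis
  qed
next
  case (Suc j)
  let ?x = "Suc j" and ?J = "{1..j}"
  have x: "?x \<notin> ?J" and insert: "{1..Suc j} = insert ?x ?J"
    by auto
  have c: "colour_cochain (insert ?x ?J) (Suc n) c"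
    using Suc.prems(1) insert by simp
  define h where "h = homotopy n ?x c"
  define q where "q = extract_colour (Suc n) ?x c"
  have h: "colour_cochain (insert ?x ?J) n h"
    unfolding h_def by (rule colour_cochain_homotopy[OF c])
  have q: "colour_cochain ?J n q"
    unfolding q_def by (rule colour_cochain_extract_colour[OF c x])
  have eq: "append_colour ?J ?x (Suc n) q = (\<lambda>\<phi>. c \<phi> - colour_diff n h \<phi>)"
  proof
    fix \<phi> :: "nat \<Rightarrow> nat"
    show "append_colour ?J ?x (Suc n) q \<phi> = c \<phi> - colour_diff n h \<phi>"
    proof (cases "\<phi> ` insert ?x ?J \<subseteq> {1..Suc n}")
      case True
      moreover have "homotopy (Suc n) ?x (colour_diff (Suc n) c) \<phi> = 0"
        by (simp add: Suc.prems(2) homotopy_def)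
      ultimately show ?thesis
        using homotopy_identity[OF c x, of \<phi>] by (simp add: h_def q_def algebra_simps)
    next
      case False
      then obtain i where i: "i \<in> insert ?x ?J" "\<phi> i \<notin> {1..Suc n}"
        by blast
      then show ?thesis
        using colour_cochain_outside[OF c i(1), of \<phi>]
          colour_cochain_outside[OF colour_cochain_colour_diff[OF h] i(1), of \<phi>]
          colour_cochain_outside[OF colour_cochain_append_colour[OF q] i(1), of \<phi>]
        by (simp only: not_False_eq_True simp_thms diff_self)
    qed
  qed
  have "append_colour ?J ?x (Suc (Suc n)) (colour_diff n q) = (\<lambda>\<phi>. 0)"
    unfolding colour_diff_append_colour[OF q, of ?x, symmetric] eq
    by (simp add: colour_diff_diff Suc.prems(2))
  then have dq: "colour_diff n q = (\<lambda>\<phi>. 0)"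
    by (rule append_colour_eq_zeroD[OF colour_cochain_colour_diff[OF q] x])
  have altq: "colour_alternation j q = 0" if "n = j"
    using that Suc.prems colour_alternation_extract_colour[of j c] by (simp add: q_def)
  show ?case
  proof (cases n)
    case 0
    then have "q = (\<lambda>\<phi>. 0)"
      using colour_cochain_0[of j q] q altq by simp
    then have "(\<lambda>\<phi>. c \<phi> - colour_diff n h \<phi>) = (\<lambda>\<phi>. 0)"
      by (simp flip: eq)
    then have "colour_diff n h = c"
      by (simp add: fun_eq_iff)
    then show ?thesis
      using h insert by auto
  next
    case (Suc n')
    then obtain b where b: "colour_cochain ?J n' b" "colour_diff n' b = q"
      using Suc.IH[of n' q] q dq altq by auto
    let ?b = "append_colour ?J ?x n b"
    have "colour_cochain (insert ?x ?J) n ?b"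
      using colour_cochain_append_colour[OF b(1)] Suc by simp
    moreover have "colour_diff n ?b = append_colour ?J ?x (Suc n) q"
      using colour_diff_append_colour[OF b(1)] Suc b(2) by simp
    ultimately have "colour_cochain (insert ?x ?J) n (\<lambda>\<phi>. h \<phi> + ?b \<phi>)"
      and "colour_diff n (\<lambda>\<phi>. h \<phi> + ?b \<phi>) = c"
      using h fun_cong[OF eq] by (simp_all add: colour_cochain_add colour_diff_add fun_eq_iff)
    then show ?thesis
      using insert by auto
  qed
qed


section \<open>Linear maps between free modules\<close>

lemma lookup_scale [simp]: "Poly_Mapping.lookup (scale c v) x = c * Poly_Mapping.lookup v x"
  by (simp add: scale_def Poly_Mapping.map.rep_eq when_def)

lemma scale_simps [simp]:
  fixes v :: "'x \<Rightarrow>\<^sub>0 'k::{comm_ring,comm_monoid_mult}"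
  shows "scale 1 v = v" "scale 0 v = 0" "scale c 0 = (0 :: 'x \<Rightarrow>\<^sub>0 'k)"
    "scale c (scale d v) = scale (c * d) v"
  by (auto intro!: poly_mapping_eqI simp: mult.assoc)

lemma scale_add: "scale c (v + w) = scale c v + scale c w"
  by (rule poly_mapping_eqI) (simp add: lookup_add distrib_left)

lemma scale_add_left: "scale (c + d) v = scale c v + scale d v"
  by (rule poly_mapping_eqI) (simp add: lookup_add distrib_right)

lemma lookup_basis: "Poly_Mapping.lookup (basis x) y = (if x = y then 1 else 0)"
  by (simp add: basis_def lookup_single when_def)

lemma single_eq_scale: "Poly_Mapping.single x c = scale c (basis x)"
  by (rule poly_mapping_eqI) (simp add: lookup_single lookup_basis when_def)

lemma free_module_iff: "v \<in> free_module A \<longleftrightarrow> (\<forall>x. x \<notin> A \<longrightarrow> Poly_Mapping.lookup v x = 0)"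
  by (auto simp: free_module_def in_keys_iff)

lemma free_module_zero [simp]: "0 \<in> free_module A"
  by (simp add: free_module_iff)

lemma free_module_add: "v \<in> free_module A \<Longrightarrow> w \<in> free_module A \<Longrightarrow> v + w \<in> free_module A"
  for v w :: "'x \<Rightarrow>\<^sub>0 'k::{comm_ring,comm_monoid_mult}"
  by (simp add: free_module_iff lookup_add)

lemma free_module_scale: "v \<in> free_module A \<Longrightarrow> scale c v \<in> free_module A"
  by (simp add: free_module_iff)

lemma free_module_basis: "x \<in> A \<Longrightarrow> basis x \<in> free_module A"
  by (auto simp: free_module_iff lookup_basis)

lemma free_module_sum:
  fixes g :: "'b \<Rightarrow> 'x \<Rightarrow>\<^sub>0 'k::{comm_ring,comm_monoid_mult}"
  shows "(\<And>i. i \<in> S \<Longrightarrow> g i \<in> free_module A) \<Longrightarrow> sum g S \<in> free_module A"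
  by (induction S rule: infinite_finite_induct) (auto intro: free_module_add)

lemma free_module_expand:
  fixes v :: "'x \<Rightarrow>\<^sub>0 'k::{comm_ring,comm_monoid_mult}"
  shows "v = (\<Sum>x\<in>Poly_Mapping.keys v. scale (Poly_Mapping.lookup v x) (basis x))"
  by (rule poly_mapping_eqI)
    (simp add: lookup_sum lookup_basis if_distrib in_keys_iff cong: if_cong)

definition linear_map ::
    "'x set \<Rightarrow> 'y set \<Rightarrow> (('x \<Rightarrow>\<^sub>0 'k::{comm_ring,comm_monoid_mult}) \<Rightarrow> ('y \<Rightarrow>\<^sub>0 'k)) \<Rightarrow> bool" where
  "linear_map A B L \<longleftrightarrow>
     (\<forall>v\<in>free_module A. L v \<in> free_module B) \<and>
     (\<forall>v\<in>free_module A. \<forall>w\<in>free_module A. L (v + w) = L v + L w) \<and>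
     (\<forall>c. \<forall>v\<in>free_module A. L (scale c v) = scale c (L v))"

lemma linear_mapD:
  assumes "linear_map A B L" "v \<in> free_module A"
  shows "L v \<in> free_module B" "w \<in> free_module A \<Longrightarrow> L (v + w) = L v + L w" "L (scale c v) = scale c (L v)"
  using assms by (auto simp: linear_map_def)

lemma linear_map_zero: "linear_map A B L \<Longrightarrow> L 0 = 0"
  using linear_mapD(3)[of A B L 0 0] by simp

lemma linear_map_sum:
  assumes "linear_map A B L" "\<And>i. i \<in> S \<Longrightarrow> g i \<in> free_module A"
  shows "L (sum g S) = (\<Sum>i\<in>S. L (g i))"
  using assms(2)
  by (induction S rule: infinite_finite_induct)
    (auto simp: linear_map_zero[OF assms(1)] linear_mapD(2)[OF assms(1)] free_module_sum)

lemma linear_map_comp: "linear_map A B L \<Longrightarrow> linear_map B C M \<Longrightarrow> linear_map A C (\<lambda>v. M (L v))"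
  unfolding linear_map_def by simp

lemma linear_map_sum_maps:
  "(\<And>i. i \<in> S \<Longrightarrow> linear_map A B (L i)) \<Longrightarrow> linear_map A B (\<lambda>v. \<Sum>i\<in>S. L i v)"
proof (induction S rule: infinite_finite_induct)
  case (insert i S)
  then have "linear_map A B (L i)" "linear_map A B (\<lambda>v. \<Sum>i\<in>S. L i v)"
    by auto
  with insert.hyps show ?case
    by (auto simp: linear_map_def free_module_add scale_add algebra_simps)
qed (auto simp: linear_map_def)

lemma free_module_induct [consumes 1, case_names zero scale_basis add]:
  fixes v :: "'x \<Rightarrow>\<^sub>0 'k::{comm_ring,comm_monoid_mult}"
  assumes "v \<in> free_module A" "P 0" "\<And>x c. x \<in> A \<Longrightarrow> P (scale c (basis x))"
    "\<And>v w. v \<in> free_module A \<Longrightarrow> w \<in> free_module A \<Longrightarrow> P v \<Longrightarrow> P w \<Longrightarrow> P (v + w)"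
  shows "P v"
proof -
  let ?g = "\<lambda>x. scale (Poly_Mapping.lookup v x) (basis x)"
  have "P (sum ?g S) \<and> sum ?g S \<in> free_module A" if "finite S" "S \<subseteq> A" for S
    using that
    by (induction S rule: finite_induct)
      (auto intro!: assms free_module_add free_module_scale free_module_basis)
  then show ?thesis
    using assms(1) free_module_expand[of v] by (metis finite_keys free_module_def mem_Collect_eq)
qed

lemma linear_map_eqI:
  assumes "linear_map A B L" "linear_map A B M" "\<And>x. x \<in> A \<Longrightarrow> L (basis x) = M (basis x)"
    and "v \<in> free_module A"
  shows "L v = M v"
  using assms(4)
  by (induction rule: free_module_induct)
    (auto simp: linear_map_zero[OF assms(1)] linear_map_zero[OF assms(2)] linear_mapD[OF assms(1)]
      linear_mapD[OF assms(2)] assms(3) free_module_basis)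

definition extend :: "('x \<Rightarrow> 'y \<Rightarrow>\<^sub>0 'k::{comm_ring,comm_monoid_mult}) \<Rightarrow> ('x \<Rightarrow>\<^sub>0 'k) \<Rightarrow> ('y \<Rightarrow>\<^sub>0 'k)" where
  "extend h v = (\<Sum>x\<in>Poly_Mapping.keys v. scale (Poly_Mapping.lookup v x) (h x))"

lemma extend_superset:
  assumes "finite S" "Poly_Mapping.keys v \<subseteq> S"
  shows "extend h v = (\<Sum>x\<in>S. scale (Poly_Mapping.lookup v x) (h x))"
  unfolding extend_def using assms by (intro sum.mono_neutral_left) (auto simp: in_keys_iff)

lemma extend_add: "extend h (v + w) = extend h v + extend h w"
proof -
  let ?S = "Poly_Mapping.keys v \<union> Poly_Mapping.keys w"
  have "Poly_Mapping.keys (v + w) \<subseteq> ?S"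
    by (rule Poly_Mapping.keys_add)
  then show ?thesis
    using extend_superset[of ?S v h] extend_superset[of ?S w h] extend_superset[of ?S "v + w" h]
    by (simp add: lookup_add scale_add_left sum.distrib)
qed

lemma scale_sum: "scale c (sum g S) = (\<Sum>x\<in>S. scale c (g x))"
  by (induction S rule: infinite_finite_induct) (auto simp: scale_add)

lemma extend_scale: "extend h (scale c v) = scale c (extend h v)"
proof -
  have "Poly_Mapping.keys (scale c v) \<subseteq> Poly_Mapping.keys v"
    by (auto simp: in_keys_iff)
  then show ?thesis
    by (simp add: extend_superset[of "Poly_Mapping.keys v"] scale_sum)
qed

lemma extend_basis [simp]: "extend h (basis x) = h x"
  by (subst extend_superset[of "{x}"]) (auto simp: lookup_basis in_keys_iff split: if_splits)

lemma linear_map_extend: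
  assumes "\<And>x. x \<in> A \<Longrightarrow> h x \<in> free_module B"
  shows "linear_map A B (extend h)"
proof -
  have "extend h v \<in> free_module B" if "v \<in> free_module A" for v
    unfolding extend_def using that
    by (intro free_module_sum free_module_scale assms) (auto simp: free_module_def)
  then show ?thesis
    by (simp add: linear_map_def extend_add extend_scale)
qed

lemma push_eq_extend: "push h = extend (\<lambda>x. basis (h x))"
  by (simp add: push_def extend_def fun_eq_iff single_eq_scale)

lemma push_basis [simp]: "push h (basis x) = basis (h x)"
  by (simp add: push_eq_extend)

lemma linear_map_push: "h ` A \<subseteq> B \<Longrightarrow> linear_map A B (push h)"
  unfolding push_eq_extend by (rule linear_map_extend) (auto intro: free_module_basis)

lemma push_cong_on:
  assumes "v \<in> free_module A" "\<And>x. x \<in> A \<Longrightarrow> h x = h' x"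
  shows "push h v = push h' v"
  using assms by (auto simp: push_def free_module_def intro!: sum.cong)

lemma push_push: "push h (push h' v) = push (h \<circ> h') v"
proof -
  have "linear_map UNIV UNIV (\<lambda>v. push h (push h' v))"
    by (rule linear_map_comp[of _ UNIV]; rule linear_map_push) auto
  then show ?thesis
    by (rule linear_map_eqI[where L = "\<lambda>v. push h (push h' v)"])
      (auto simp: free_module_iff intro: linear_map_push)
qed

lemma push_id_on: "v \<in> free_module A \<Longrightarrow> (\<And>x. x \<in> A \<Longrightarrow> h x = x) \<Longrightarrow> push h v = v"
  using push_cong_on[of v A h "\<lambda>x. x"] free_module_expand[of v]
  by (simp add: push_eq_extend extend_def)


subsection \<open>Linear forms\<close>

lemma linear_formsD:
  assumes "f \<in> linear_forms A"
  shows "v \<in> free_module A \<Longrightarrow> w \<in> free_module A \<Longrightarrow> f (v + w) = f v + f w"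
    "v \<in> free_module A \<Longrightarrow> f (scale c v) = c * f v"
    "v \<notin> free_module A \<Longrightarrow> f v = 0"
  using assms by (auto simp: linear_forms_def)

lemma linear_forms_apply_zero: "f \<in> linear_forms A \<Longrightarrow> f 0 = 0"
  using linear_formsD(2)[of f A 0 0] by simp

lemma linear_forms_apply_sum:
  assumes "f \<in> linear_forms A" "\<And>i. i \<in> S \<Longrightarrow> g i \<in> free_module A"
  shows "f (sum g S) = (\<Sum>i\<in>S. f (g i))"
  using assms(2)
  by (induction S rule: infinite_finite_induct)
    (auto simp: linear_forms_apply_zero[OF assms(1)] linear_formsD(1)[OF assms(1)] free_module_sum)

lemma linear_forms_eqI:
  assumes "f \<in> linear_forms A" "g \<in> linear_forms A" "\<And>x. x \<in> A \<Longrightarrow> f (basis x) = g (basis x)"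
  shows "f = g"
proof
  fix v
  show "f v = g v"
  proof (cases "v \<in> free_module A")
    case True
    then show ?thesis
      by (induction rule: free_module_induct)
        (auto simp: linear_forms_apply_zero[OF assms(1)] linear_forms_apply_zero[OF assms(2)]
          linear_formsD[OF assms(1)] linear_formsD[OF assms(2)] assms(3) free_module_basis)
  qed (use assms linear_formsD(3) in metis)
qed

lemma linear_forms_zero: "(\<lambda>v. 0) \<in> linear_forms A"
  by (simp add: linear_forms_def)

lemma linear_forms_add: "f \<in> linear_forms A \<Longrightarrow> g \<in> linear_forms A \<Longrightarrow> (\<lambda>v. f v + g v) \<in> linear_forms A"
  by (simp add: linear_forms_def algebra_simps)

lemma linear_forms_uminus: "f \<in> linear_forms A \<Longrightarrow> (\<lambda>v. - f v) \<in> linear_forms A"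
  by (simp add: linear_forms_def algebra_simps)

lemma linear_forms_diff: "f \<in> linear_forms A \<Longrightarrow> g \<in> linear_forms A \<Longrightarrow> (\<lambda>v. f v - g v) \<in> linear_forms A"
  using linear_forms_add[of f A "\<lambda>v. - g v"] by (simp add: linear_forms_uminus)

lemma linear_forms_signed: "f \<in> linear_forms A \<Longrightarrow> (\<lambda>v. signed n (f v)) \<in> linear_forms A"
  by (cases "even n") (simp_all add: signed_def linear_forms_uminus)

lemma linear_forms_mult: "f \<in> linear_forms A \<Longrightarrow> (\<lambda>v. c * f v) \<in> linear_forms A"
  by (simp add: linear_forms_def algebra_simps)

lemma linear_forms_sum:
  "(\<And>i. i \<in> S \<Longrightarrow> f i \<in> linear_forms A) \<Longrightarrow> (\<lambda>v. \<Sum>i\<in>S. f i v) \<in> linear_forms A"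
  by (induction S rule: infinite_finite_induct) (auto intro: linear_forms_zero linear_forms_add)

lemma linear_forms_comp:
  assumes "linear_map A B L" "f \<in> linear_forms B"
  shows "(\<lambda>v. if v \<in> free_module A then f (L v) else 0) \<in> linear_forms A"
  using linear_mapD[OF assms(1)] linear_formsD[OF assms(2)]
  by (auto simp: linear_forms_def free_module_add free_module_scale)

lemma linear_extension_superset:
  assumes "v \<in> free_module A" "finite S" "Poly_Mapping.keys v \<subseteq> S"
  shows "linear_extension A h v = (\<Sum>x\<in>S. Poly_Mapping.lookup v x * h x)"
  unfolding linear_extension_def using assms
  by simp (intro sum.mono_neutral_left; auto simp: in_keys_iff)

lemma linear_extension_in_linear_forms: "linear_extension A h \<in> linear_forms A"
  unfolding linear_forms_def
proof (intro CollectI conjI ballI allI impI)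
  fix v w :: "'a \<Rightarrow>\<^sub>0 'b"
  assume vw: "v \<in> free_module A" "w \<in> free_module A"
  let ?S = "Poly_Mapping.keys v \<union> Poly_Mapping.keys w"
  have "Poly_Mapping.keys (v + w) \<subseteq> ?S"
    by (rule Poly_Mapping.keys_add)
  then show "linear_extension A h (v + w) = linear_extension A h v + linear_extension A h w"
    using vw linear_extension_superset[of v A ?S h] linear_extension_superset[of w A ?S h]
      linear_extension_superset[of "v + w" A ?S h]
    by (simp add: lookup_add distrib_right sum.distrib free_module_add)
next
  fix c and v :: "'a \<Rightarrow>\<^sub>0 'b"
  assume v: "v \<in> free_module A"
  have "Poly_Mapping.keys (scale c v) \<subseteq> Poly_Mapping.keys v"
    by (auto simp: in_keys_iff)
  then show "linear_extension A h (scale c v) = c * linear_extension A h v"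
    using v by (simp add: linear_extension_superset[of _ A "Poly_Mapping.keys v"] sum_distrib_left
      mult.assoc free_module_scale)
qed (simp add: linear_extension_def)

lemma linear_extension_basis [simp]: "x \<in> A \<Longrightarrow> linear_extension A h (basis x) = h x"
  by (subst linear_extension_superset[of _ _ "{x}"])
    (auto simp: free_module_basis lookup_basis in_keys_iff split: if_splits)


subsection \<open>The trace of a projective module\<close>

text \<open>
  This is D. G. Higman's criterion. On a free module over the group ring, the projection onto the
  span of the basis elements \<open>(id, b)\<close> has the identity as its trace; conjugating it with a splitting
  gives \<open>\<theta>\<close>. The criterion allows linear choices to be averaged into equivariant ones although the
  order of the group need not be invertible.
\<close>

theorem projective_sym_module_trace:
  fixes act :: "(nat \<Rightarrow> nat) \<Rightarrow> ('x \<Rightarrow>\<^sub>0 'k::{comm_ring,comm_monoid_mult}) \<Rightarrow> ('x \<Rightarrow>\<^sub>0 'k)"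
  assumes "projective_sym_module j (free_module A) act"
    and act: "\<And>\<sigma> v. \<sigma> permutes {1..j} \<Longrightarrow> v \<in> free_module A \<Longrightarrow> act \<sigma> v \<in> free_module A"
  shows "\<exists>\<theta>. linear_map A A \<theta> \<and>
    (\<forall>v\<in>free_module A. (\<Sum>\<sigma>\<in>{\<sigma>. \<sigma> permutes {1..j}}. act \<sigma> (\<theta> (act (inv \<sigma>) v))) = v)"
proof -
  obtain B :: "('x \<Rightarrow>\<^sub>0 'k) set" and s r where
    s: "equivariant_hom j (free_module A) act (free_sym_module j B) free_sym_action s" and
    r: "equivariant_hom j (free_sym_module j B) free_sym_action (free_module A) act r" and
    rs: "\<And>v. v \<in> free_module A \<Longrightarrow> r (s v) = v"
    using assms(1) unfolding projective_sym_module_def by blast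
  define G where "G = {\<sigma>. \<sigma> permutes {1..j}}"
  have G: "finite G" "\<And>\<sigma>. \<sigma> \<in> G \<Longrightarrow> inv \<sigma> \<in> G" "\<And>\<sigma> \<tau>. \<sigma> \<in> G \<Longrightarrow> \<tau> \<in> G \<Longrightarrow> \<sigma> \<circ> \<tau> \<in> G"
    by (auto simp: G_def finite_permutations permutes_inv intro: permutes_compose)
  let ?F = "G \<times> B"
  have F: "free_sym_module j B = (free_module ?F :: ((nat \<Rightarrow> nat) \<times> ('x \<Rightarrow>\<^sub>0 'k) \<Rightarrow>\<^sub>0 'k) set)"
    by (simp add: free_sym_module_def G_def)
  define e :: "((nat \<Rightarrow> nat) \<times> ('x \<Rightarrow>\<^sub>0 'k) \<Rightarrow>\<^sub>0 'k) \<Rightarrow> _" where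
    "e = extend (\<lambda>(\<tau>, b). if \<tau> = id then basis (\<tau>, b) else 0)"
  have lin_s: "linear_map A ?F s" and lin_r: "linear_map ?F A r"
    using s r unfolding equivariant_hom_def linear_map_def F by auto
  have lin_e: "linear_map ?F ?F e"
    unfolding e_def by (rule linear_map_extend) (auto intro: free_module_basis)
  have lin_act: "linear_map ?F ?F (free_sym_action \<sigma> :: (_ \<times> ('x \<Rightarrow>\<^sub>0 'k) \<Rightarrow>\<^sub>0 'k) \<Rightarrow> _)" if "\<sigma> \<in> G" for \<sigma>
    unfolding free_sym_action_def using that G by (intro linear_map_push) auto
  let ?c = "\<lambda>\<sigma> w. free_sym_action \<sigma> (e (free_sym_action (inv \<sigma>) w))"
  have lin_c: "linear_map ?F ?F (?c \<sigma>)" if "\<sigma> \<in> G" for \<sigma>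
    using linear_map_comp[OF linear_map_comp[OF lin_act lin_e] lin_act, of "inv \<sigma>" \<sigma>] that G by simp
  have trace: "(\<Sum>\<sigma>\<in>G. ?c \<sigma> w) = w" if "w \<in> free_module ?F" for w
  proof (rule linear_map_eqI[where L = "\<lambda>w. \<Sum>\<sigma>\<in>G. ?c \<sigma> w" and M = "\<lambda>w. w"])
    show "linear_map ?F ?F (\<lambda>w. \<Sum>\<sigma>\<in>G. ?c \<sigma> w)"
      by (rule linear_map_sum_maps) (rule lin_c)
    fix x assume "x \<in> ?F"
    then obtain \<tau> b where x: "x = (\<tau>, b)" "\<tau> \<in> G"
      by auto
    have "?c \<sigma> (basis x) = (if \<sigma> = \<tau> then basis x else 0)" if "\<sigma> \<in> G" for \<sigma>
    proof -
      have "bij \<sigma>"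
        using that by (auto simp: G_def dest: permutes_bij)
      then have "inv \<sigma> \<circ> \<tau> = id \<longleftrightarrow> \<sigma> = \<tau>"
        by (metis bij_is_surj comp_assoc comp_id id_comp inv_o_cancel bij_is_inj surj_iff)
      then show ?thesis
        by (auto simp: x free_sym_action_def e_def push_eq_extend free_module_iff
            linear_map_zero[OF linear_map_extend[of UNIV _ UNIV]])
    qed
    then show "(\<Sum>\<sigma>\<in>G. ?c \<sigma> (basis x)) = basis x"
      using x G(1) by simp
  qed (use that in \<open>auto simp: linear_map_def\<close>)

  define \<theta> where "\<theta> v = r (e (s v))" for v
  have "linear_map A A \<theta>"
    unfolding \<theta>_def using linear_map_comp[OF linear_map_comp[OF lin_s lin_e] lin_r] .
  moreover have "(\<Sum>\<sigma>\<in>G. act \<sigma> (\<theta> (act (inv \<sigma>) v))) = v" if v: "v \<in> free_module A" for v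
  proof -
    have sv: "s v \<in> free_module ?F"
      using linear_mapD(1)[OF lin_s v] .
    have "act \<sigma> (\<theta> (act (inv \<sigma>) v)) = r (?c \<sigma> (s v))" if \<sigma>: "\<sigma> \<in> G" for \<sigma>
    proof -
      have "s (act (inv \<sigma>) v) = free_sym_action (inv \<sigma>) (s v)"
        using s v G(2)[OF \<sigma>] by (auto simp: equivariant_hom_def G_def)
      moreover have "e (free_sym_action (inv \<sigma>) (s v)) \<in> free_module ?F"
        using lin_e lin_act[OF G(2)[OF \<sigma>]] sv by (auto intro: linear_mapD(1))
      ultimately show ?thesis
        using r \<sigma> unfolding \<theta>_def equivariant_hom_def F by (simp add: G_def)
    qed
    then have "(\<Sum>\<sigma>\<in>G. act \<sigma> (\<theta> (act (inv \<sigma>) v))) = (\<Sum>\<sigma>\<in>G. r (?c \<sigma> (s v)))"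
      by simp
    also have "\<dots> = r (\<Sum>\<sigma>\<in>G. ?c \<sigma> (s v))"
      using linear_mapD(1)[OF lin_c sv] by (intro linear_map_sum[OF lin_r, symmetric])
    also have "\<dots> = v"
      by (simp only: trace[OF sv] rs[OF v])
    finally show ?thesis .
  qed
  ultimately show ?thesis
    unfolding G_def by blast
qed


section \<open>Decompositions and colourings\<close>

text \<open>
  The decompositions of \<open>I\<close> into \<open>n\<close> blocks are the lists \<open>fibres n I \<phi>\<close> for \<open>\<phi>\<close> with values in
  \<open>{1..n}\<close>. For other \<open>\<phi>\<close> they decompose \<open>in_range n I \<phi>\<close>.
\<close>

definition in_range :: "nat \<Rightarrow> nat set \<Rightarrow> (nat \<Rightarrow> nat) \<Rightarrow> nat set" where
  "in_range n I \<phi> = {i \<in> I. \<phi> i \<in> {1..n}}"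

definition fibres :: "nat \<Rightarrow> nat set \<Rightarrow> (nat \<Rightarrow> nat) \<Rightarrow> nat set list" where
  "fibres n I \<phi> = map (\<lambda>k. {i \<in> I. \<phi> i = Suc k}) [0..<n]"

definition colour_of :: "nat set list \<Rightarrow> nat \<Rightarrow> nat" where
  "colour_of F i = Suc (LEAST k. i \<in> F ! k)"

lemma length_fibres [simp]: "length (fibres n I \<phi>) = n"
  by (simp add: fibres_def)

lemma nth_fibres [simp]: "k < n \<Longrightarrow> fibres n I \<phi> ! k = {i \<in> I. \<phi> i = Suc k}"
  by (simp add: fibres_def)

lemma in_range_subset: "in_range n I \<phi> \<subseteq> I"
  by (auto simp: in_range_def)

lemma finite_in_range: "finite I \<Longrightarrow> finite (in_range n I \<phi>)"
  by (rule finite_subset[OF in_range_subset])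

lemma in_range_eq: "\<phi> ` I \<subseteq> {1..n} \<Longrightarrow> in_range n I \<phi> = I"
  by (auto simp: in_range_def)

lemma Union_fibres: "\<Union>(set (fibres n I \<phi>)) = in_range n I \<phi>"
proof -
  have "i \<in> \<Union>(set (fibres n I \<phi>))" if "i \<in> in_range n I \<phi>" for i
  proof -
    have "\<phi> i = Suc (\<phi> i - 1)" "\<phi> i - 1 < n" "i \<in> I"
      using that by (auto simp: in_range_def)
    then show ?thesis
      by (auto simp: fibres_def intro!: bexI[of _ "\<phi> i - 1"])
  qed
  then show ?thesis
    by (auto simp: in_range_def fibres_def)
qed

lemma fibres_in_decompositions: "finite I \<Longrightarrow> fibres n I \<phi> \<in> decompositions n"
  unfolding decompositions_def decomposition_def
  using Union_fibres[of n I \<phi>] finite_in_range[of I n \<phi>] by auto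

lemma fibres_cong:
  "(\<And>i. i \<in> I \<Longrightarrow> \<phi> i = \<psi> i \<or> (\<phi> i \<notin> {1..n} \<and> \<psi> i \<notin> {1..n})) \<Longrightarrow> fibres n I \<phi> = fibres n I \<psi>"
  unfolding fibres_def by (intro map_cong refl) (auto, force+)

lemma fibres_in_range: "fibres n (in_range n I \<phi>) \<phi> = fibres n I \<phi>"
  by (auto simp: fibres_def in_range_def)

lemma fibres_image: "inj_on \<sigma> I \<Longrightarrow> fibres n (\<sigma> ` I) \<phi> = map ((`) \<sigma>) (fibres n I (\<phi> \<circ> \<sigma>))"
  by (auto simp: fibres_def)

lemma decompositionsD:
  assumes "F \<in> decompositions n"
  shows "length F = n" "finite (\<Union>(set F))" "colour_of F ` \<Union>(set F) \<subseteq> {1..n}"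
    "fibres n (\<Union>(set F)) (colour_of F) = F"
proof -
  show len: "length F = n" and fin: "finite (\<Union>(set F))"
    using assms by (auto simp: decompositions_def decomposition_def)
  have disj: "F ! k \<inter> F ! l = {}" if "k < n" "l < n" "k \<noteq> l" for k l
    using assms that by (auto simp: decompositions_def decomposition_def)
  have col: "colour_of F i = Suc k" if "i \<in> F ! k" "k < n" for i k
  proof -
    have "(LEAST k. i \<in> F ! k) \<le> k" "i \<in> F ! (LEAST k. i \<in> F ! k)"
      using that by (auto intro: Least_le LeastI)
    then have "(LEAST k. i \<in> F ! k) = k"
      using disj[of "LEAST k. i \<in> F ! k" k] that by (cases "(LEAST k. i \<in> F ! k) = k") auto
    then show ?thesis
      by (simp add: colour_of_def)
  qed
  then show "colour_of F ` \<Union>(set F) \<subseteq> {1..n}"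
    using len by (fastforce simp: in_set_conv_nth)
  show "fibres n (\<Union>(set F)) (colour_of F) = F"
  proof (rule nth_equalityI)
    fix k assume "k < length (fibres n (\<Union>(set F)) (colour_of F))"
    then have k: "k < n"
      by simp
    have "i \<in> F ! k" if "i \<in> \<Union>(set F)" "colour_of F i = Suc k" for i
      using that col len by (auto simp: in_set_conv_nth)
    then show "fibres n (\<Union>(set F)) (colour_of F) ! k = F ! k"
      using k col len by (auto intro: nth_mem)
  qed (simp add: len)
qed

lemma colour_of_fibres:
  assumes "finite I" "\<phi> ` I \<subseteq> {1..n}" "i \<in> I"
  shows "colour_of (fibres n I \<phi>) i = \<phi> i"
proof -
  have F: "fibres n I \<phi> \<in> decompositions n" "\<Union>(set (fibres n I \<phi>)) = I"
    using assms by (simp_all add: fibres_in_decompositions Union_fibres in_range_eq)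
  have "\<phi> i \<in> {1..n}"
    using assms by blast
  then have "\<phi> i = Suc (\<phi> i - 1)" "\<phi> i - 1 < n"
    by auto
  then have "i \<in> fibres n I \<phi> ! (\<phi> i - 1)"
    using assms(3) by simp
  then have "i \<in> fibres n I (colour_of (fibres n I \<phi>)) ! (\<phi> i - 1)"
    using decompositionsD(4)[OF F(1)] F(2) by simp
  then show ?thesis
    using \<open>\<phi> i = Suc (\<phi> i - 1)\<close> \<open>\<phi> i - 1 < n\<close> by simp
qed

lemma map_image_decompositions:
  assumes "F \<in> decompositions n" "inj_on \<sigma> (\<Union>(set F))"
  shows "map ((`) \<sigma>) F \<in> decompositions n" "\<Union>(set (map ((`) \<sigma>) F)) = \<sigma> ` \<Union>(set F)"
    "i \<in> \<Union>(set F) \<Longrightarrow> colour_of (map ((`) \<sigma>) F) (\<sigma> i) = colour_of F i"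
proof -
  let ?I = "\<Union>(set F)"
  let ?\<phi> = "colour_of F \<circ> inv_into ?I \<sigma>"
  note F = decompositionsD[OF assms(1)]
  have "fibres n ?I (?\<phi> \<circ> \<sigma>) = fibres n ?I (colour_of F)"
    using assms(2) by (intro fibres_cong) simp
  then have eq: "fibres n (\<sigma> ` ?I) ?\<phi> = map ((`) \<sigma>) F"
    using fibres_image[OF assms(2), of n ?\<phi>] F(4) by simp
  show "map ((`) \<sigma>) F \<in> decompositions n"
    unfolding eq[symmetric] using F(2) by (intro fibres_in_decompositions) simp
  show "\<Union>(set (map ((`) \<sigma>) F)) = \<sigma> ` ?I"
    by auto
  assume i: "i \<in> ?I"
  have "?\<phi> ` \<sigma> ` ?I = colour_of F ` ?I"
    unfolding image_image by (intro image_cong refl) (simp add: inv_into_f_f[OF assms(2)] del: Union_iff)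
  then have "colour_of (map ((`) \<sigma>) F) (\<sigma> i) = ?\<phi> (\<sigma> i)"
    unfolding eq[symmetric] using F(2,3) i by (intro colour_of_fibres) simp_all
  then show "colour_of (map ((`) \<sigma>) F) (\<sigma> i) = colour_of F i"
    using i assms(2) by simp
qed


section \<open>Cochains as functions of colourings\<close>

locale cosymmetric_bicomodule =
  fixes X :: "'x set_bicomodule" and K :: "'k::{comm_ring,comm_monoid_mult} itself"
  assumes linearized: "linearized_bicomodule X" and cosym: "cosymmetric K X"
begin

lemma
  species: "set_species X" and restriction_lres: "restriction X (lres X)"
  using linearized by (simp_all add: linearized_bicomodule_def)

lemmas species_rules = species[unfolded set_species_def]
lemmas lres_rules = restriction_lres[unfolded restriction_def]

lemma trans_obj: "finite I \<Longrightarrow> inj_on \<sigma> I \<Longrightarrow> z \<in> obj X I \<Longrightarrow> trans X I \<sigma> z \<in> obj X (\<sigma> ` I)"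
  by (rule species_rules[THEN conjunct1, rule_format])

lemma trans_cong:
  "finite I \<Longrightarrow> inj_on \<sigma> I \<Longrightarrow> (\<And>i. i \<in> I \<Longrightarrow> \<sigma> i = \<tau> i) \<Longrightarrow> z \<in> obj X I \<Longrightarrow> trans X I \<sigma> z = trans X I \<tau> z"
  by (rule species_rules[THEN conjunct2, THEN conjunct1, rule_format])

lemma lres_obj: "finite I \<Longrightarrow> S \<subseteq> I \<Longrightarrow> z \<in> obj X I \<Longrightarrow> lres X I S z \<in> obj X S"
  by (rule lres_rules[THEN conjunct1, rule_format])

lemma linear_map_ltrans:
  "finite I \<Longrightarrow> inj_on \<sigma> I \<Longrightarrow> linear_map (obj X I) (obj X (\<sigma> ` I)) (ltrans X I \<sigma> :: ('x \<Rightarrow>\<^sub>0 'k) \<Rightarrow> _)"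
  unfolding ltrans_def by (rule linear_map_push) (auto intro: trans_obj)

lemma linear_map_llres:
  "finite I \<Longrightarrow> S \<subseteq> I \<Longrightarrow> linear_map (obj X I) (obj X S) (llres X I S :: ('x \<Rightarrow>\<^sub>0 'k) \<Rightarrow> _)"
  unfolding llres_def by (rule linear_map_push) (auto intro: lres_obj)

lemmas ltrans_lin = linear_mapD(1)[OF linear_map_ltrans]
lemmas llres_lin = linear_mapD(1)[OF linear_map_llres]

lemma ltrans_cong:
  assumes "finite I" "inj_on \<sigma> I" "\<And>i. i \<in> I \<Longrightarrow> \<sigma> i = \<tau> i" "(v :: 'x \<Rightarrow>\<^sub>0 'k) \<in> lin X I"
  shows "ltrans X I \<sigma> v = ltrans X I \<tau> v"
  unfolding ltrans_def using assms(4) by (rule push_cong_on) (rule trans_cong[OF assms(1-3)])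

lemma ltrans_id:
  assumes "finite I" "(v :: 'x \<Rightarrow>\<^sub>0 'k) \<in> lin X I" "\<And>i. i \<in> I \<Longrightarrow> \<sigma> i = i"
  shows "ltrans X I \<sigma> v = v"
proof -
  have "ltrans X I \<sigma> v = ltrans X I id v"
    using assms by (intro ltrans_cong) (auto simp: inj_on_def)
  also have "\<dots> = v"
    unfolding ltrans_def using assms(2)
    by (rule push_id_on)
      (rule species_rules[THEN conjunct2, THEN conjunct2, THEN conjunct1, rule_format, OF assms(1)])
  finally show ?thesis .
qed

lemma ltrans_ltrans:
  assumes "finite I" "inj_on \<sigma> I" "inj_on \<tau> (\<sigma> ` I)" "(v :: 'x \<Rightarrow>\<^sub>0 'k) \<in> lin X I"
  shows "ltrans X (\<sigma> ` I) \<tau> (ltrans X I \<sigma> v) = ltrans X I (\<tau> \<circ> \<sigma>) v"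
  unfolding ltrans_def push_push
proof (rule push_cong_on[OF assms(4)])
  fix z assume "z \<in> obj X I"
  then show "(trans X (\<sigma> ` I) \<tau> \<circ> trans X I \<sigma>) z = trans X I (\<tau> \<circ> \<sigma>) z"
    using species_rules[THEN conjunct2, THEN conjunct2, THEN conjunct2, rule_format, OF assms(1-3)] by simp
qed

lemma llres_self: "finite I \<Longrightarrow> (v :: 'x \<Rightarrow>\<^sub>0 'k) \<in> lin X I \<Longrightarrow> llres X I I v = v"
  unfolding llres_def
  by (rule push_id_on) (auto intro: lres_rules[THEN conjunct2, THEN conjunct2, THEN conjunct1, rule_format])

lemma llres_llres:
  assumes "finite I" "S \<subseteq> I" "U \<subseteq> S" "(v :: 'x \<Rightarrow>\<^sub>0 'k) \<in> lin X I"
  shows "llres X S U (llres X I S v) = llres X I U v"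
  unfolding llres_def push_push
proof (rule push_cong_on[OF assms(4)])
  fix z assume "z \<in> obj X I"
  then show "(lres X S U \<circ> lres X I S) z = lres X I U z"
    using lres_rules[THEN conjunct2, THEN conjunct2, THEN conjunct2, rule_format, OF assms(1-3)] by simp
qed

lemma llres_ltrans:
  assumes "finite I" "S \<subseteq> I" "inj_on \<sigma> I" "(v :: 'x \<Rightarrow>\<^sub>0 'k) \<in> lin X I"
  shows "llres X (\<sigma> ` I) (\<sigma> ` S) (ltrans X I \<sigma> v) = ltrans X S \<sigma> (llres X I S v)"
  unfolding llres_def ltrans_def push_push
proof (rule push_cong_on[OF assms(4)])
  fix z assume "z \<in> obj X I"
  then show "(lres X (\<sigma> ` I) (\<sigma> ` S) \<circ> trans X I \<sigma>) z = (trans X S \<sigma> \<circ> lres X I S) z"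
    using lres_rules[THEN conjunct2, THEN conjunct1, rule_format, OF assms(1-3)] by simp
qed

lemma lrres_eq_llres: "finite I \<Longrightarrow> S \<subseteq> I \<Longrightarrow> (v :: 'x \<Rightarrow>\<^sub>0 'k) \<in> lin X I \<Longrightarrow> lrres X I S v = llres X I S v"
  using cosym by (simp add: cosymmetric_def)

lemma basis_lres: "basis (lres X I S z) = llres X I S (basis z)"
  by (simp add: llres_def)

text \<open>
  Over the zero ring the two restrictions of \<open>z\<close> may differ; cosymmetry only says that the basis
  vectors agree.
\<close>

lemma basis_rres:
  assumes "finite I" "S \<subseteq> I" "z \<in> obj X I"
  shows "basis (rres X I S z) = (llres X I S (basis z) :: 'x \<Rightarrow>\<^sub>0 'k)"
  using lrres_eq_llres[OF assms(1,2) free_module_basis[OF assms(3)]] by (simp add: lrres_def)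

text \<open>
  The value of \<open>\<alpha>\<close> on a colouring. Elements whose colour is not in \<open>{1..n}\<close> are removed by
  restriction, as the outer faces of a cochain remove the elements of the first or the last block.
\<close>

definition hat :: "('x, 'k) cochain \<Rightarrow> nat \<Rightarrow> nat set \<Rightarrow> (nat \<Rightarrow> nat) \<Rightarrow> ('x \<Rightarrow>\<^sub>0 'k) \<Rightarrow> 'k" where
  "hat \<alpha> n I \<phi> v = (if v \<in> lin X I then \<alpha> (fibres n I \<phi>) (llres X I (in_range n I \<phi>) v) else 0)"

lemma cochain_linear_form:
  assumes "\<alpha> \<in> cochains X n" "F \<in> decompositions n"
  shows "\<alpha> F \<in> linear_forms (obj X (\<Union>(set F)))"
  using assms by (simp add: cochains_def)

lemma cochain_natural:
  assumes "\<alpha> \<in> cochains X n" "F \<in> decompositions n" "inj_on \<sigma> (\<Union>(set F))"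
    "(v :: 'x \<Rightarrow>\<^sub>0 'k) \<in> lin X (\<Union>(set F))"
  shows "\<alpha> (map ((`) \<sigma>) F) (ltrans X (\<Union>(set F)) \<sigma> v) = \<alpha> F v"
  using assms unfolding cochains_def by blast

lemma cochain_off_decompositions: "\<alpha> \<in> cochains X n \<Longrightarrow> F \<notin> decompositions n \<Longrightarrow> \<alpha> F = (\<lambda>v. 0)"
  by (simp add: cochains_def)

lemma hat_linear_form:
  assumes "\<alpha> \<in> cochains X n" "finite I"
  shows "hat \<alpha> n I \<phi> \<in> linear_forms (obj X I)"
proof -
  have "\<alpha> (fibres n I \<phi>) \<in> linear_forms (obj X (in_range n I \<phi>))"
    using cochain_linear_form[OF assms(1) fibres_in_decompositions[OF assms(2)]]
    by (simp add: Union_fibres)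
  then show ?thesis
    using linear_forms_comp[OF linear_map_llres[OF assms(2) in_range_subset]]
    by (simp add: hat_def[abs_def])
qed

lemma hat_eq:
  "finite I \<Longrightarrow> \<phi> ` I \<subseteq> {1..n} \<Longrightarrow> v \<in> lin X I \<Longrightarrow> hat \<alpha> n I \<phi> v = \<alpha> (fibres n I \<phi>) v"
  by (simp add: hat_def in_range_eq llres_self)

lemma hat_cong:
  assumes "\<And>i. i \<in> I \<Longrightarrow> \<phi> i = \<psi> i \<or> (\<phi> i \<notin> {1..n} \<and> \<psi> i \<notin> {1..n})"
  shows "hat \<alpha> n I \<phi> = hat \<alpha> n I \<psi>"
proof -
  have "in_range n I \<phi> = in_range n I \<psi>"
    using assms by (fastforce simp: in_range_def)
  then show ?thesis
    using fibres_cong[OF assms] by (simp add: hat_def fun_eq_iff)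
qed

lemma hat_natural:
  assumes "\<alpha> \<in> cochains X n" "finite I" "inj_on \<sigma> I" "v \<in> lin X I"
  shows "hat \<alpha> n (\<sigma> ` I) \<phi> (ltrans X I \<sigma> v) = hat \<alpha> n I (\<phi> \<circ> \<sigma>) v"
proof -
  let ?S = "in_range n I (\<phi> \<circ> \<sigma>)"
  have S: "?S \<subseteq> I" "inj_on \<sigma> ?S" "in_range n (\<sigma> ` I) \<phi> = \<sigma> ` ?S"
    using assms(3) by (auto simp: in_range_def inj_on_def)
  have "hat \<alpha> n (\<sigma> ` I) \<phi> (ltrans X I \<sigma> v) =
      \<alpha> (map ((`) \<sigma>) (fibres n I (\<phi> \<circ> \<sigma>))) (ltrans X ?S \<sigma> (llres X I ?S v))"
    using assms S by (simp add: hat_def ltrans_lin fibres_image llres_ltrans)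
  also have "\<dots> = \<alpha> (fibres n I (\<phi> \<circ> \<sigma>)) (llres X I ?S v)"
    using cochain_natural[OF assms(1) fibres_in_decompositions[OF assms(2)]] assms S llres_lin
    by (simp add: Union_fibres)
  finally show ?thesis
    using assms(4) by (simp add: hat_def)
qed

lemma hat_restrict:
  assumes "finite I" "S \<subseteq> I" "in_range n I \<phi> \<subseteq> S" "v \<in> lin X I"
  shows "hat \<alpha> n S \<phi> (llres X I S v) = hat \<alpha> n I \<phi> v"
proof -
  have "in_range n S \<phi> = in_range n I \<phi>"
    using assms(2,3) by (auto simp: in_range_def)
  moreover from this have "fibres n S \<phi> = fibres n I \<phi>"
    by (metis fibres_in_range)
  ultimately show ?thesis
    using assms llres_lin by (simp add: hat_def llres_llres)
qed

lemma cochains_eqI: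
  assumes "\<alpha> \<in> cochains X n" "\<beta> \<in> cochains X n"
    and "\<And>I \<phi> v. finite I \<Longrightarrow> \<phi> ` I \<subseteq> {1..n} \<Longrightarrow> v \<in> lin X I \<Longrightarrow> hat \<alpha> n I \<phi> v = hat \<beta> n I \<phi> v"
  shows "\<alpha> = \<beta>"
proof (intro ext)
  fix F and v :: "'x \<Rightarrow>\<^sub>0 'k"
  show "\<alpha> F v = \<beta> F v"
  proof (cases "F \<in> decompositions n \<and> v \<in> lin X (\<Union>(set F))")
    case True
    then show ?thesis
      using assms(3)[of "\<Union>(set F)" "colour_of F" v] decompositionsD[of F n] by (auto simp: hat_eq)
  next
    case False
    then show ?thesis
      using assms(1,2)[THEN cochain_off_decompositions, of F]
        assms(1,2)[THEN cochain_linear_form, of F, THEN linear_formsD(3), of v]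
      by (cases "F \<in> decompositions n") auto
  qed
qed

text \<open>
  The data that define a cochain in terms of colourings.
\<close>

definition natural_family ::
    "nat \<Rightarrow> (nat set \<Rightarrow> (nat \<Rightarrow> nat) \<Rightarrow> ('x \<Rightarrow>\<^sub>0 'k) \<Rightarrow> 'k) \<Rightarrow> bool" where
  "natural_family n B \<longleftrightarrow>
     (\<forall>I \<phi>. finite I \<longrightarrow> \<phi> ` I \<subseteq> {1..n} \<longrightarrow> B I \<phi> \<in> linear_forms (obj X I)) \<and>
     (\<forall>I \<phi> \<psi>. finite I \<longrightarrow> \<phi> ` I \<subseteq> {1..n} \<longrightarrow> (\<forall>i\<in>I. \<phi> i = \<psi> i) \<longrightarrow> B I \<phi> = B I \<psi>) \<and>
     (\<forall>I \<phi> \<sigma>. finite I \<longrightarrow> inj_on \<sigma> I \<longrightarrow> \<phi> ` \<sigma> ` I \<subseteq> {1..n} \<longrightarrow>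
        (\<forall>v\<in>lin X I. B (\<sigma> ` I) \<phi> (ltrans X I \<sigma> v) = B I (\<phi> \<circ> \<sigma>) v))"

definition cochain_of ::
    "nat \<Rightarrow> (nat set \<Rightarrow> (nat \<Rightarrow> nat) \<Rightarrow> ('x \<Rightarrow>\<^sub>0 'k) \<Rightarrow> 'k) \<Rightarrow> ('x, 'k) cochain" where
  "cochain_of n B F = (if F \<in> decompositions n then B (\<Union>(set F)) (colour_of F) else (\<lambda>v. 0))"

lemma natural_familyD:
  assumes "natural_family n B" "finite I"
  shows "\<phi> ` I \<subseteq> {1..n} \<Longrightarrow> B I \<phi> \<in> linear_forms (obj X I)"
    "\<phi> ` I \<subseteq> {1..n} \<Longrightarrow> (\<And>i. i \<in> I \<Longrightarrow> \<phi> i = \<psi> i) \<Longrightarrow> B I \<phi> = B I \<psi>"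
    "inj_on \<sigma> I \<Longrightarrow> \<phi> ` \<sigma> ` I \<subseteq> {1..n} \<Longrightarrow> v \<in> lin X I \<Longrightarrow>
      B (\<sigma> ` I) \<phi> (ltrans X I \<sigma> v) = B I (\<phi> \<circ> \<sigma>) v"
proof -
  note B = assms(1)[unfolded natural_family_def]
  show "\<phi> ` I \<subseteq> {1..n} \<Longrightarrow> B I \<phi> \<in> linear_forms (obj X I)"
    by (rule B[THEN conjunct1, rule_format, OF assms(2)])
  show "\<phi> ` I \<subseteq> {1..n} \<Longrightarrow> (\<And>i. i \<in> I \<Longrightarrow> \<phi> i = \<psi> i) \<Longrightarrow> B I \<phi> = B I \<psi>"
    by (rule B[THEN conjunct2, THEN conjunct1, rule_format, OF assms(2)])
  show "inj_on \<sigma> I \<Longrightarrow> \<phi> ` \<sigma> ` I \<subseteq> {1..n} \<Longrightarrow> v \<in> lin X I \<Longrightarrow>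
      B (\<sigma> ` I) \<phi> (ltrans X I \<sigma> v) = B I (\<phi> \<circ> \<sigma>) v"
    by (rule B[THEN conjunct2, THEN conjunct2, rule_format, OF assms(2)])
qed

lemma cochain_of_fibres:
  assumes "natural_family n B" "finite I" "\<phi> ` I \<subseteq> {1..n}"
  shows "cochain_of n B (fibres n I \<phi>) = B I \<phi>"
  using assms natural_familyD(2)[OF assms, of "colour_of (fibres n I \<phi>)"]
  by (simp add: cochain_of_def fibres_in_decompositions Union_fibres in_range_eq colour_of_fibres)

lemma cochain_of_in_cochains:
  assumes B: "natural_family n B"
  shows "cochain_of n B \<in> cochains X n"
  unfolding cochains_def
proof (intro CollectI conjI ballI allI impI)
  fix F assume F: "F \<in> decompositions n"
  note F' = decompositionsD[OF F]
  show "cochain_of n B F \<in> linear_forms (obj X (\<Union>(set F)))"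
    using natural_familyD(1)[OF B F'(2,3)] F by (simp add: cochain_of_def)
  fix \<sigma> :: "nat \<Rightarrow> nat" and v :: "'x \<Rightarrow>\<^sub>0 'k" assume \<sigma>: "inj_on \<sigma> (\<Union>(set F))" and v: "v \<in> lin X (\<Union>(set F))"
  note G = map_image_decompositions[OF F \<sigma>]
  let ?G = "map ((`) \<sigma>) F" and ?I = "\<Union>(set F)"
  have "cochain_of n B ?G (ltrans X ?I \<sigma> v) = B (\<sigma> ` ?I) (colour_of ?G) (ltrans X ?I \<sigma> v)"
    using G(1,2) by (simp add: cochain_of_def)
  also have "\<dots> = B ?I (colour_of ?G \<circ> \<sigma>) v"
    using decompositionsD(3)[OF G(1)] G(2) v by (intro natural_familyD(3)[OF B F'(2) \<sigma>]) auto
  also have "\<dots> = B ?I (colour_of F) v"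
    using G(3) F'(3) by (intro fun_cong[OF natural_familyD(2)[OF B F'(2)]]) (auto simp: image_subset_iff)
  finally show "cochain_of n B ?G (ltrans X ?I \<sigma> v) = cochain_of n B F v"
    using F by (simp add: cochain_of_def)
qed (simp add: cochain_of_def)

lemma hat_cochain_of:
  assumes "natural_family n B" "finite I" "v \<in> lin X I"
  shows "hat (cochain_of n B) n I \<phi> v = B (in_range n I \<phi>) \<phi> (llres X I (in_range n I \<phi>) v)"
proof -
  have "cochain_of n B (fibres n (in_range n I \<phi>) \<phi>) = B (in_range n I \<phi>) \<phi>"
    using assms(1,2) by (intro cochain_of_fibres finite_in_range) (auto simp: in_range_def)
  then show ?thesis
    using assms(3) by (simp add: hat_def fibres_in_range)
qed

text \<open>
  For the last face the right restriction is replaced by the left one; this is where cosymmetry enters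
  the differential.
\<close>

lemma coface_fibres:
  assumes I: "finite I" "\<phi> ` I \<subseteq> {1..Suc n}" and v: "(v :: 'x \<Rightarrow>\<^sub>0 'k) \<in> lin X I" and k: "k \<le> Suc n"
  shows "coface X n k \<alpha> (fibres (Suc n) I \<phi>) v = hat \<alpha> n I (merge k \<circ> \<phi>) v"
proof -
  let ?F = "fibres (Suc n) I \<phi>"
  have pos: "0 < \<phi> i" "\<phi> i \<le> Suc n" if "i \<in> I" for i
    using I(2) that by (auto simp: image_subset_iff Suc_le_eq)
  have U: "\<Union>(set ?F) = I"
    using I by (simp add: Union_fibres in_range_eq)
  have nonempty: "?F \<noteq> []"
    using length_fibres[of "Suc n" I \<phi>] by (metis length_0_conv nat.distinct(1))
  consider "k = 0" | "k = Suc n" | "0 < k" "k \<le> n"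
    using k by linarith
  then show ?thesis
  proof cases
    case 1
    have "tl ?F = fibres n I (merge k \<circ> \<phi>)"
      by (rule nth_equalityI) (use 1 pos in \<open>auto simp: nth_tl merge_def\<close>)
    moreover have "I - hd ?F = in_range n I (merge k \<circ> \<phi>)"
      using 1 pos by (auto simp: hd_conv_nth nonempty in_range_def merge_def Suc_le_eq le_Suc_eq less_Suc_eq_le) force+
    ultimately show ?thesis
      using v 1 by (simp add: coface_def U hat_def)
  next
    case 2
    have "butlast ?F = fibres n I (merge k \<circ> \<phi>)"
      by (rule nth_equalityI) (use 2 pos in \<open>auto simp: nth_butlast merge_def\<close>)
    moreover have "I - last ?F = in_range n I (merge k \<circ> \<phi>)"
      using 2 pos by (auto simp: last_conv_nth nonempty in_range_def merge_def Suc_le_eq) (metis le_SucE pos(2))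
    moreover have "in_range n I (merge k \<circ> \<phi>) \<subseteq> I"
      by (rule in_range_subset)
    ultimately show ?thesis
      using v 2 I(1) by (simp add: coface_def U hat_def lrres_eq_llres)
  next
    case 3
    have "take (k - 1) ?F @ (?F ! (k - 1) \<union> ?F ! k) # drop (k + 1) ?F = fibres n I (merge k \<circ> \<phi>)"
    proof (rule nth_equalityI)
      fix m assume "m < length (take (k - 1) ?F @ (?F ! (k - 1) \<union> ?F ! k) # drop (k + 1) ?F)"
      then have "m < n"
        using 3 by auto
      then show "(take (k - 1) ?F @ (?F ! (k - 1) \<union> ?F ! k) # drop (k + 1) ?F) ! m =
          fibres n I (merge k \<circ> \<phi>) ! m"
        using 3 pos by (auto simp: nth_append nth_Cons' merge_def)
    qed (use 3 in auto)
    moreover have "(merge k \<circ> \<phi>) ` I \<subseteq> {1..n}"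
      using 3 pos by (force simp: merge_def)
    ultimately show ?thesis
      using 3 v I(1) by (simp add: coface_def U hat_eq)
  qed
qed

end


lemma linear_extension_cong:
  "(\<And>x. x \<in> A \<Longrightarrow> h x = h' x) \<Longrightarrow> linear_extension A h = linear_extension A h'"
  by (rule linear_forms_eqI[of _ A]) (auto simp: linear_extension_in_linear_forms)

context cosymmetric_bicomodule
begin

abbreviation cochain_group :: "nat \<Rightarrow> ('x, 'k) cochain set" where
  "cochain_group \<equiv> cochains X"

abbreviation cocycle_group :: "nat \<Rightarrow> ('x, 'k) cochain set" where
  "cocycle_group \<equiv> cocycles X"

subsection \<open>The differential\<close>

lemma hat_coboundary:
  assumes "finite I" "v \<in> lin X I"
  shows "hat (coboundary X n \<alpha>) (Suc n) I \<phi> v = (\<Sum>k\<le>Suc n. signed k (hat \<alpha> n I (merge k \<circ> \<phi>) v))"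
proof -
  define S where "S = in_range (Suc n) I \<phi>"
  have S: "finite S" "S \<subseteq> I" "\<phi> ` S \<subseteq> {1..Suc n}"
    using assms(1) in_range_subset by (auto simp: S_def finite_in_range) (auto simp: in_range_def)
  have Sv: "llres X I S v \<in> lin X S"
    using llres_lin S assms by blast
  have F: "fibres (Suc n) I \<phi> = fibres (Suc n) S \<phi>"
    by (simp add: S_def fibres_in_range)
  have "hat (coboundary X n \<alpha>) (Suc n) I \<phi> v = coboundary X n \<alpha> (fibres (Suc n) S \<phi>) (llres X I S v)"
    using assms(2) by (simp add: hat_def F flip: S_def)
  also have "\<dots> = (\<Sum>k\<le>Suc n. signed k (coface X n k \<alpha> (fibres (Suc n) S \<phi>) (llres X I S v)))"
    using S Sv
    by (simp add: coboundary_def fibres_in_decompositions Union_fibres in_range_eq minus_one_power_mult)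
  also have "\<dots> = (\<Sum>k\<le>Suc n. signed k (hat \<alpha> n I (merge k \<circ> \<phi>) v))"
  proof (intro sum.cong refl)
    fix k assume "k \<in> {..Suc n}"
    then have k: "k \<le> Suc n"
      by simp
    have "in_range n I (merge k \<circ> \<phi>) \<subseteq> S"
      using merge_in_range[OF _ k] by (auto simp: in_range_def S_def)
    then show "signed k (coface X n k \<alpha> (fibres (Suc n) S \<phi>) (llres X I S v)) =
        signed k (hat \<alpha> n I (merge k \<circ> \<phi>) v)"
      using coface_fibres[OF S(1,3) Sv k] hat_restrict[OF assms(1) S(2) _ assms(2)] by simp
  qed
  finally show ?thesis .
qed

lemma coboundary_in_cochains:
  assumes \<alpha>: "\<alpha> \<in> cochain_group n"
  shows "coboundary X n \<alpha> \<in> cochain_group (Suc n)"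
proof -
  let ?B = "\<lambda>I \<phi> v. \<Sum>k\<le>Suc n. signed k (hat \<alpha> n I (merge k \<circ> \<phi>) v)"
  have B: "natural_family (Suc n) ?B"
    unfolding natural_family_def
  proof (intro conjI allI impI ballI)
    show "?B I \<phi> \<in> linear_forms (obj X I)" if "finite I" for I \<phi>
      by (intro linear_forms_sum linear_forms_signed hat_linear_form[OF \<alpha> that])
    show "?B I \<phi> = ?B I \<psi>" if "\<forall>i\<in>I. \<phi> i = \<psi> i" for I \<phi> \<psi>
    proof -
      have "hat \<alpha> n I (merge k \<circ> \<phi>) = hat \<alpha> n I (merge k \<circ> \<psi>)" for k
        using that by (intro hat_cong) simp
      then show ?thesis
        by simp
    qed
    show "?B (\<sigma> ` I) \<phi> (ltrans X I \<sigma> v) = ?B I (\<phi> \<circ> \<sigma>) v"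
      if "finite I" "inj_on \<sigma> I" "v \<in> lin X I" for I \<phi> \<sigma> v
      using hat_natural[OF \<alpha> that] by (simp add: comp_assoc)
  qed
  have "coboundary X n \<alpha> = cochain_of (Suc n) ?B"
  proof (intro ext)
    fix F :: "nat set list" and v :: "'x \<Rightarrow>\<^sub>0 'k"
    let ?I = "\<Union>(set F)"
    show "coboundary X n \<alpha> F v = cochain_of (Suc n) ?B F v"
    proof (cases "F \<in> decompositions (Suc n) \<and> v \<in> lin X ?I")
      case True
      then have F: "finite ?I" "colour_of F ` ?I \<subseteq> {1..Suc n}" "fibres (Suc n) ?I (colour_of F) = F"
        using decompositionsD by blast+
      have "coboundary X n \<alpha> F v = hat (coboundary X n \<alpha>) (Suc n) ?I (colour_of F) v"
        using True F by (simp only: hat_eq)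
      then show ?thesis
        using True F by (simp only: hat_coboundary cochain_of_def if_True)
    next
      case False
      then show ?thesis
        by (auto simp: coboundary_def cochain_of_def hat_def)
    qed
  qed
  then show ?thesis
    using cochain_of_in_cochains[OF B] by simp
qed

lemma cochains_zero: "(\<lambda>F v. 0) \<in> cochain_group n"
  by (simp add: cochains_def linear_forms_zero)

lemma cochains_add:
  "\<alpha> \<in> cochain_group n \<Longrightarrow> \<beta> \<in> cochain_group n \<Longrightarrow> (\<lambda>F v. \<alpha> F v + \<beta> F (v :: 'x \<Rightarrow>\<^sub>0 'k)) \<in> cochain_group n"
  by (simp add: cochains_def linear_forms_add)

lemma cochains_diff:
  "\<alpha> \<in> cochain_group n \<Longrightarrow> \<beta> \<in> cochain_group n \<Longrightarrow> (\<lambda>F v. \<alpha> F v - \<beta> F (v :: 'x \<Rightarrow>\<^sub>0 'k)) \<in> cochain_group n"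
  by (simp add: cochains_def linear_forms_diff)

lemma cochains_mult:
  "\<alpha> \<in> cochain_group n \<Longrightarrow> (\<lambda>F v. c * \<alpha> F (v :: 'x \<Rightarrow>\<^sub>0 'k)) \<in> cochain_group n"
  by (simp add: cochains_def linear_forms_mult)

lemma hat_zero [simp]: "hat (\<lambda>F v. 0) n I \<phi> v = 0"
  by (simp add: hat_def)

lemma hat_add: "hat (\<lambda>F v. \<alpha> F v + \<beta> F v) n I \<phi> v = hat \<alpha> n I \<phi> v + hat \<beta> n I \<phi> v"
  by (simp add: hat_def)

lemma hat_diff: "hat (\<lambda>F v. \<alpha> F v - \<beta> F v) n I \<phi> v = hat \<alpha> n I \<phi> v - hat \<beta> n I \<phi> v"
  by (simp add: hat_def)

lemma hat_mult: "hat (\<lambda>F v. c * \<alpha> F v) n I \<phi> v = c * hat \<alpha> n I \<phi> v"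
  by (simp add: hat_def)

lemma cocycles_in_cochains: "\<alpha> \<in> cocycle_group n \<Longrightarrow> \<alpha> \<in> cochain_group n"
  by (simp add: cocycles_def)

lemma cocycle_hat:
  assumes "\<alpha> \<in> cocycle_group n" "finite I" "v \<in> lin X I"
  shows "(\<Sum>k\<le>Suc n. signed k (hat \<alpha> n I (merge k \<circ> \<phi>) v)) = 0"
  using assms hat_coboundary[OF assms(2,3), of n \<alpha> \<phi>] by (simp add: cocycles_def)

lemma cocyclesI:
  assumes \<alpha>: "\<alpha> \<in> cochain_group n"
    and "\<And>I \<phi> v. finite I \<Longrightarrow> v \<in> lin X I \<Longrightarrow> (\<Sum>k\<le>Suc n. signed k (hat \<alpha> n I (merge k \<circ> \<phi>) v)) = 0"
  shows "\<alpha> \<in> cocycle_group n"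
proof -
  have "coboundary X n \<alpha> = (\<lambda>F v. 0)"
    using coboundary_in_cochains[OF \<alpha>] cochains_zero
    by (rule cochains_eqI) (simp add: hat_coboundary assms(2))
  then show ?thesis
    using \<alpha> by (simp add: cocycles_def)
qed

lemma coboundary_in_cocycles:
  assumes "\<alpha> \<in> cochain_group n"
  shows "coboundary X n \<alpha> \<in> cocycle_group (Suc n)"
proof (rule cocyclesI[OF coboundary_in_cochains[OF assms]])
  fix I :: "nat set" and \<phi> :: "nat \<Rightarrow> nat" and v :: "'x \<Rightarrow>\<^sub>0 'k"
  assume "finite I" "v \<in> lin X I"
  then show "(\<Sum>k\<le>Suc (Suc n). signed k (hat (coboundary X n \<alpha>) (Suc n) I (merge k \<circ> \<phi>) v)) = 0"
    using alternating_merge_merge_sum[of "\<lambda>\<phi>. hat \<alpha> n I \<phi> v" \<phi> n]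
    by (simp only: hat_coboundary signed_sum signed_signed)
qed

lemma cocycles_add:
  assumes "\<alpha> \<in> cocycle_group n" "\<beta> \<in> cocycle_group n"
  shows "(\<lambda>F v. \<alpha> F v + \<beta> F (v :: 'x \<Rightarrow>\<^sub>0 'k)) \<in> cocycle_group n"
  using assms[THEN cocycles_in_cochains] assms[THEN cocycle_hat]
  by (intro cocyclesI cochains_add) (simp_all add: hat_add signed_plus sum.distrib)

lemma cocycles_mult:
  assumes "\<alpha> \<in> cocycle_group n"
  shows "(\<lambda>F v. c * \<alpha> F (v :: 'x \<Rightarrow>\<^sub>0 'k)) \<in> cocycle_group n"
  using assms[THEN cocycles_in_cochains] assms[THEN cocycle_hat]
  by (intro cocyclesI cochains_mult)
    (simp_all add: hat_mult signed_mult_right[symmetric] sum_distrib_left[symmetric])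

lemma cocycles_diff:
  assumes "\<alpha> \<in> cocycle_group n" "\<beta> \<in> cocycle_group n"
  shows "(\<lambda>F v. \<alpha> F v - \<beta> F (v :: 'x \<Rightarrow>\<^sub>0 'k)) \<in> cocycle_group n"
proof (intro cocyclesI cochains_diff assms[THEN cocycles_in_cochains])
  fix I :: "nat set" and \<phi> :: "nat \<Rightarrow> nat" and v :: "'x \<Rightarrow>\<^sub>0 'k"
  assume I: "finite I" "v \<in> lin X I"
  have "(\<Sum>k\<le>Suc n. signed k (a k - b k)) = (\<Sum>k\<le>Suc n. signed k (a k)) - (\<Sum>k\<le>Suc n. signed k (b k))"
    for a b :: "nat \<Rightarrow> 'k"
    by (simp add: signed_plus sum.distrib sum_negf diff_conv_add_uminus del: add_uminus_conv_diff)
  then show "(\<Sum>k\<le>Suc n. signed k (hat (\<lambda>F v. \<alpha> F v - \<beta> F v) n I (merge k \<circ> \<phi>) v)) = 0"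
    using assms[THEN cocycle_hat, OF I] by (simp add: hat_diff)
qed


subsection \<open>The cup product\<close>

definition cup_family :: "nat \<Rightarrow> nat \<Rightarrow> ('x, 'k) cochain \<Rightarrow> ('x, 'k) cochain \<Rightarrow>
    nat set \<Rightarrow> (nat \<Rightarrow> nat) \<Rightarrow> ('x \<Rightarrow>\<^sub>0 'k) \<Rightarrow> 'k" where
  "cup_family p q \<alpha> \<beta> I \<phi> =
     linear_extension (obj X I) (\<lambda>z. hat \<alpha> p I \<phi> (basis z) * hat \<beta> q I (\<lambda>i. \<phi> i - p) (basis z))"

lemma natural_family_cup_family:
  assumes \<alpha>: "\<alpha> \<in> cochain_group p" and \<beta>: "\<beta> \<in> cochain_group q"
  shows "natural_family (p + q) (cup_family p q \<alpha> \<beta>)"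
  unfolding natural_family_def
proof (intro conjI allI impI ballI)
  show "cup_family p q \<alpha> \<beta> I \<phi> \<in> linear_forms (obj X I)" for I \<phi>
    by (simp add: cup_family_def linear_extension_in_linear_forms)
next
  fix I :: "nat set" and \<phi> \<psi> :: "nat \<Rightarrow> nat"
  assume "\<forall>i\<in>I. \<phi> i = \<psi> i"
  then have "hat \<alpha> p I \<phi> = hat \<alpha> p I \<psi>" "hat \<beta> q I (\<lambda>i. \<phi> i - p) = hat \<beta> q I (\<lambda>i. \<psi> i - p)"
    by (auto intro!: hat_cong)
  then show "cup_family p q \<alpha> \<beta> I \<phi> = cup_family p q \<alpha> \<beta> I \<psi>"
    by (simp add: cup_family_def)
next
  fix I \<phi> and \<sigma> :: "nat \<Rightarrow> nat" and v :: "'x \<Rightarrow>\<^sub>0 'k"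
  assume I: "finite I" "inj_on \<sigma> I" and v: "v \<in> lin X I"
  let ?f = "\<lambda>v. if v \<in> lin X I then cup_family p q \<alpha> \<beta> (\<sigma> ` I) \<phi> (ltrans X I \<sigma> v) else 0"
  have "?f = cup_family p q \<alpha> \<beta> I (\<phi> \<circ> \<sigma>)"
  proof (rule linear_forms_eqI)
    show "?f \<in> linear_forms (obj X I)"
      unfolding cup_family_def
      by (rule linear_forms_comp[OF linear_map_ltrans[OF I] linear_extension_in_linear_forms])
    show "cup_family p q \<alpha> \<beta> I (\<phi> \<circ> \<sigma>) \<in> linear_forms (obj X I)"
      by (simp add: cup_family_def linear_extension_in_linear_forms)
    fix z assume z: "z \<in> obj X I"
    note b = free_module_basis[OF z, where ?'b = 'k]
    have "basis (trans X I \<sigma> z) = (ltrans X I \<sigma> (basis z) :: 'x \<Rightarrow>\<^sub>0 'k)"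
      by (simp add: ltrans_def)
    then show "?f (basis z) = cup_family p q \<alpha> \<beta> I (\<phi> \<circ> \<sigma>) (basis z)"
      using z b trans_obj[OF I z] hat_natural[OF \<alpha> I b, of \<phi>] hat_natural[OF \<beta> I b, of "\<lambda>i. \<phi> i - p"]
      by (simp add: cup_family_def ltrans_def comp_def)
  qed
  then show "cup_family p q \<alpha> \<beta> (\<sigma> ` I) \<phi> (ltrans X I \<sigma> v) = cup_family p q \<alpha> \<beta> I (\<phi> \<circ> \<sigma>) v"
    using v by (simp add: fun_eq_iff) metis
qed

lemma cup_eq_cochain_of: "cup X p q \<alpha> \<beta> = cochain_of (p + q) (cup_family p q \<alpha> \<beta>)"
proof
  fix F :: "nat set list"
  show "cup X p q \<alpha> \<beta> F = cochain_of (p + q) (cup_family p q \<alpha> \<beta>) F"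
  proof (cases "F \<in> decompositions (p + q)")
    case True
    define I where "I = \<Union>(set F)"
    define \<phi> where "\<phi> = colour_of F"
    have F: "length F = p + q" "finite I" "fibres (p + q) I \<phi> = F"
      using decompositionsD[OF True] by (simp_all add: I_def \<phi>_def)
    have take: "take p F = fibres p I \<phi>"
      unfolding F(3)[symmetric] by (rule nth_equalityI) auto
    have drop: "drop p F = fibres q I (\<lambda>i. \<phi> i - p)"
      unfolding F(3)[symmetric] by (rule nth_equalityI) (auto simp: less_diff_conv)
    have "linear_extension (obj X I) (\<lambda>z. \<alpha> (take p F) (basis (rres X I (\<Union>(set (take p F))) z)) *
          \<beta> (drop p F) (basis (lres X I (\<Union>(set (drop p F))) z))) = cup_family p q \<alpha> \<beta> I \<phi>"
      unfolding cup_family_def take drop Union_fibres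
      using F(2) by (intro linear_extension_cong)
        (simp add: basis_rres basis_lres in_range_subset hat_def free_module_basis)
    then show ?thesis
      using True by (simp add: cup_def Let_def cochain_of_def flip: I_def \<phi>_def)
  qed (simp add: cup_def cochain_of_def)
qed

lemma cup_in_cochains:
  "\<alpha> \<in> cochain_group p \<Longrightarrow> \<beta> \<in> cochain_group q \<Longrightarrow> cup X p q \<alpha> \<beta> \<in> cochain_group (p + q)"
  by (simp add: cup_eq_cochain_of cochain_of_in_cochains natural_family_cup_family)

lemma hat_cup:
  assumes "\<alpha> \<in> cochain_group p" "\<beta> \<in> cochain_group q" "finite I" "z \<in> obj X I"
  shows "hat (cup X p q \<alpha> \<beta>) (p + q) I \<phi> (basis z) =
    hat \<alpha> p I \<phi> (basis z) * hat \<beta> q I (\<lambda>i. \<phi> i - p) (basis z)"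
proof -
  let ?S = "in_range (p + q) I \<phi>"
  have S: "?S \<subseteq> I" "in_range p I \<phi> \<subseteq> ?S" "in_range q I (\<lambda>i. \<phi> i - p) \<subseteq> ?S"
    by (auto simp: in_range_def)
  note b = free_module_basis[OF assms(4), where ?'b = 'k]
  have "hat (cup X p q \<alpha> \<beta>) (p + q) I \<phi> (basis z) =
      cup_family p q \<alpha> \<beta> ?S \<phi> (basis (lres X I ?S z))"
    using assms b
    by (simp add: cup_eq_cochain_of hat_cochain_of natural_family_cup_family basis_lres)
  also have "\<dots> = hat \<alpha> p ?S \<phi> (llres X I ?S (basis z)) *
      hat \<beta> q ?S (\<lambda>i. \<phi> i - p) (llres X I ?S (basis z))"
    using lres_obj[OF assms(3) S(1) assms(4)] by (simp add: cup_family_def flip: basis_lres)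
  also have "\<dots> = hat \<alpha> p I \<phi> (basis z) * hat \<beta> q I (\<lambda>i. \<phi> i - p) (basis z)"
    using hat_restrict[OF assms(3) S(1) S(2) b] hat_restrict[OF assms(3) S(1) S(3) b] by simp
  finally show ?thesis .
qed

text \<open>
  In \<open>hat_cup\<close>, the faces with \<open>k \<le> p\<close> act on \<open>\<alpha>\<close> and shift the colours seen by \<open>\<beta>\<close>; the others
  act on \<open>\<beta>\<close> only. The differentials of \<open>\<alpha>\<close> and \<open>\<beta>\<close> are complete up to the last face of \<open>\<alpha>\<close> and
  the first face of \<open>\<beta>\<close>, and these two missing terms cancel.
\<close>

lemma cup_in_cocycles:
  assumes "\<alpha> \<in> cocycle_group p" "\<beta> \<in> cocycle_group q"
  shows "cup X p q \<alpha> \<beta> \<in> cocycle_group (p + q)"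
proof (rule cocyclesI)
  note \<alpha> = cocycles_in_cochains[OF assms(1)] and \<beta> = cocycles_in_cochains[OF assms(2)]
  show cup: "cup X p q \<alpha> \<beta> \<in> cochain_group (p + q)"
    using cup_in_cochains[OF \<alpha> \<beta>] .
  fix I :: "nat set" and \<phi> :: "nat \<Rightarrow> nat" and v :: "'x \<Rightarrow>\<^sub>0 'k"
  assume I: "finite I"
  let ?d = "\<lambda>v. \<Sum>k\<le>Suc (p + q). signed k (hat (cup X p q \<alpha> \<beta>) (p + q) I (merge k \<circ> \<phi>) v)"
  have "?d = (\<lambda>v. 0)"
  proof (rule linear_forms_eqI)
    show "?d \<in> linear_forms (obj X I)"
      by (intro linear_forms_sum linear_forms_signed hat_linear_form[OF cup I])
    show "(\<lambda>v :: 'x \<Rightarrow>\<^sub>0 'k. 0) \<in> linear_forms (obj X I)"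
      by (rule linear_forms_zero)
    fix z assume z: "z \<in> obj X I"
    note b = free_module_basis[OF z, where ?'b = 'k]
    let ?\<phi>p = "\<lambda>i. \<phi> i - p" and ?\<phi>p' = "\<lambda>i. \<phi> i - Suc p"
    let ?a = "\<lambda>\<psi>. hat \<alpha> p I \<psi> (basis z)" and ?b = "\<lambda>\<psi>. hat \<beta> q I \<psi> (basis z)"
    have low: "?b (\<lambda>i. (merge k \<circ> \<phi>) i - p) = ?b ?\<phi>p'" if "k \<le> p" for k
      using that by (intro arg_cong[where f = ?b]) (auto simp: merge_def)
    have high: "?a (merge (p + k) \<circ> \<phi>) = ?a \<phi>" if "1 \<le> k" for k
      using that by (intro fun_cong[OF hat_cong]) (auto simp: merge_def)
    have high': "(\<lambda>i. (merge (p + k) \<circ> \<phi>) i - p) = merge k \<circ> ?\<phi>p" for k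
      by (auto simp: merge_def)
    have zero': "merge 0 \<circ> ?\<phi>p = ?\<phi>p'"
      by (auto simp: merge_def)
    let ?t = "\<lambda>k. signed k (?a (merge k \<circ> \<phi>) * ?b (\<lambda>i. (merge k \<circ> \<phi>) i - p))"
    have "?d (basis z) = sum ?t {..Suc (p + q)}"
      using hat_cup[OF \<alpha> \<beta> I z] by simp
    also have "\<dots> = sum ?t ({..p} \<union> {Suc p..Suc (p + q)})"
      by (intro sum.cong) auto
    also have "\<dots> = sum ?t {..p} + sum ?t {Suc p..Suc (p + q)}"
      by (rule sum.union_disjoint) auto
    also have "sum ?t {..p} = (\<Sum>k\<le>p. signed k (?a (merge k \<circ> \<phi>))) * ?b ?\<phi>p'"
      unfolding sum_distrib_right
      by (intro sum.cong refl) (simp only: low atMost_iff signed_mult_left)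
    also have "(\<Sum>k\<le>p. signed k (?a (merge k \<circ> \<phi>))) = signed p (?a \<phi>)"
      using cocycle_hat[OF assms(1) I b, of \<phi>] high[of 1] by (simp add: sum.atMost_Suc)
    also have "sum ?t {Suc p..Suc (p + q)} = (\<Sum>k\<in>{1..Suc q}. ?t (p + k))"
      by (rule sum.reindex_bij_witness[of _ "\<lambda>k. p + k" "\<lambda>k. k - p"]) auto
    also have "\<dots> = signed p (?a \<phi> * (\<Sum>k\<in>{1..Suc q}. signed k (?b (merge k \<circ> ?\<phi>p))))"
      unfolding sum_distrib_left signed_sum
      by (intro sum.cong refl) (simp only: high high' signed_mult_right signed_signed atLeastAtMost_iff)
    also have "(\<Sum>k\<in>{1..Suc q}. signed k (?b (merge k \<circ> ?\<phi>p))) = - ?b ?\<phi>p'"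
    proof -
      have "{..Suc q} = insert 0 {1..Suc q}"
        by auto
      then show ?thesis
        using cocycle_hat[OF assms(2) I b, of ?\<phi>p] zero' by (simp add: eq_neg_iff_add_eq_0 add.commute)
    qed
    finally show "?d (basis z) = 0"
      by (simp only: signed_mult_left mult_minus_right signed_minus right_minus)
  qed
  then show "?d v = 0"
    by (simp add: fun_eq_iff)
qed

end


section \<open>The alternation of a cochain\<close>

lemma std_bij_strict_mono_on: "finite S \<Longrightarrow> strict_mono_on S (std_bij S)"
  unfolding strict_mono_on_def std_bij_def
proof (intro allI impI psubset_card_mono psubsetI)
  fix r s assume *: "finite S" "r \<in> S \<and> s \<in> S \<and> r < s"
  then show "{y \<in> S. y \<le> r} \<subseteq> {y \<in> S. y \<le> s}" "finite {y \<in> S. y \<le> s}"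
    by auto
  have "s \<in> {y \<in> S. y \<le> s}" "s \<notin> {y \<in> S. y \<le> r}"
    using * by auto
  then show "{y \<in> S. y \<le> r} \<noteq> {y \<in> S. y \<le> s}"
    by blast
qed

lemma std_bij_inj_on: "finite S \<Longrightarrow> inj_on (std_bij S) S"
  by (rule strict_mono_on_imp_inj_on[OF std_bij_strict_mono_on])

lemma std_bij_image:
  assumes "finite S"
  shows "std_bij S ` S = {1..card S}"
proof (rule card_subset_eq)
  have "std_bij S i \<in> {1..card S}" if "i \<in> S" for i
  proof -
    have "{y \<in> S. y \<le> i} \<subseteq> S" "{y \<in> S. y \<le> i} \<noteq> {}"
      using that by auto
    then show ?thesis
      using assms by (auto simp: std_bij_def Suc_le_eq card_gt_0_iff intro: card_mono)
  qed
  then show "std_bij S ` S \<subseteq> {1..card S}"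
    by blast
  show "card (std_bij S ` S) = card {1..card S}"
    using card_image[OF std_bij_inj_on[OF assms]] by simp
qed simp

lemma sum_pairs_cong:
  "(\<And>S T. (S, T) \<in> D \<Longrightarrow> f S T = g S T) \<Longrightarrow> (\<Sum>(S, T)\<in>D. f S T) = (\<Sum>(S, T)\<in>D. g S T)"
  by (rule sum.cong) auto

context cosymmetric_bicomodule
begin

text \<open>
  The fibres of \<open>position xs\<close> are the singletons of the entries of \<open>xs\<close>, in the order of \<open>xs\<close>.
\<close>

definition alternation :: "nat set \<Rightarrow> ('x, 'k) cochain \<Rightarrow> ('x \<Rightarrow>\<^sub>0 'k) \<Rightarrow> 'k" where
  "alternation I \<alpha> v =
     (\<Sum>xs\<in>permutations_of_set I. signed (inversions xs) (hat \<alpha> (card I) I (position xs) v))"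

lemma alternation_linear_form:
  "\<alpha> \<in> cochain_group (card I) \<Longrightarrow> finite I \<Longrightarrow> alternation I \<alpha> \<in> linear_forms (obj X I)"
  unfolding alternation_def[abs_def]
  by (intro linear_forms_sum linear_forms_signed hat_linear_form)

lemma alternation_add: "alternation I (\<lambda>F v. \<alpha> F v + \<beta> F v) v = alternation I \<alpha> v + alternation I \<beta> v"
  by (simp add: alternation_def hat_add signed_plus sum.distrib)

lemma alternation_mult: "alternation I (\<lambda>F v. c * \<alpha> F v) v = c * alternation I \<alpha> v"
  by (simp add: alternation_def hat_mult signed_mult_right[symmetric] sum_distrib_left)

lemma alternation_diff: "alternation I (\<lambda>F v. \<alpha> F v - \<beta> F v) v = alternation I \<alpha> v - alternation I \<beta> v"
  using alternation_add[of I "\<lambda>F v. \<alpha> F v - \<beta> F v" \<beta> v] by simp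

lemma alternation_zero: "alternation I (\<lambda>F v. 0) v = 0"
  by (simp add: alternation_def)

lemma hat_position_map:
  assumes "\<alpha> \<in> cochain_group n" "finite I" "inj_on \<sigma> I" "set xs = I" "v \<in> lin X I"
  shows "hat \<alpha> n (\<sigma> ` I) (position (map \<sigma> xs)) (ltrans X I \<sigma> v) = hat \<alpha> n I (position xs) v"
proof -
  have "(position (map \<sigma> xs) \<circ> \<sigma>) i = position xs i" if "i \<in> I" for i
    using position_map[of \<sigma> i xs] assms(3,4) that by (simp add: insert_absorb)
  then have "hat \<alpha> n I (position (map \<sigma> xs) \<circ> \<sigma>) = hat \<alpha> n I (position xs)"
    by (intro hat_cong) simp
  then show ?thesis
    using hat_natural[OF assms(1-3,5)] by simp
qed

lemma alternation_strict_mono: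
  assumes "\<alpha> \<in> cochain_group (card I)" "finite I" "strict_mono_on I f" "v \<in> lin X I"
  shows "alternation (f ` I) \<alpha> (ltrans X I f v) = alternation I \<alpha> v"
proof -
  have inj: "inj_on f I"
    using assms(3) by (rule strict_mono_on_imp_inj_on)
  then have card: "card (f ` I) = card I"
    by (rule card_image)
  show ?thesis
    unfolding alternation_def card sum_permutations_of_set_image[OF inj]
  proof (intro sum.cong refl)
    fix xs assume "xs \<in> permutations_of_set I"
    then have "set xs = I"
      by (rule permutations_of_setD)
    then show "signed (inversions (map f xs)) (hat \<alpha> (card I) (f ` I) (position (map f xs)) (ltrans X I f v)) =
        signed (inversions xs) (hat \<alpha> (card I) I (position xs) v)"
      using assms inj by (simp add: hat_position_map inversions_map_strict_mono_on)
  qed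
qed

lemma alternation_permutes:
  assumes "\<alpha> \<in> cochain_group (card I)" "finite I" "\<sigma> permutes I" "v \<in> lin X I"
  shows "alternation I \<alpha> (ltrans X I \<sigma> v) = (if evenperm \<sigma> then alternation I \<alpha> v else - alternation I \<alpha> v)"
proof -
  let ?s = "if evenperm \<sigma> then 0 else 1 :: nat"
  have \<sigma>: "inj_on \<sigma> I" "\<sigma> ` I = I"
    using assms(3) by (simp_all add: permutes_inj_on permutes_image)
  have "alternation I \<alpha> (ltrans X I \<sigma> v) = (\<Sum>xs\<in>permutations_of_set I.
      signed (inversions (map \<sigma> xs)) (hat \<alpha> (card I) I (position (map \<sigma> xs)) (ltrans X I \<sigma> v)))"
    unfolding alternation_def by (rule sum_permutations_of_set_permutes[OF assms(3)])
  also have "\<dots> = (\<Sum>xs\<in>permutations_of_set I.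
      signed (?s + inversions xs) (hat \<alpha> (card I) I (position xs) v))"
  proof (intro sum.cong refl)
    fix xs assume "xs \<in> permutations_of_set I"
    then have xs: "set xs = I" "distinct xs"
      using permutations_of_setD by blast+
    have "even (inversions (map \<sigma> xs)) = even (?s + inversions xs)"
      using inversions_map_permutes[of \<sigma> xs] assms(3) xs by auto
    then show "signed (inversions (map \<sigma> xs)) (hat \<alpha> (card I) I (position (map \<sigma> xs)) (ltrans X I \<sigma> v)) =
        signed (?s + inversions xs) (hat \<alpha> (card I) I (position xs) v)"
      using hat_position_map[OF assms(1,2) \<sigma>(1) xs(1) assms(4)] \<sigma>(2)
      by (metis signed_parity)
  qed
  also have "\<dots> = signed ?s (alternation I \<alpha> v)"
    by (simp only: alternation_def signed_sum signed_signed)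
  finally show ?thesis
    by simp
qed

lemma alternation_koszul: "\<alpha> \<in> cochain_group p \<Longrightarrow> alternation {1..p} \<alpha> \<in> koszul X p"
  using alternation_linear_form[of \<alpha> "{1..p}"] alternation_permutes[of \<alpha> "{1..p}"]
  by (simp add: koszul_def)

text \<open>
  Exchanging the entries at the positions \<open>k\<close> and \<open>k + 1\<close> does not affect \<open>merge k \<circ> position xs\<close>
  but changes the sign.
\<close>

lemma alternation_inner_face:
  assumes "finite I" "k \<in> {1..<card I}"
  shows "(\<Sum>xs\<in>permutations_of_set I. signed (inversions xs) (hat \<alpha> n I (merge k \<circ> position xs) v)) = 0"
proof (rule sum_sign_reversing_involution[where P = "\<lambda>xs. even (inversions xs)"
      and g = "\<lambda>xs. map (transpose (entry xs k) (entry xs (Suc k))) xs"])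
  fix xs assume "xs \<in> permutations_of_set I"
  then have xs: "set xs = I" "distinct xs" "length xs = card I"
    using permutations_of_setD by blast+
  let ?a = "entry xs k" and ?b = "entry xs (Suc k)"
  let ?\<tau> = "transpose ?a ?b"
  have k: "k \<in> {1..length xs}" "Suc k \<in> {1..length xs}"
    using assms(2) xs(3) by auto
  have ab: "?a \<in> I" "?b \<in> I"
    using k xs(1) entry_mem by blast+
  have pos: "position xs ?a = k" "position xs ?b = Suc k"
    using position_entry[OF xs(2)] k by blast+
  then have "?a \<noteq> ?b"
    by auto
  have \<tau>: "?\<tau> permutes I"
    using ab by (rule permutes_swap_id)
  let ?ys = "map ?\<tau> xs"
  show "?ys \<in> permutations_of_set I"
    using xs \<tau> assms(1) by (auto simp: permutations_of_set_iff permutes_image distinct_map permutes_inj_on)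
  have "entry ?ys k = ?b" "entry ?ys (Suc k) = ?a"
    using k by (auto simp: entry_def)
  then show "map (transpose (entry ?ys k) (entry ?ys (Suc k))) ?ys = xs"
    by (simp add: transpose_commute[of ?b] comp_def)
  show parity: "even (inversions ?ys) \<longleftrightarrow> \<not> even (inversions xs)"
    using inversions_map_transpose[OF xs(2)] ab xs(1) \<open>?a \<noteq> ?b\<close> by auto
  have "(merge k \<circ> position ?ys) i = (merge k \<circ> position xs) i" if "i \<in> I" for i
  proof -
    have "position ?ys (?\<tau> (?\<tau> i)) = position xs (?\<tau> i)"
      using \<tau> by (intro position_map) (rule permutes_inj_on)
    then have "position ?ys i = position xs (?\<tau> i)"
      by simp
    then show ?thesis
      using pos by (auto simp: transpose_def merge_def)
  qed
  then have "hat \<alpha> n I (merge k \<circ> position ?ys) = hat \<alpha> n I (merge k \<circ> position xs)"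
    by (intro hat_cong) blast
  then show "signed (inversions ?ys) (hat \<alpha> n I (merge k \<circ> position ?ys) v) =
      - signed (inversions xs) (hat \<alpha> n I (merge k \<circ> position xs) v)"
    using parity by (simp add: signed_def)
qed simp

text \<open>
  Moving the first entry of \<open>xs\<close> to the end turns the first face into the last one. Of the \<open>n\<close> other
  entries, those that are smaller than the moved one lose an inversion and the others gain one.
\<close>

lemma alternation_outer_faces:
  assumes "finite I" "card I = Suc n"
  shows "(\<Sum>xs\<in>permutations_of_set I. signed (inversions xs) (hat \<alpha> n I (merge 0 \<circ> position xs) v)) =
    signed n (\<Sum>xs\<in>permutations_of_set I. signed (inversions xs) (hat \<alpha> n I (merge (Suc n) \<circ> position xs) v))"
  unfolding signed_sum signed_signed
proof (rule sum.reindex_bij_witness[of _ "\<lambda>xs. last xs # butlast xs" rotate1])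
  fix xs assume "xs \<in> permutations_of_set I"
  then have xs: "set xs = I" "distinct xs" "length xs = Suc n"
    using permutations_of_setD assms(2) by metis+
  then obtain x ys where eq: "xs = x # ys"
    by (cases xs) auto
  show "last (rotate1 xs) # butlast (rotate1 xs) = xs"
    by (simp add: eq)
  show "rotate1 xs \<in> permutations_of_set I"
    using xs assms(1) by (simp add: permutations_of_set_iff)
  have "length (filter (\<lambda>y. y < x) ys) + cross_inversions ys [x] = n"
    using filter_less_add_cross[of x ys] xs eq by simp
  then have "even (inversions xs) = even (n + inversions (rotate1 xs))"
    by (simp add: eq inversions_append) presburger
  moreover have "hat \<alpha> n I (merge 0 \<circ> position xs) = hat \<alpha> n I (merge (Suc n) \<circ> position (rotate1 xs))"
  proof (rule hat_cong)
    fix i assume "i \<in> I"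
    then consider "i = x" "x \<notin> set ys" | "i \<in> set ys" "i \<noteq> x" "position ys i \<le> n"
      using xs eq position_le_length[of i ys] by auto
    then show "(merge 0 \<circ> position xs) i = (merge (Suc n) \<circ> position (rotate1 xs)) i \<or>
        (merge 0 \<circ> position xs) i \<notin> {1..n} \<and> (merge (Suc n) \<circ> position (rotate1 xs)) i \<notin> {1..n}"
      using xs(3) by cases (auto simp: eq merge_def position_append)
  qed
  ultimately show "signed (n + inversions (rotate1 xs)) (hat \<alpha> n I (merge (Suc n) \<circ> position (rotate1 xs)) v) =
      signed (inversions xs) (hat \<alpha> n I (merge 0 \<circ> position xs) v)"
    by (metis signed_parity)
next
  fix xs assume "xs \<in> permutations_of_set I"
  then have xs: "set xs = I" "distinct xs" "length xs = Suc n"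
    using permutations_of_setD assms(2) by metis+
  then obtain ys x where eq: "xs = ys @ [x]"
    by (cases xs rule: rev_cases) auto
  then show "rotate1 (last xs # butlast xs) = xs" "last xs # butlast xs \<in> permutations_of_set I"
    using xs assms(1) by (auto simp: permutations_of_set_iff)
qed

lemma alternation_coboundary:
  assumes "finite I" "card I = Suc n" "v \<in> lin X I"
  shows "alternation I (coboundary X n \<alpha>) v = 0"
proof -
  let ?A = "\<lambda>k. \<Sum>xs\<in>permutations_of_set I. signed (inversions xs) (hat \<alpha> n I (merge k \<circ> position xs) v)"
  have "alternation I (coboundary X n \<alpha>) v = (\<Sum>xs\<in>permutations_of_set I. \<Sum>k\<le>Suc n.
      signed k (signed (inversions xs) (hat \<alpha> n I (merge k \<circ> position xs) v)))"
    unfolding alternation_def assms(2) hat_coboundary[OF assms(1,3)] signed_sum signed_signed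
    by (simp only: add.commute)
  also have "\<dots> = (\<Sum>k\<le>Suc n. signed k (?A k))"
    unfolding signed_sum by (rule sum.swap)
  also have "\<dots> = (\<Sum>k\<in>{0, Suc n}. signed k (?A k))"
    using alternation_inner_face[OF assms(1)] assms(2)
    by (intro sum.mono_neutral_right) (auto simp: Suc_le_eq)
  also have "\<dots> = 0"
    using alternation_outer_faces[OF assms(1,2), of \<alpha> v] by simp
  finally show ?thesis .
qed


subsection \<open>Multiplicativity\<close>

text \<open>
  The colours \<open>1, ..., p\<close> of \<open>position (ys @ zs)\<close> are those of \<open>ys\<close>, and the next \<open>q\<close> colours are
  those of \<open>zs\<close>, shifted by \<open>p\<close>.
\<close>

lemma hat_position_append:
  assumes "finite I" "set (ys @ zs) = I" "distinct (ys @ zs)" "length ys = p" "length zs = q" "v \<in> lin X I"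
  shows "hat \<alpha> p I (position (ys @ zs)) v = hat \<alpha> p (set ys) (position ys) (llres X I (set ys) v)"
    "hat \<alpha> q I (\<lambda>i. position (ys @ zs) i - p) v = hat \<alpha> q (set zs) (position zs) (llres X I (set zs) v)"
proof -
  have sub: "set ys \<subseteq> I" "set zs \<subseteq> I" and disj: "set ys \<inter> set zs = {}"
    using assms by auto
  have "in_range p I (position (ys @ zs)) \<subseteq> set ys"
  proof
    fix i assume "i \<in> in_range p I (position (ys @ zs))"
    then have "position (ys @ zs) i \<le> p"
      by (simp add: in_range_def)
    then show "i \<in> set ys"
      using position_ge_1[of zs i] assms(4) by (auto simp: position_append split: if_splits)
  qed
  moreover have "hat \<alpha> p (set ys) (position (ys @ zs)) = hat \<alpha> p (set ys) (position ys)"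
    by (rule hat_cong) (simp add: position_append)
  ultimately show "hat \<alpha> p I (position (ys @ zs)) v = hat \<alpha> p (set ys) (position ys) (llres X I (set ys) v)"
    using hat_restrict[OF assms(1) sub(1) _ assms(6)] by metis
  have "in_range q I (\<lambda>i. position (ys @ zs) i - p) \<subseteq> set zs"
  proof
    fix i assume i: "i \<in> in_range q I (\<lambda>i. position (ys @ zs) i - p)"
    then have "p < position (ys @ zs) i" "i \<in> I"
      by (auto simp: in_range_def)
    then have "i \<notin> set ys"
      using position_le_length[of i ys] assms(4) by (auto simp: position_append)
    with \<open>i \<in> I\<close> show "i \<in> set zs"
      using assms(2) by auto
  qed
  moreover have "hat \<alpha> q (set zs) (\<lambda>i. position (ys @ zs) i - p) = hat \<alpha> q (set zs) (position zs)"
    using disj assms(4) by (intro hat_cong) (auto simp: position_append)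
  ultimately show "hat \<alpha> q I (\<lambda>i. position (ys @ zs) i - p) v =
      hat \<alpha> q (set zs) (position zs) (llres X I (set zs) v)"
    using hat_restrict[OF assms(1) sub(2) _ assms(6)] by metis
qed

lemma decomposition_pair: "decomposition I [S, T] \<longleftrightarrow> S \<union> T = I \<and> S \<inter> T = {}"
  by (auto simp: decomposition_def less_Suc_eq nth_Cons')

lemma sum_permutations_of_set_split:
  assumes I: "finite I" "card I = p + q"
  shows "(\<Sum>xs\<in>permutations_of_set I. g (take p xs) (drop p xs)) =
    (\<Sum>(S, T)\<in>{(S, T). decomposition I [S, T] \<and> card S = p \<and> card T = q}.
      \<Sum>ys\<in>permutations_of_set S. \<Sum>zs\<in>permutations_of_set T. g ys zs)"
proof -
  let ?D = "{(S, T). decomposition I [S, T] \<and> card S = p \<and> card T = q}"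
  have D: "finite ?D"
    by (rule finite_subset[of _ "Pow I \<times> Pow I"]) (use I(1) in \<open>auto simp: decomposition_pair\<close>)
  have "(\<Sum>(S, T)\<in>?D. \<Sum>ys\<in>permutations_of_set S. \<Sum>zs\<in>permutations_of_set T. g ys zs) =
      (\<Sum>d\<in>?D. \<Sum>w\<in>permutations_of_set (fst d) \<times> permutations_of_set (snd d). g (fst w) (snd w))"
    by (intro sum.cong refl) (auto simp: sum.cartesian_product case_prod_unfold)
  also have "\<dots> = (\<Sum>(d, w)\<in>(SIGMA d:?D. permutations_of_set (fst d) \<times> permutations_of_set (snd d)).
      g (fst w) (snd w))"
    using D by (intro sum.Sigma) auto
  also have "\<dots> = (\<Sum>xs\<in>permutations_of_set I. g (take p xs) (drop p xs))"
  proof (rule sum.reindex_bij_witness[of _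
        "\<lambda>xs. ((set (take p xs), set (drop p xs)), (take p xs, drop p xs))" "\<lambda>(d, w). fst w @ snd w"])
    fix x assume "x \<in> (SIGMA d:?D. permutations_of_set (fst d) \<times> permutations_of_set (snd d))"
    then obtain S T ys zs where x: "x = ((S, T), (ys, zs))" "decomposition I [S, T]"
      "card S = p" "card T = q" "ys \<in> permutations_of_set S" "zs \<in> permutations_of_set T"
      by auto
    note ys = permutations_of_setD[OF x(5)] and zs = permutations_of_setD[OF x(6)]
    show "(\<lambda>xs. ((set (take p xs), set (drop p xs)), (take p xs, drop p xs))) (case x of (d, w) \<Rightarrow> fst w @ snd w) = x"
      "(case x of (d, w) \<Rightarrow> fst w @ snd w) \<in> permutations_of_set I"
      "g (take p (case x of (d, w) \<Rightarrow> fst w @ snd w)) (drop p (case x of (d, w) \<Rightarrow> fst w @ snd w)) =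
        (case x of (d, w) \<Rightarrow> g (fst w) (snd w))"
      using x ys zs I(1) by (auto simp: decomposition_pair permutations_of_set_iff)
  next
    fix xs assume "xs \<in> permutations_of_set I"
    then have xs: "set xs = I" "distinct xs" "length xs = p + q"
      using permutations_of_setD I(2) by metis+
    have "set (take p xs) \<union> set (drop p xs) = I"
      unfolding set_append[symmetric] append_take_drop_id by (rule xs(1))
    moreover have "card (set (take p xs)) = p" "card (set (drop p xs)) = q"
      using xs by (simp_all add: distinct_card)
    moreover have "set (take p xs) \<inter> set (drop p xs) = {}"
      using xs(2) by (rule set_take_disj_set_drop_if_distinct) simp
    ultimately show "((set (take p xs), set (drop p xs)), (take p xs, drop p xs)) \<in>
        (SIGMA d:?D. permutations_of_set (fst d) \<times> permutations_of_set (snd d))"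
      using xs(2) by (auto simp: decomposition_pair permutations_of_set_iff)
    show "(case ((set (take p xs), set (drop p xs)), (take p xs, drop p xs)) of (d, w) \<Rightarrow> fst w @ snd w) = xs"
      by simp
  qed
  finally show ?thesis ..
qed

lemma alternation_cup:
  assumes \<alpha>: "\<alpha> \<in> cochain_group p" and \<beta>: "\<beta> \<in> cochain_group q"
    and I: "finite I" "card I = p + q" and z: "z \<in> obj X I"
  shows "alternation I (cup X p q \<alpha> \<beta>) (basis z) =
    (\<Sum>(S, T)\<in>{(S, T). decomposition I [S, T] \<and> card S = p \<and> card T = q}.
      signed (sch S T) (alternation S \<alpha> (llres X I S (basis z)) * alternation T \<beta> (llres X I T (basis z))))"
proof -
  note b = free_module_basis[OF z, where ?'b = 'k]
  let ?a = "\<lambda>ys. hat \<alpha> p (set ys) (position ys) (llres X I (set ys) (basis z))"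
  let ?b = "\<lambda>zs. hat \<beta> q (set zs) (position zs) (llres X I (set zs) (basis z))"
  let ?g = "\<lambda>ys zs. signed (inversions (ys @ zs)) (?a ys * ?b zs)"
  have "alternation I (cup X p q \<alpha> \<beta>) (basis z) =
      (\<Sum>xs\<in>permutations_of_set I. ?g (take p xs) (drop p xs))"
    unfolding alternation_def I(2)
  proof (intro sum.cong refl)
    fix xs assume "xs \<in> permutations_of_set I"
    then have xs: "set xs = I" "distinct xs" "length xs = p + q"
      using permutations_of_setD I(2) by metis+
    then show "signed (inversions xs) (hat (cup X p q \<alpha> \<beta>) (p + q) I (position xs) (basis z)) =
        ?g (take p xs) (drop p xs)"
      using hat_position_append[of I "take p xs" "drop p xs" p q "basis z" \<alpha>]
        hat_position_append[of I "take p xs" "drop p xs" p q "basis z" \<beta>] I b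
      unfolding append_take_drop_id by (simp add: hat_cup[OF \<alpha> \<beta> I(1) z])
  qed
  also have "\<dots> = (\<Sum>(S, T)\<in>{(S, T). decomposition I [S, T] \<and> card S = p \<and> card T = q}.
      \<Sum>ys\<in>permutations_of_set S. \<Sum>zs\<in>permutations_of_set T. ?g ys zs)"
    by (rule sum_permutations_of_set_split[OF I])
  also have "\<dots> = (\<Sum>(S, T)\<in>{(S, T). decomposition I [S, T] \<and> card S = p \<and> card T = q}.
      signed (sch S T) (alternation S \<alpha> (llres X I S (basis z)) * alternation T \<beta> (llres X I T (basis z))))"
  proof (rule sum_pairs_cong)
    fix S T assume "(S, T) \<in> {(S, T). decomposition I [S, T] \<and> card S = p \<and> card T = q}"
    then have ST: "card S = p" "card T = q"
      by auto
    have "?g ys zs = signed (sch S T) (signed (inversions ys) (?a ys) * signed (inversions zs) (?b zs))"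
      if "ys \<in> permutations_of_set S" "zs \<in> permutations_of_set T" for ys zs
      using permutations_of_setD[OF that(1)] permutations_of_setD[OF that(2)]
      by (simp add: inversions_append cross_inversions_sch signed_mult_left signed_mult_right add.commute add.left_commute)
    then have "(\<Sum>ys\<in>permutations_of_set S. \<Sum>zs\<in>permutations_of_set T. ?g ys zs) =
      signed (sch S T) ((\<Sum>ys\<in>permutations_of_set S. signed (inversions ys) (?a ys)) *
        (\<Sum>zs\<in>permutations_of_set T. signed (inversions zs) (?b zs)))"
      by (simp add: sum_product signed_sum)
    also have "(\<Sum>ys\<in>permutations_of_set S. signed (inversions ys) (?a ys)) = alternation S \<alpha> (llres X I S (basis z))"
      unfolding alternation_def by (intro sum.cong refl) (simp add: permutations_of_setD(1) ST)
    also have "(\<Sum>zs\<in>permutations_of_set T. signed (inversions zs) (?b zs)) = alternation T \<beta> (llres X I T (basis z))"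
      unfolding alternation_def by (intro sum.cong refl) (simp add: permutations_of_setD(1) ST)
    finally show "(\<Sum>ys\<in>permutations_of_set S. \<Sum>zs\<in>permutations_of_set T. ?g ys zs) =
      signed (sch S T) (alternation S \<alpha> (llres X I S (basis z)) * alternation T \<beta> (llres X I T (basis z)))" .
  qed
  finally show ?thesis .
qed

lemma koszul_cup_basis:
  fixes f g :: "('x \<Rightarrow>\<^sub>0 'k) \<Rightarrow> 'k"
  assumes z: "z \<in> obj X {1..p + q}"
  shows "koszul_cup X p q f g (basis z) =
    (\<Sum>(S, T)\<in>{(S, T). decomposition {1..p + q} [S, T] \<and> card S = p \<and> card T = q}.
      signed (sch S T) (f (ltrans X S (std_bij S) (llres X {1..p + q} S (basis z))) *
        g (ltrans X T (std_bij T) (llres X {1..p + q} T (basis z)))))"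
  unfolding koszul_cup_def Let_def linear_extension_basis[OF z]
proof (rule sum_pairs_cong)
  fix S T assume "(S, T) \<in> {(S, T). decomposition {1..p + q} [S, T] \<and> card S = p \<and> card T = q}"
  then have "S \<subseteq> {1..p + q}"
    by (auto simp: decomposition_pair)
  then have "basis (trans X S (std_bij S) (rres X {1..p + q} S z)) =
      (ltrans X S (std_bij S) (llres X {1..p + q} S (basis z)) :: 'x \<Rightarrow>\<^sub>0 'k)"
    using basis_rres[OF _ _ z, of S] by (simp add: ltrans_def flip: push_basis)
  moreover have "basis (trans X T (std_bij T) (lres X {1..p + q} T z)) =
      (ltrans X T (std_bij T) (llres X {1..p + q} T (basis z)) :: 'x \<Rightarrow>\<^sub>0 'k)"
    by (simp add: ltrans_def llres_def)
  ultimately show "(- 1) ^ sch S T * (f (basis (trans X S (std_bij S) (rres X {1..p + q} S z))) *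
        g (basis (trans X T (std_bij T) (lres X {1..p + q} T z)))) =
      signed (sch S T) (f (ltrans X S (std_bij S) (llres X {1..p + q} S (basis z))) *
        g (ltrans X T (std_bij T) (llres X {1..p + q} T (basis z))))"
    by (simp add: minus_one_power_mult)
qed

lemma koszul_cup_linear_form: "koszul_cup X p q f g \<in> linear_forms (obj X {1..p + q})"
  by (simp add: koszul_cup_def Let_def linear_extension_in_linear_forms)

theorem koszul_cup_alternation:
  assumes \<alpha>: "\<alpha> \<in> cochain_group p" and \<beta>: "\<beta> \<in> cochain_group q"
  shows "koszul_cup X p q (alternation {1..p} \<alpha>) (alternation {1..q} \<beta>) =
    alternation {1..p + q} (cup X p q \<alpha> \<beta>)"
proof (rule linear_forms_eqI[OF koszul_cup_linear_form alternation_linear_form])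
  show "cup X p q \<alpha> \<beta> \<in> cochain_group (card {1..p + q})"
    using cup_in_cochains[OF \<alpha> \<beta>] by simp
  fix z assume z: "z \<in> obj X {1..p + q}"
  note b = free_module_basis[OF z, where ?'b = 'k]
  have std: "alternation {1..card S} \<gamma> (ltrans X S (std_bij S) (llres X {1..p + q} S (basis z))) =
      alternation S \<gamma> (llres X {1..p + q} S (basis z))"
    if "S \<subseteq> {1..p + q}" "\<gamma> \<in> cochain_group (card S)" for S \<gamma>
  proof -
    have "finite S"
      using that(1) finite_subset by blast
    then show ?thesis
      using alternation_strict_mono[OF that(2) _ std_bij_strict_mono_on llres_lin[OF _ that(1) b]]
      by (simp add: std_bij_image)
  qed
  have card: "card {1..p + q} = p + q"
    by simp
  show "koszul_cup X p q (alternation {1..p} \<alpha>) (alternation {1..q} \<beta>) (basis z) =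
      alternation {1..p + q} (cup X p q \<alpha> \<beta>) (basis z)"
    unfolding koszul_cup_basis[OF z] alternation_cup[OF \<alpha> \<beta> finite_atLeastAtMost card z]
  proof (rule sum_pairs_cong)
    fix S T assume "(S, T) \<in> {(S, T). decomposition {1..p + q} [S, T] \<and> card S = p \<and> card T = q}"
    then have "S \<subseteq> {1..p + q}" "T \<subseteq> {1..p + q}" "card S = p" "card T = q"
      by (auto simp: decomposition_pair)
    then show "signed (sch S T) (alternation {1..p} \<alpha> (ltrans X S (std_bij S) (llres X {1..p + q} S (basis z))) *
        alternation {1..q} \<beta> (ltrans X T (std_bij T) (llres X {1..p + q} T (basis z)))) =
      signed (sch S T) (alternation S \<alpha> (llres X {1..p + q} S (basis z)) *
        alternation T \<beta> (llres X {1..p + q} T (basis z)))"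
      using std[of S \<alpha>] std[of T \<beta>] \<alpha> \<beta> by simp
  qed
qed simp

lemma koszul_cup_commute:
  fixes f g :: "('x \<Rightarrow>\<^sub>0 'k) \<Rightarrow> 'k"
  shows "koszul_cup X p q f g v = signed (p * q) (koszul_cup X q p g f v)"
proof -
  have "koszul_cup X p q f g = (\<lambda>v. signed (p * q) (koszul_cup X q p g f v))"
  proof (rule linear_forms_eqI[OF koszul_cup_linear_form])
    show "(\<lambda>v. signed (p * q) (koszul_cup X q p g f v)) \<in> linear_forms (obj X {1..p + q})"
      using koszul_cup_linear_form[of q p g f] by (intro linear_forms_signed) (simp add: add.commute)
    fix z assume z: "z \<in> obj X {1..p + q}"
    then have z': "z \<in> obj X {1..q + p}"
      by (simp add: add.commute)
    show "koszul_cup X p q f g (basis z) = signed (p * q) (koszul_cup X q p g f (basis z))"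
      unfolding koszul_cup_basis[OF z] koszul_cup_basis[OF z'] signed_sum
    proof (rule sum.reindex_bij_witness[of _ prod.swap prod.swap])
      fix w assume "w \<in> {(S, T). decomposition {1..p + q} [S, T] \<and> card S = p \<and> card T = q}"
      then obtain S T where w: "w = (S, T)" "S \<union> T = {1..p + q}" "S \<inter> T = {}" "card S = p" "card T = q"
        by (auto simp: decomposition_pair)
      show "prod.swap (prod.swap w) = w"
        by simp
      show "prod.swap w \<in> {(S, T). decomposition {1..q + p} [S, T] \<and> card S = q \<and> card T = p}"
        using w by (auto simp: decomposition_pair add.commute)
      have "finite S" "finite T"
        using w(2) by (metis finite_Un finite_atLeastAtMost)+
      then have "sch S T + sch T S = p * q"
        using sch_add_sch_swap[of S T] w by simp
      then have "even (p * q + sch T S) = even (sch S T)"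
        by presburger
      then have "signed (sch S T) a = signed (p * q + sch T S) a" for a :: 'k
        by (rule signed_parity[symmetric])
      then show "signed (p * q) (case prod.swap w of (S, T) \<Rightarrow>
            signed (sch S T) (g (ltrans X S (std_bij S) (llres X {1..q + p} S (basis z))) *
              f (ltrans X T (std_bij T) (llres X {1..q + p} T (basis z))))) =
          (case w of (S, T) \<Rightarrow>
            signed (sch S T) (f (ltrans X S (std_bij S) (llres X {1..p + q} S (basis z))) *
              g (ltrans X T (std_bij T) (llres X {1..p + q} T (basis z)))))"
        by (simp add: w(1) add.commute[of q p] mult.commute)
    qed (auto simp: decomposition_pair add.commute)
  qed
  then show ?thesis
    by (rule fun_cong)
qed

end


section \<open>Surjectivity of the alternation\<close>

(* The list [1..<Suc n] of all elements of {1..n} is kept whole. *)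
declare upt_Suc [simp del]

lemma inversions_sorted: "sorted xs \<Longrightarrow> inversions xs = 0"
  by (induction xs) (auto simp: filter_empty_conv not_less)

text \<open>
  An ordering of \<open>{1..n}\<close>, given as a list, as a permutation in the sense of \<open>permutes\<close>.
\<close>

definition permutation_of :: "nat list \<Rightarrow> nat \<Rightarrow> nat" where
  "permutation_of xs k = (if k \<in> {1..length xs} then entry xs k else k)"

lemma map_entry: "map (entry xs) [1..<Suc (length xs)] = xs"
  by (rule nth_equalityI) (auto simp: entry_def)

lemma permutation_of_permutes:
  assumes "set xs = {1..n}" "distinct xs"
  shows "permutation_of xs permutes {1..n}" "map (permutation_of xs) [1..<Suc n] = xs"
    "evenperm (permutation_of xs) \<longleftrightarrow> even (inversions xs)"
proof -
  have len: "length xs = n"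
    using distinct_card[OF assms(2)] assms(1) by simp
  have "bij_betw (permutation_of xs) {1..n} {1..n}"
    using bij_betw_entry[OF assms(2)] unfolding len assms(1)
    by (rule bij_betw_cong[THEN iffD1, rotated]) (simp add: permutation_of_def len)
  then show perm: "permutation_of xs permutes {1..n}"
    by (rule bij_imp_permutes) (auto simp: permutation_of_def len)
  have "map (permutation_of xs) [1..<Suc n] = map (entry xs) [1..<Suc n]"
    by (rule map_cong) (auto simp: permutation_of_def len)
  then show eq: "map (permutation_of xs) [1..<Suc n] = xs"
    using map_entry[of xs] len by metis
  have "set [1..<Suc n] = {1..n}"
    by auto
  then show "evenperm (permutation_of xs) \<longleftrightarrow> even (inversions xs)"
    using inversions_map_permutes[of "permutation_of xs" "[1..<Suc n]"] perm
    by (simp only: eq distinct_upt inversions_sorted sorted_upt) auto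
qed

lemma sum_permutes_eq_sum_permutations_of_set:
  "(\<Sum>\<sigma>\<in>{\<sigma>. \<sigma> permutes {1..n}}. g \<sigma>) = (\<Sum>xs\<in>permutations_of_set {1..n}. g (permutation_of xs))"
proof (rule sum.reindex_bij_witness[of _ permutation_of "\<lambda>\<sigma>. map \<sigma> [1..<Suc n]"])
  fix xs assume "xs \<in> permutations_of_set {1..n}"
  then show "permutation_of xs \<in> {\<sigma>. \<sigma> permutes {1..n}}" "map (permutation_of xs) [1..<Suc n] = xs"
    using permutation_of_permutes[of xs n] permutations_of_setD[of xs "{1..n}"] by blast+
next
  fix \<sigma> assume "\<sigma> \<in> {\<sigma>. \<sigma> permutes {1..n}}"
  then have \<sigma>: "\<sigma> permutes {1..n}"
    by simp
  have set: "set [1..<Suc n] = {1..n}"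
    by auto
  show "map \<sigma> [1..<Suc n] \<in> permutations_of_set {1..n}"
    by (simp only: permutations_of_set_iff finite_atLeastAtMost set_map set permutes_image[OF \<sigma>]
        distinct_map permutes_inj_on[OF \<sigma>] distinct_upt simp_thms)
  have "permutation_of (map \<sigma> [1..<Suc n]) k = \<sigma> k" for k
    using permutes_not_in[OF \<sigma>, of k] by (auto simp: permutation_of_def entry_def)
  then show "permutation_of (map \<sigma> [1..<Suc n]) = \<sigma>" "g (permutation_of (map \<sigma> [1..<Suc n])) = g \<sigma>"
    by presburger+
qed

locale weakly_projective_bicomodule = cosymmetric_bicomodule X K
  for X :: "'x set_bicomodule" and K :: "'k::{comm_ring,comm_monoid_mult} itself" +
  assumes weakly_projective: "weakly_projective K X"
begin

definition \<theta> :: "nat \<Rightarrow> ('x \<Rightarrow>\<^sub>0 'k) \<Rightarrow> ('x \<Rightarrow>\<^sub>0 'k)" where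
  "\<theta> n = (SOME \<theta>. linear_map (obj X {1..n}) (obj X {1..n}) \<theta> \<and>
    (\<forall>v\<in>lin X {1..n}. (\<Sum>\<sigma>\<in>{\<sigma>. \<sigma> permutes {1..n}}.
      ltrans X {1..n} \<sigma> (\<theta> (ltrans X {1..n} (inv \<sigma>) v))) = v))"

lemma linear_map_\<theta>: "linear_map (obj X {1..n}) (obj X {1..n}) (\<theta> n)"
  and \<theta>_trace: "v \<in> lin X {1..n} \<Longrightarrow>
    (\<Sum>\<sigma>\<in>{\<sigma>. \<sigma> permutes {1..n}}. ltrans X {1..n} \<sigma> (\<theta> n (ltrans X {1..n} (inv \<sigma>) v))) = v"
proof -
  have act: "ltrans X {1..n} \<sigma> v \<in> lin X {1..n}"
    if "\<sigma> permutes {1..n}" "v \<in> lin X {1..n}" for \<sigma> and v :: "'x \<Rightarrow>\<^sub>0 'k"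
    using ltrans_lin[OF finite_atLeastAtMost permutes_inj_on[OF that(1)] that(2)]
    by (simp only: permutes_image[OF that(1)])
  have proj: "projective_sym_module n (lin X {1..n} :: ('x \<Rightarrow>\<^sub>0 'k) set) (ltrans X {1..n})"
    using weakly_projective by (simp add: weakly_projective_def)
  have "linear_map (obj X {1..n}) (obj X {1..n}) (\<theta> n) \<and>
    (\<forall>v\<in>lin X {1..n}. (\<Sum>\<sigma>\<in>{\<sigma>. \<sigma> permutes {1..n}}.
      ltrans X {1..n} \<sigma> (\<theta> n (ltrans X {1..n} (inv \<sigma>) v))) = v)"
    using someI_ex[OF projective_sym_module_trace[OF proj act]] unfolding \<theta>_def .
  then show "linear_map (obj X {1..n}) (obj X {1..n}) (\<theta> n)"
    "v \<in> lin X {1..n} \<Longrightarrow>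
      (\<Sum>\<sigma>\<in>{\<sigma>. \<sigma> permutes {1..n}}. ltrans X {1..n} \<sigma> (\<theta> n (ltrans X {1..n} (inv \<sigma>) v))) = v"
    by blast+
qed

lemma ltrans_position_lin:
  assumes "set xs = I" "distinct xs" "length xs = n" "(v :: 'x \<Rightarrow>\<^sub>0 'k) \<in> lin X I"
  shows "ltrans X I (position xs) v \<in> lin X {1..n}"
  using ltrans_lin[of I "position xs" v] position_image[OF assms(2)] inj_on_position[OF assms(2)] assms by auto

lemma linear_map_ltrans_position:
  assumes "set xs = I" "distinct xs" "length xs = n"
  shows "linear_map (obj X I) (obj X {1..n}) (ltrans X I (position xs) :: ('x \<Rightarrow>\<^sub>0 'k) \<Rightarrow> _)"
  using linear_map_ltrans[of I "position xs"] position_image[OF assms(2)] inj_on_position[OF assms(2)] assms by auto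

lemma trace_lists:
  assumes v: "v \<in> lin X {1..n}"
  shows "(\<Sum>xs\<in>permutations_of_set {1..n}.
    ltrans X {1..n} (entry xs) (\<theta> n (ltrans X {1..n} (position xs) v))) = v"
proof -
  have "(\<Sum>xs\<in>permutations_of_set {1..n}. ltrans X {1..n} (entry xs) (\<theta> n (ltrans X {1..n} (position xs) v))) =
      (\<Sum>xs\<in>permutations_of_set {1..n}. ltrans X {1..n} (permutation_of xs)
        (\<theta> n (ltrans X {1..n} (inv (permutation_of xs)) v)))"
  proof (intro sum.cong refl)
    fix xs assume "xs \<in> permutations_of_set {1..n}"
    then have xs: "set xs = {1..n}" "distinct xs" "length xs = n"
      using permutations_of_setD[of xs "{1..n}"] by simp_all
    note perm = permutation_of_permutes(1)[OF xs(1,2)]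
    have "permutation_of xs (position xs i) = i" if "i \<in> {1..n}" for i
      using that xs position_mem[of i xs] entry_position[of i xs] by (simp add: permutation_of_def)
    then have "position xs i = inv (permutation_of xs) i" if "i \<in> {1..n}" for i
      using that permutes_inv_eq[OF perm] by metis
    then have "ltrans X {1..n} (position xs) v = ltrans X {1..n} (inv (permutation_of xs)) v"
      using xs inj_on_position[OF xs(2)] v by (intro ltrans_cong) auto
    moreover have "ltrans X {1..n} (entry xs) w = ltrans X {1..n} (permutation_of xs) w"
      if "w \<in> lin X {1..n}" for w :: "'x \<Rightarrow>\<^sub>0 'k"
      using that inj_on_entry[OF xs(2)] xs(3) by (intro ltrans_cong) (auto simp: permutation_of_def)
    moreover have "\<theta> n (ltrans X {1..n} (position xs) v) \<in> lin X {1..n}"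
      using linear_mapD(1)[OF linear_map_\<theta> ltrans_position_lin[OF xs v]] .
    ultimately show "ltrans X {1..n} (entry xs) (\<theta> n (ltrans X {1..n} (position xs) v)) =
        ltrans X {1..n} (permutation_of xs) (\<theta> n (ltrans X {1..n} (inv (permutation_of xs)) v))"
      by simp
  qed
  also have "\<dots> = v"
    using \<theta>_trace[OF v] unfolding sum_permutes_eq_sum_permutations_of_set .
  finally show ?thesis .
qed

lemma permutations_of_interval:
  assumes "xs \<in> permutations_of_set {1..n}"
  shows "set xs = {1..n}" "distinct xs" "length xs = n"
    "entry xs ` {1..n} = {1..n}" "inj_on (entry xs) {1..n}"
proof -
  show xs: "set xs = {1..n}" "distinct xs" "length xs = n"
    using permutations_of_setD[OF assms] by simp_all
  show "entry xs ` {1..n} = {1..n}" "inj_on (entry xs) {1..n}"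
    using entry_image[OF xs(2)] inj_on_entry[OF xs(2)] xs(1,3) by (simp_all only:)
qed

lemma \<theta>_position_lin:
  assumes "xs \<in> permutations_of_set {1..n}" "v \<in> lin X {1..n}"
  shows "\<theta> n (ltrans X {1..n} (position xs) v) \<in> lin X {1..n}"
  using linear_mapD(1)[OF linear_map_\<theta>
    ltrans_position_lin[OF permutations_of_interval(1-3)[OF assms(1)] assms(2)]] .

lemma linear_form_trace:
  assumes f: "f \<in> linear_forms (obj X {1..n})" and v: "v \<in> lin X {1..n}"
  shows "(\<Sum>xs\<in>permutations_of_set {1..n}.
    f (ltrans X {1..n} (entry xs) (\<theta> n (ltrans X {1..n} (position xs) v)))) = f v"
proof -
  have "ltrans X {1..n} (entry xs) (\<theta> n (ltrans X {1..n} (position xs) v)) \<in> lin X {1..n}"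
    if "xs \<in> permutations_of_set {1..n}" for xs
    using ltrans_lin[OF finite_atLeastAtMost permutations_of_interval(5)[OF that] \<theta>_position_lin[OF that v]]
    unfolding permutations_of_interval(4)[OF that] .
  then have "(\<Sum>xs\<in>permutations_of_set {1..n}. f (ltrans X {1..n} (entry xs)
        (\<theta> n (ltrans X {1..n} (position xs) v)))) =
      f (\<Sum>xs\<in>permutations_of_set {1..n}. ltrans X {1..n} (entry xs)
        (\<theta> n (ltrans X {1..n} (position xs) v)))"
    by (rule linear_forms_apply_sum[OF f, symmetric])
  then show ?thesis
    by (simp only: trace_lists[OF v])
qed

lemma ltrans_position_map:
  assumes "finite I" "inj_on \<sigma> I" "set xs = I" "distinct xs" "(v :: 'x \<Rightarrow>\<^sub>0 'k) \<in> lin X I"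
  shows "ltrans X (\<sigma> ` I) (position (map \<sigma> xs)) (ltrans X I \<sigma> v) = ltrans X I (position xs) v"
proof -
  have inj: "inj_on (position (map \<sigma> xs)) (\<sigma> ` I)"
    using inj_on_position[of "map \<sigma> xs"] assms(2-4) by (simp add: distinct_map)
  have "ltrans X (\<sigma> ` I) (position (map \<sigma> xs)) (ltrans X I \<sigma> v) =
      ltrans X I (position (map \<sigma> xs) \<circ> \<sigma>) v"
    using assms(1,2) inj assms(5) by (rule ltrans_ltrans)
  also have "\<dots> = ltrans X I (position xs) v"
  proof (intro ltrans_cong comp_inj_on assms inj)
    fix i assume "i \<in> I"
    then show "(position (map \<sigma> xs) \<circ> \<sigma>) i = position xs i"
      using position_map[of \<sigma> i xs] assms(2,3) by (simp add: insert_absorb)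
  qed
  finally show ?thesis .
qed

text \<open>
  The transversals of the blocks of \<open>\<phi>\<close>, listed in the order of the blocks.
\<close>

definition transversals :: "nat \<Rightarrow> nat set \<Rightarrow> (nat \<Rightarrow> nat) \<Rightarrow> nat list set" where
  "transversals n I \<phi> = {xs. length xs = n \<and> set xs \<subseteq> I \<and> (\<forall>k\<in>{1..n}. \<phi> (entry xs k) = k)}"

lemma distinct_transversal:
  assumes "length xs = n" "inj_on c {1..n}" "\<And>k. k \<in> {1..n} \<Longrightarrow> \<phi> (entry xs k) = c k"
  shows "distinct xs"
proof -
  have "xs ! i \<noteq> xs ! j" if "i < n" "j < n" "i \<noteq> j" for i j
  proof
    assume "xs ! i = xs ! j"
    then have "c (Suc i) = c (Suc j)"
      using assms(3)[of "Suc i"] assms(3)[of "Suc j"] that by (simp add: entry_def)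
    then show False
      using inj_onD[OF assms(2), of "Suc i" "Suc j"] that by auto
  qed
  then show ?thesis
    using assms(1) by (simp add: distinct_conv_nth)
qed

lemma transversalsD:
  assumes "xs \<in> transversals n I \<phi>"
  shows "length xs = n" "set xs \<subseteq> I" "distinct xs" "\<And>k. k \<in> {1..n} \<Longrightarrow> \<phi> (entry xs k) = k"
  using assms distinct_transversal[of xs n "\<lambda>k. k" \<phi>] by (auto simp: transversals_def)

definition transversal_value :: "(('x \<Rightarrow>\<^sub>0 'k) \<Rightarrow> 'k) \<Rightarrow> nat set \<Rightarrow> nat list \<Rightarrow> ('x \<Rightarrow>\<^sub>0 'k) \<Rightarrow> 'k" where
  "transversal_value h I xs v =
     (if v \<in> lin X I then h (ltrans X (set xs) (position xs) (llres X I (set xs) v)) else 0)"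

definition transversal_family :: "nat \<Rightarrow> (('x \<Rightarrow>\<^sub>0 'k) \<Rightarrow> 'k) \<Rightarrow> nat set \<Rightarrow> (nat \<Rightarrow> nat) \<Rightarrow> ('x \<Rightarrow>\<^sub>0 'k) \<Rightarrow> 'k" where
  "transversal_family n h I \<phi> v = (\<Sum>xs\<in>transversals n I \<phi>. transversal_value h I xs v)"

lemma natural_family_transversal_family:
  assumes h: "h \<in> linear_forms (obj X {1..n})"
  shows "natural_family n (transversal_family n h)"
  unfolding natural_family_def
proof (intro conjI allI impI ballI)
  fix I :: "nat set" and \<phi> :: "nat \<Rightarrow> nat"
  assume I: "finite I"
  show "transversal_family n h I \<phi> \<in> linear_forms (obj X I)"
    unfolding transversal_family_def[abs_def] transversal_value_def
  proof (rule linear_forms_sum)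
    fix xs assume "xs \<in> transversals n I \<phi>"
    note xs = transversalsD[OF this]
    show "(\<lambda>v. if v \<in> lin X I then h (ltrans X (set xs) (position xs) (llres X I (set xs) v)) else 0)
        \<in> linear_forms (obj X I)"
      using I xs h
      by (intro linear_forms_comp[OF linear_map_comp[OF linear_map_llres linear_map_ltrans_position]]) auto
  qed
next
  fix I and \<phi> \<psi> :: "nat \<Rightarrow> nat"
  assume "\<forall>i\<in>I. \<phi> i = \<psi> i"
  then have "transversals n I \<phi> = transversals n I \<psi>"
    unfolding transversals_def using entry_mem by (metis (no_types, opaque_lifting) subsetD)
  then show "transversal_family n h I \<phi> = transversal_family n h I \<psi>"
    by (simp add: transversal_family_def fun_eq_iff)
next
  fix I :: "nat set" and \<phi> \<sigma> :: "nat \<Rightarrow> nat" and v :: "'x \<Rightarrow>\<^sub>0 'k"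
  assume I: "finite I" and \<sigma>: "inj_on \<sigma> I" and v: "v \<in> lin X I"
  have entry_map: "entry (map \<sigma> xs) k = \<sigma> (entry xs k)" if "k \<in> {1..length xs}" for xs k
    using that by (auto simp: entry_def)
  have sub: "ys \<in> map \<sigma> ` transversals n I (\<phi> \<circ> \<sigma>)" if "ys \<in> transversals n (\<sigma> ` I) \<phi>" for ys
  proof -
    note ys = transversalsD[OF that]
    obtain xs where xs: "ys = map \<sigma> xs" "set xs \<subseteq> I"
    proof -
      have "ys \<in> lists (\<sigma> ` I)"
        using ys(2) by auto
      then show thesis
        using that unfolding lists_image by blast
    qed
    then show ?thesis
      using ys entry_map by (auto simp: transversals_def)
  qed
  have "transversals n (\<sigma> ` I) \<phi> = map \<sigma> ` transversals n I (\<phi> \<circ> \<sigma>)"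
  proof (intro equalityI subsetI sub)
    fix ys assume "ys \<in> map \<sigma> ` transversals n I (\<phi> \<circ> \<sigma>)"
    then obtain xs where xs: "ys = map \<sigma> xs" "xs \<in> transversals n I (\<phi> \<circ> \<sigma>)"
      by blast
    then have "\<sigma> ` set xs \<subseteq> \<sigma> ` I"
      using transversalsD(2) by blast
    then show "ys \<in> transversals n (\<sigma> ` I) \<phi>"
      using xs entry_map by (simp add: transversals_def)
  qed
  moreover have "inj_on (map \<sigma>) (transversals n I (\<phi> \<circ> \<sigma>))"
    by (rule inj_on_mapI, rule inj_on_subset[OF \<sigma>]) (auto simp: transversals_def)
  ultimately have "transversal_family n h (\<sigma> ` I) \<phi> (ltrans X I \<sigma> v) =
      (\<Sum>xs\<in>transversals n I (\<phi> \<circ> \<sigma>). transversal_value h (\<sigma> ` I) (map \<sigma> xs) (ltrans X I \<sigma> v))"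
    by (simp add: transversal_family_def sum.reindex)
  also have "\<dots> = transversal_family n h I (\<phi> \<circ> \<sigma>) v"
    unfolding transversal_family_def
  proof (intro sum.cong refl)
    fix xs assume "xs \<in> transversals n I (\<phi> \<circ> \<sigma>)"
    note xs = transversalsD[OF this]
    let ?S = "set xs" and ?w = "llres X I (set xs) v"
    have inj: "inj_on \<sigma> ?S"
      using \<sigma> xs(2) by (rule inj_on_subset)
    have w: "?w \<in> lin X ?S"
      using I xs(2) v by (rule llres_lin)
    have "ltrans X (\<sigma> ` ?S) (position (map \<sigma> xs)) (ltrans X ?S \<sigma> ?w) = ltrans X ?S (position xs) ?w"
      using inj xs(3) w by (intro ltrans_position_map) auto
    then show "transversal_value h (\<sigma> ` I) (map \<sigma> xs) (ltrans X I \<sigma> v) = transversal_value h I xs v"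
      using I \<sigma> v xs(2) ltrans_lin[OF I \<sigma> v] by (simp add: transversal_value_def llres_ltrans)
  qed
  finally show "transversal_family n h (\<sigma> ` I) \<phi> (ltrans X I \<sigma> v) = transversal_family n h I (\<phi> \<circ> \<sigma>) v" .
qed

definition transversal_cochain :: "nat \<Rightarrow> (('x \<Rightarrow>\<^sub>0 'k) \<Rightarrow> 'k) \<Rightarrow> ('x, 'k) cochain" where
  "transversal_cochain n h = cochain_of n (transversal_family n h)"

lemma hat_transversal_cochain:
  assumes h: "h \<in> linear_forms (obj X {1..n})" and I: "finite I" and v: "v \<in> lin X I"
  shows "hat (transversal_cochain n h) n I \<phi> v = transversal_family n h I \<phi> v"
proof -
  let ?S = "in_range n I \<phi>"
  have "set xs \<subseteq> ?S" if "set xs \<subseteq> I" "length xs = n" "\<forall>k\<in>{1..n}. \<phi> (entry xs k) = k" for xs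
  proof
    fix i assume i: "i \<in> set xs"
    then have "\<phi> i = position xs i"
      using that position_mem[OF i] entry_position[OF i] by metis
    then show "i \<in> ?S"
      using i that position_mem[OF i] by (auto simp: in_range_def)
  qed
  then have "transversals n ?S \<phi> = transversals n I \<phi>"
    using in_range_subset[of n I \<phi>] by (auto simp: transversals_def)
  moreover have "transversal_value h ?S xs (llres X I ?S v) = transversal_value h I xs v"
    if "xs \<in> transversals n ?S \<phi>" for xs
    using transversalsD(2)[OF that] I v in_range_subset[of n I \<phi>] llres_lin[of I ?S v]
    by (simp add: transversal_value_def llres_llres)
  ultimately show ?thesis
    using I v hat_cochain_of[OF natural_family_transversal_family[OF h] I v, of \<phi>]
    by (simp add: transversal_cochain_def transversal_family_def)
qed

lemma finite_transversals: "finite I \<Longrightarrow> finite {xs. length xs = n \<and> set xs \<subseteq> I \<and> P xs}"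
  by (rule finite_subset[OF _ finite_lists_length_eq[of I n]]) auto

lemma alternating_sum_adjacent:
  fixes a :: "nat \<Rightarrow> 'c::ab_group_add"
  shows "(\<Sum>k=1..n. signed k (a k + a (Suc k))) = - a 1 + signed n (a (Suc n))"
  by (induction n) (simp_all add: sum.cl_ivl_Suc signed_plus)

text \<open>
  Let \<open>a k\<close> be the sum over the transversals of all blocks but the \<open>k\<close>-th. A transversal after merging
  the blocks \<open>k\<close> and \<open>k + 1\<close> misses one of them, so the \<open>k\<close>-th face is \<open>a k + a (k + 1)\<close>; the outer
  faces are \<open>a 1\<close> and \<open>a (n + 1)\<close>, and the alternating sum telescopes.
\<close>

lemma transversal_cochain_in_cocycles:
  assumes h: "h \<in> linear_forms (obj X {1..n})"
  shows "transversal_cochain n h \<in> cocycle_group n"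
proof (rule cocyclesI)
  show "transversal_cochain n h \<in> cochain_group n"
    unfolding transversal_cochain_def
    using natural_family_transversal_family[OF h] by (rule cochain_of_in_cochains)
  fix I :: "nat set" and \<phi> :: "nat \<Rightarrow> nat" and v :: "'x \<Rightarrow>\<^sub>0 'k"
  assume I: "finite I" and v: "v \<in> lin X I"
  define A where "A k = {xs. length xs = n \<and> set xs \<subseteq> I \<and>
    (\<forall>i\<in>{1..n}. \<phi> (entry xs i) = (if i < k then i else Suc i))}" for k
  define a where "a k = (\<Sum>xs\<in>A k. transversal_value h I xs v)" for k
  let ?T = "\<lambda>k. hat (transversal_cochain n h) n I (merge k \<circ> \<phi>) v"
  have T: "?T k = (\<Sum>xs\<in>transversals n I (merge k \<circ> \<phi>). transversal_value h I xs v)" for k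
    by (simp add: hat_transversal_cochain[OF h I v] transversal_family_def)
  have first: "?T 0 = a 1"
  proof -
    have "merge 0 u = i \<longleftrightarrow> u = (if i < 1 then i else Suc i)" if "i \<in> {1..n}" for i u
      using that by (auto simp: merge_def)
    then have "transversals n I (merge 0 \<circ> \<phi>) = A 1"
      by (auto simp: transversals_def A_def)
    then show ?thesis
      by (simp add: T a_def)
  qed
  have last: "?T (Suc n) = a (Suc n)"
  proof -
    have "merge (Suc n) u = i \<longleftrightarrow> u = (if i < Suc n then i else Suc i)" if "i \<in> {1..n}" for i u
      using that by (auto simp: merge_def)
    then have "transversals n I (merge (Suc n) \<circ> \<phi>) = A (Suc n)"
      by (auto simp: transversals_def A_def)
    then show ?thesis
      by (simp add: T a_def)
  qed
  have inner: "?T k = a k + a (Suc k)" if k: "k \<in> {1..n}" for k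
  proof -
    have m: "merge k u = i \<longleftrightarrow> u = (if i < k then i else Suc i) \<or> u = (if i < Suc k then i else Suc i)" for i u
      using k by (auto simp: merge_def)
    have "xs \<in> A k \<union> A (Suc k)" if "xs \<in> transversals n I (merge k \<circ> \<phi>)" for xs
    proof -
      note xs = transversalsD[OF that]
      have c: "\<phi> (entry xs i) = (if i < k then i else Suc i) \<or> \<phi> (entry xs i) = (if i < Suc k then i else Suc i)"
        if "i \<in> {1..n}" for i
        using xs(4)[OF that] m by simp
      have "\<phi> (entry xs i) = (if i < k then i else Suc i) \<longleftrightarrow> \<phi> (entry xs i) = (if i < Suc k then i else Suc i)"
        if "i \<noteq> k" for i
        using that by (auto simp: less_Suc_eq)
      then show ?thesis
        using c c[OF k] xs(1,2) unfolding A_def by (smt (verit) Un_iff mem_Collect_eq)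
    qed
    moreover have "A k \<union> A (Suc k) \<subseteq> transversals n I (merge k \<circ> \<phi>)"
      using m by (fastforce simp: A_def transversals_def)
    ultimately have "transversals n I (merge k \<circ> \<phi>) = A k \<union> A (Suc k)"
      by blast
    moreover have "A k \<inter> A (Suc k) = {}"
      using k by (auto simp: A_def)
    moreover have "finite (A k)" "finite (A (Suc k))"
      unfolding A_def by (rule finite_transversals[OF I])+
    ultimately show ?thesis
      by (simp add: T a_def sum.union_disjoint)
  qed
  have "{..Suc n} = insert 0 (insert (Suc n) {1..n})"
    by auto
  then have "(\<Sum>k\<le>Suc n. signed k (?T k)) = ?T 0 + (signed (Suc n) (?T (Suc n)) + (\<Sum>k=1..n. signed k (?T k)))"
    by simp
  also have "(\<Sum>k=1..n. signed k (?T k)) = (\<Sum>k=1..n. signed k (a k + a (Suc k)))"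
    by (intro sum.cong refl arg_cong[of _ _ "signed _"] inner)
  also have "?T 0 + (signed (Suc n) (?T (Suc n)) + \<dots>) = 0"
    unfolding first last alternating_sum_adjacent by simp
  finally show "(\<Sum>k\<le>Suc n. signed k (?T k)) = 0" .
qed

lemma transversals_position:
  assumes xs: "set xs = {1..n}" "distinct xs"
  shows "transversals n {1..n} (position xs) = {xs}"
proof -
  have len: "length xs = n"
    using distinct_card[OF xs(2)] xs(1) by simp
  have "ys = xs" if "ys \<in> transversals n {1..n} (position xs)" for ys
  proof -
    note ys = transversalsD[OF that]
    have "entry ys k = entry xs k" if k: "k \<in> {1..n}" for k
    proof -
      have "entry ys k \<in> set xs"
        using entry_mem[of k ys] ys(1,2) k xs(1) by auto
      then show ?thesis
        using entry_position[of "entry ys k" xs] ys(4)[OF k] by simp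
    qed
    then have "map (entry ys) [1..<Suc n] = map (entry xs) [1..<Suc n]"
      by (intro map_cong refl) auto
    then show ?thesis
      using map_entry[of xs] map_entry[of ys] len ys(1) by metis
  qed
  moreover have "xs \<in> transversals n {1..n} (position xs)"
    using xs len position_entry[OF xs(2)] by (simp add: transversals_def)
  ultimately show ?thesis
    by blast
qed

text \<open>
  The only transversal of singletons is their ordering, so the alternation of the cochain of \<open>h\<close> is
  the signed sum of \<open>h\<close> over all orderings. For \<open>h = f \<circ> \<theta>\<close>, the signs are absorbed by \<open>f\<close> and
  the trace of \<open>\<theta>\<close> appears.
\<close>

theorem alternation_surjective:
  assumes f: "f \<in> koszul X n"
  shows "\<exists>\<alpha>\<in>cocycle_group n. alternation {1..n} \<alpha> = f"
proof -
  have f_lin: "f \<in> linear_forms (obj X {1..n})" and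
    f_sgn: "\<And>\<sigma> v. \<sigma> permutes {1..n} \<Longrightarrow> v \<in> lin X {1..n} \<Longrightarrow>
      f (ltrans X {1..n} \<sigma> v) = (if evenperm \<sigma> then f v else - f v)"
    using f by (simp_all add: koszul_def)
  define h where "h = (\<lambda>v. if v \<in> lin X {1..n} then f (\<theta> n v) else 0)"
  have h: "h \<in> linear_forms (obj X {1..n})"
    unfolding h_def by (rule linear_forms_comp[OF linear_map_\<theta> f_lin])
  let ?\<alpha> = "transversal_cochain n h"
  have \<alpha>: "?\<alpha> \<in> cocycle_group n"
    by (rule transversal_cochain_in_cocycles[OF h])
  have "alternation {1..n} ?\<alpha> v = f v" for v
  proof (cases "v \<in> lin X {1..n}")
    case False
    moreover have "alternation {1..n} ?\<alpha> \<in> linear_forms (obj X {1..n})"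
      using cocycles_in_cochains[OF \<alpha>] by (intro alternation_linear_form) auto
    ultimately show ?thesis
      using f_lin linear_formsD(3) by metis
  next
    case True
    have "alternation {1..n} ?\<alpha> v = (\<Sum>xs\<in>permutations_of_set {1..n}.
        f (ltrans X {1..n} (entry xs) (\<theta> n (ltrans X {1..n} (position xs) v))))"
      unfolding alternation_def
    proof (intro sum.cong refl)
      fix xs assume "xs \<in> permutations_of_set {1..n}"
      then have xs: "set xs = {1..n}" "distinct xs" "length xs = n"
        using permutations_of_setD[of xs "{1..n}"] by simp_all
      let ?w = "ltrans X {1..n} (position xs) v"
      have w: "?w \<in> lin X {1..n}" "\<theta> n ?w \<in> lin X {1..n}"
        using ltrans_position_lin[OF xs True] linear_mapD(1)[OF linear_map_\<theta>] by blast+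
      have "hat ?\<alpha> (card {1..n}) {1..n} (position xs) v = h ?w"
        using True by (simp add: hat_transversal_cochain[OF h] transversal_family_def
          transversals_position[OF xs(1,2), simplified] transversal_value_def llres_self xs(1)[simplified])
      also have "\<dots> = f (\<theta> n ?w)"
        using w by (simp add: h_def)
      finally have "signed (inversions xs) (hat ?\<alpha> (card {1..n}) {1..n} (position xs) v) =
          f (ltrans X {1..n} (permutation_of xs) (\<theta> n ?w))"
        using f_sgn[OF permutation_of_permutes(1)[OF xs(1,2)] w(2)] permutation_of_permutes(3)[OF xs(1,2)]
        by (simp add: signed_def)
      also have "ltrans X {1..n} (permutation_of xs) (\<theta> n ?w) = ltrans X {1..n} (entry xs) (\<theta> n ?w)"
        using permutes_inj_on[OF permutation_of_permutes(1)[OF xs(1,2)]] w(2) xs(3)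
        by (intro ltrans_cong) (auto simp: permutation_of_def)
      finally show "signed (inversions xs) (hat ?\<alpha> (card {1..n}) {1..n} (position xs) v) =
          f (ltrans X {1..n} (entry xs) (\<theta> n ?w))" .
    qed
    also have "\<dots> = f v"
      by (rule linear_form_trace[OF f_lin True])
    finally show ?thesis .
  qed
  then show ?thesis
    using \<alpha> by blast
qed

end


section \<open>The kernel of the alternation\<close>

context weakly_projective_bicomodule
begin

lemma card_Union_image:
  assumes "inj_on \<sigma> (\<Union>(set F))"
  shows "card (\<Union>(set (map ((`) \<sigma>) F))) = card (\<Union>(set F))"
proof -
  have "\<Union>(set (map ((`) \<sigma>) F)) = \<sigma> ` \<Union>(set F)"
    by auto
  then show ?thesis
    using card_image[OF assms] by simp
qed

lemma hat_vanishes: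
  assumes "\<forall>F. card (\<Union>(set F)) < m \<longrightarrow> \<alpha> F = (\<lambda>v. 0)" "card (in_range n I \<phi>) < m"
  shows "hat \<alpha> n I \<phi> v = 0"
  using assms(1)[rule_format, of "fibres n I \<phi>"] assms(2) by (simp add: hat_def Union_fibres)

lemma cochain_vanishesI:
  assumes "\<alpha> \<in> cochain_group n"
    and "\<And>I \<phi> v. finite I \<Longrightarrow> card I < m \<Longrightarrow> v \<in> lin X I \<Longrightarrow> hat \<alpha> n I \<phi> v = 0"
    and "card (\<Union>(set F)) < m"
  shows "\<alpha> F = (\<lambda>v. 0)"
proof (cases "F \<in> decompositions n")
  case True
  note F = decompositionsD[OF True]
  have "\<alpha> F v = 0" for v
  proof (cases "v \<in> lin X (\<Union>(set F))")
    case v: True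
    then have "\<alpha> F v = hat \<alpha> n (\<Union>(set F)) (colour_of F) v"
      using F by (simp only: hat_eq)
    then show ?thesis
      using assms(2)[OF F(2) assms(3) v] by simp
  next
    case False
    then show ?thesis
      using linear_formsD(3)[OF cochain_linear_form[OF assms(1) True]] by blast
  qed
  then show ?thesis
    by blast
qed (rule cochain_off_decompositions[OF assms(1)])

text \<open>
  For \<open>I = {1..m}\<close> this is the sum of the conjugates of \<open>b \<circ> \<theta>\<close> under the symmetric group; for other
  \<open>I\<close> with \<open>m\<close> elements the permutations are replaced by the bijections \<open>I \<rightarrow> {1..m}\<close>.
\<close>

definition averaged_family ::
    "nat \<Rightarrow> nat \<Rightarrow> ('x \<Rightarrow> (nat \<Rightarrow> nat) \<Rightarrow> 'k) \<Rightarrow> nat set \<Rightarrow> (nat \<Rightarrow> nat) \<Rightarrow> ('x \<Rightarrow>\<^sub>0 'k) \<Rightarrow> 'k" where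
  "averaged_family n m b I \<phi> v =
     (if card I = m
      then \<Sum>xs\<in>permutations_of_set I. if v \<in> lin X I
        then linear_extension (obj X {1..m}) (\<lambda>z. b z (\<phi> \<circ> entry xs)) (\<theta> m (ltrans X I (position xs) v))
        else 0
      else 0)"

lemma natural_family_averaged_family:
  assumes b: "\<And>z. z \<in> obj X {1..m} \<Longrightarrow> colour_cochain {1..m} n (b z)"
  shows "natural_family n (averaged_family n m b)"
  unfolding natural_family_def
proof (intro conjI allI impI ballI)
  fix I :: "nat set" and \<phi> :: "nat \<Rightarrow> nat"
  assume I: "finite I"
  show "averaged_family n m b I \<phi> \<in> linear_forms (obj X I)"
  proof (cases "card I = m")
    case True
    have "(\<lambda>v. \<Sum>xs\<in>permutations_of_set I. if v \<in> lin X I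
        then linear_extension (obj X {1..m}) (\<lambda>z. b z (\<phi> \<circ> entry xs)) (\<theta> m (ltrans X I (position xs) v))
        else 0) \<in> linear_forms (obj X I)"
    proof (rule linear_forms_sum)
      fix xs assume "xs \<in> permutations_of_set I"
      then have xs: "set xs = I" "distinct xs" "length xs = m"
        using permutations_of_setD True by metis+
      show "(\<lambda>v. if v \<in> lin X I
          then linear_extension (obj X {1..m}) (\<lambda>z. b z (\<phi> \<circ> entry xs)) (\<theta> m (ltrans X I (position xs) v))
          else 0) \<in> linear_forms (obj X I)"
        by (rule linear_forms_comp[OF linear_map_comp[OF linear_map_ltrans_position[OF xs] linear_map_\<theta>]
            linear_extension_in_linear_forms])
    qed
    then show ?thesis
      using True by (simp add: averaged_family_def[abs_def])
  next
    case False
    then show ?thesis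
      by (simp add: averaged_family_def[abs_def] linear_forms_zero)
  qed
next
  fix I :: "nat set" and \<phi> \<psi> :: "nat \<Rightarrow> nat"
  assume "\<forall>i\<in>I. \<phi> i = \<psi> i"
  moreover have "entry xs i \<in> I" if "xs \<in> permutations_of_set I" "card I = m" "i \<in> {1..m}" for xs i
    using entry_mem[of i xs] permutations_of_setD[OF that(1)] that by simp
  ultimately have "linear_extension (obj X {1..m}) (\<lambda>z. b z (\<phi> \<circ> entry xs)) =
      linear_extension (obj X {1..m}) (\<lambda>z. b z (\<psi> \<circ> entry xs))"
    if "xs \<in> permutations_of_set I" "card I = m" for xs
    using that by (intro linear_extension_cong colour_cochain_cong[OF b]) auto
  then show "averaged_family n m b I \<phi> = averaged_family n m b I \<psi>"
    unfolding averaged_family_def by (intro ext if_cong refl sum.cong) (simp only:)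
next
  fix I :: "nat set" and \<phi> \<sigma> :: "nat \<Rightarrow> nat" and v :: "'x \<Rightarrow>\<^sub>0 'k"
  assume I: "finite I" and \<sigma>: "inj_on \<sigma> I" and v: "v \<in> lin X I"
  have card: "card (\<sigma> ` I) = card I"
    using \<sigma> by (rule card_image)
  have \<sigma>v: "ltrans X I \<sigma> v \<in> lin X (\<sigma> ` I)"
    using ltrans_lin[OF I \<sigma> v] .
  have "linear_extension (obj X {1..m}) (\<lambda>z. b z (\<phi> \<circ> entry (map \<sigma> xs)))
        (\<theta> m (ltrans X (\<sigma> ` I) (position (map \<sigma> xs)) (ltrans X I \<sigma> v))) =
      linear_extension (obj X {1..m}) (\<lambda>z. b z ((\<phi> \<circ> \<sigma>) \<circ> entry xs)) (\<theta> m (ltrans X I (position xs) v))"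
    if "xs \<in> permutations_of_set I" "card I = m" for xs
  proof -
    have xs: "set xs = I" "distinct xs" "length xs = m"
      using permutations_of_setD[OF that(1)] that(2) by auto
    have "entry (map \<sigma> xs) k = \<sigma> (entry xs k)" if "k \<in> {1..m}" for k
      using that xs(3) by (auto simp: entry_def)
    then have "linear_extension (obj X {1..m}) (\<lambda>z. b z (\<phi> \<circ> entry (map \<sigma> xs))) =
        linear_extension (obj X {1..m}) (\<lambda>z. b z ((\<phi> \<circ> \<sigma>) \<circ> entry xs))"
      by (intro linear_extension_cong colour_cochain_cong[OF b]) auto
    moreover have "ltrans X (\<sigma> ` I) (position (map \<sigma> xs)) (ltrans X I \<sigma> v) = ltrans X I (position xs) v"
      using I \<sigma> xs(1,2) v by (rule ltrans_position_map)
    ultimately show ?thesis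
      by simp
  qed
  then show "averaged_family n m b (\<sigma> ` I) \<phi> (ltrans X I \<sigma> v) = averaged_family n m b I (\<phi> \<circ> \<sigma>) v"
    unfolding averaged_family_def card sum_permutations_of_set_image[OF \<sigma>]
    using v \<sigma>v by (intro if_cong refl sum.cong) (simp_all only: if_True)
qed

lemma hat_averaged_family:
  assumes b: "\<And>z. z \<in> obj X {1..m} \<Longrightarrow> colour_cochain {1..m} n (b z)" and v: "v \<in> lin X {1..m}"
  shows "hat (cochain_of n (averaged_family n m b)) n {1..m} \<phi> v = (\<Sum>xs\<in>permutations_of_set {1..m}.
    linear_extension (obj X {1..m}) (\<lambda>z. b z (\<phi> \<circ> entry xs)) (\<theta> m (ltrans X {1..m} (position xs) v)))"
    (is "_ = ?rhs")
proof -
  let ?S = "in_range n {1..m} \<phi>"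
  have eq: "hat (cochain_of n (averaged_family n m b)) n {1..m} \<phi> v =
      averaged_family n m b ?S \<phi> (llres X {1..m} ?S v)"
    by (rule hat_cochain_of[OF natural_family_averaged_family[OF b] finite_atLeastAtMost v])
  show ?thesis
  proof (cases "?S = {1..m}")
    case True
    have "llres X {1..m} ?S v = v"
      unfolding True using v by (intro llres_self) auto
    then have "averaged_family n m b ?S \<phi> (llres X {1..m} ?S v) = averaged_family n m b {1..m} \<phi> v"
      using True by simp
    also have "\<dots> = ?rhs"
      unfolding averaged_family_def using v by simp
    finally show ?thesis
      using eq by simp
  next
    case False
    then have "\<not> \<phi> ` {1..m} \<subseteq> {1..n}"
      using in_range_eq by blast
    then obtain i where i: "i \<in> {1..m}" "\<phi> i \<notin> {1..n}"
      by blast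
    have "?S \<subset> {1..m}"
      using False in_range_subset by blast
    then have "card ?S < m"
      using psubset_card_mono[of "{1..m}" ?S] by simp
    then have "averaged_family n m b ?S \<phi> (llres X {1..m} ?S v) = 0"
      by (simp add: averaged_family_def)
    moreover have "linear_extension (obj X {1..m}) (\<lambda>z. b z (\<phi> \<circ> entry xs)) = (\<lambda>v. 0)"
      if "xs \<in> permutations_of_set {1..m}" for xs
    proof -
      have xs: "set xs = {1..m}" "length xs = m"
        using permutations_of_setD[OF that] by auto
      have "b z (\<phi> \<circ> entry xs) = 0" if "z \<in> obj X {1..m}" for z
        using colour_cochain_outside[OF b[OF that], of "position xs i" "\<phi> \<circ> entry xs"]
          i entry_position[of i xs] position_mem[of i xs] xs by simp
      then show ?thesis
        by (intro linear_forms_eqI[OF linear_extension_in_linear_forms linear_forms_zero]) simp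
    qed
    ultimately show ?thesis
      using eq by simp
  qed
qed

text \<open>
  As \<open>\<alpha>\<close> vanishes on sets with fewer than \<open>m\<close> elements, its values on a basis element of \<open>X[m]\<close>
  are a cocycle in the complex of colourings of \<open>{1..m}\<close> and have a primitive \<open>b\<close>. As \<open>\<alpha>\<close> is
  natural, the coboundary of the average of \<open>b\<close> on \<open>{1..m}\<close> is the average of \<open>\<alpha>\<close>, that is \<open>\<alpha>\<close>
  itself; a bijection carries this over to other sets with \<open>m\<close> elements.
\<close>

lemma lowest_part_is_coboundary:
  assumes \<alpha>: "\<alpha> \<in> cocycle_group (Suc n)"
    and low: "\<forall>F. card (\<Union>(set F)) < m \<longrightarrow> \<alpha> F = (\<lambda>v. 0)"
    and alt: "alternation {1..Suc n} \<alpha> = (\<lambda>v. 0)"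
  shows "\<exists>\<beta>\<in>cochain_group n. (\<forall>F. card (\<Union>(set F)) \<noteq> m \<longrightarrow> \<beta> F = (\<lambda>v. 0)) \<and>
    (\<forall>I \<phi>. finite I \<longrightarrow> card I = m \<longrightarrow> (\<forall>v\<in>lin X I.
      hat (coboundary X n \<beta>) (Suc n) I \<phi> v = hat \<alpha> (Suc n) I \<phi> v))"
proof -
  note \<alpha>c = cocycles_in_cochains[OF \<alpha>]
  let ?c = "\<lambda>z \<phi>. hat \<alpha> (Suc n) {1..m} \<phi> (basis z)"
  have "\<exists>b. colour_cochain {1..m} n b \<and> colour_diff n b = ?c z" if z: "z \<in> obj X {1..m}" for z
  proof (rule colour_complex_exact)
    show "colour_cochain {1..m} (Suc n) (?c z)"
      unfolding colour_cochain_def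
    proof (intro conjI allI impI)
      fix \<phi> \<psi> :: "nat \<Rightarrow> nat" assume "\<forall>i\<in>{1..m}. \<phi> i = \<psi> i"
      then have "hat \<alpha> (Suc n) {1..m} \<phi> = hat \<alpha> (Suc n) {1..m} \<psi>"
        by (intro hat_cong) blast
      then show "?c z \<phi> = ?c z \<psi>"
        by simp
    next
      fix \<phi> :: "nat \<Rightarrow> nat" assume "\<not> \<phi> ` {1..m} \<subseteq> {1..Suc n}"
      then have "in_range (Suc n) {1..m} \<phi> \<subset> {1..m}"
        by (auto simp: in_range_def)
      then have "card (in_range (Suc n) {1..m} \<phi>) < card {1..m}"
        by (rule psubset_card_mono[OF finite_atLeastAtMost])
      then have "card (in_range (Suc n) {1..m} \<phi>) < m"
        by simp
      then show "?c z \<phi> = 0"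
        using low by (rule hat_vanishes[rotated])
    qed
    show "colour_diff (Suc n) (?c z) = (\<lambda>\<phi>. 0)"
      unfolding colour_diff_def[abs_def]
      using cocycle_hat[OF \<alpha> finite_atLeastAtMost free_module_basis[OF z]] by (intro ext)
    show "colour_alternation m (?c z) = 0" if "Suc n = m"
      using fun_cong[OF alt, of "basis z"] by (simp add: that alternation_def colour_alternation_def)
  qed
  then obtain b where b: "\<And>z. z \<in> obj X {1..m} \<Longrightarrow> colour_cochain {1..m} n (b z)"
    and db: "\<And>z. z \<in> obj X {1..m} \<Longrightarrow> colour_diff n (b z) = ?c z"
    by metis
  let ?B = "\<lambda>\<psi>. linear_extension (obj X {1..m}) (\<lambda>z. b z \<psi>)"
  have dB: "(\<Sum>k\<le>Suc n. signed k (?B (merge k \<circ> \<psi>) w)) = hat \<alpha> (Suc n) {1..m} \<psi> w" for \<psi> w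
  proof -
    have "(\<lambda>w. \<Sum>k\<le>Suc n. signed k (?B (merge k \<circ> \<psi>) w)) = hat \<alpha> (Suc n) {1..m} \<psi>"
    proof (rule linear_forms_eqI)
      show "(\<lambda>w. \<Sum>k\<le>Suc n. signed k (?B (merge k \<circ> \<psi>) w)) \<in> linear_forms (obj X {1..m})"
        by (intro linear_forms_sum linear_forms_signed linear_extension_in_linear_forms)
      show "hat \<alpha> (Suc n) {1..m} \<psi> \<in> linear_forms (obj X {1..m})"
        using \<alpha>c by (intro hat_linear_form) auto
      show "(\<Sum>k\<le>Suc n. signed k (?B (merge k \<circ> \<psi>) (basis z))) = hat \<alpha> (Suc n) {1..m} \<psi> (basis z)"
        if "z \<in> obj X {1..m}" for z
        using fun_cong[OF db[OF that], of \<psi>] that by (simp add: colour_diff_def)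
    qed
    then show ?thesis
      by (rule fun_cong)
  qed
  define \<beta> where "\<beta> = cochain_of n (averaged_family n m b)"
  have \<beta>: "\<beta> \<in> cochain_group n"
    unfolding \<beta>_def by (rule cochain_of_in_cochains[OF natural_family_averaged_family[OF b]])
  have std: "hat (coboundary X n \<beta>) (Suc n) {1..m} \<phi> v = hat \<alpha> (Suc n) {1..m} \<phi> v"
    if v: "v \<in> lin X {1..m}" for \<phi> v
  proof -
    let ?w = "\<lambda>xs. \<theta> m (ltrans X {1..m} (position xs) v)"
    have "hat (coboundary X n \<beta>) (Suc n) {1..m} \<phi> v =
        (\<Sum>k\<le>Suc n. \<Sum>xs\<in>permutations_of_set {1..m}. signed k (?B (merge k \<circ> (\<phi> \<circ> entry xs)) (?w xs)))"
      unfolding hat_coboundary[OF finite_atLeastAtMost v] \<beta>_def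
      by (intro sum.cong refl) (simp only: hat_averaged_family[OF b v] signed_sum comp_assoc)
    also have "\<dots> = (\<Sum>xs\<in>permutations_of_set {1..m}. hat \<alpha> (Suc n) {1..m} (\<phi> \<circ> entry xs) (?w xs))"
      unfolding dB[symmetric] by (rule sum.swap)
    also have "\<dots> = (\<Sum>xs\<in>permutations_of_set {1..m}.
        hat \<alpha> (Suc n) {1..m} \<phi> (ltrans X {1..m} (entry xs) (?w xs)))"
    proof (intro sum.cong refl)
      fix xs assume xs: "xs \<in> permutations_of_set {1..m}"
      show "hat \<alpha> (Suc n) {1..m} (\<phi> \<circ> entry xs) (?w xs) =
          hat \<alpha> (Suc n) {1..m} \<phi> (ltrans X {1..m} (entry xs) (?w xs))"
        using hat_natural[OF \<alpha>c finite_atLeastAtMost permutations_of_interval(5)[OF xs]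
            \<theta>_position_lin[OF xs v], of \<phi>]
        unfolding permutations_of_interval(4)[OF xs] by simp
    qed
    also have "\<dots> = hat \<alpha> (Suc n) {1..m} \<phi> v"
      by (rule linear_form_trace[OF hat_linear_form[OF \<alpha>c finite_atLeastAtMost] v])
    finally show ?thesis .
  qed
  have "hat (coboundary X n \<beta>) (Suc n) I \<phi> v = hat \<alpha> (Suc n) I \<phi> v"
    if I: "finite I" "card I = m" and v: "v \<in> lin X I" for I \<phi> v
  proof -
    obtain xs where xs: "set xs = I" "distinct xs"
      using finite_distinct_list[OF I(1)] by blast
    then have len: "length xs = m"
      using distinct_card I(2) by metis
    let ?u = "ltrans X I (position xs) v"
    have u: "?u \<in> lin X {1..m}"
      by (rule ltrans_position_lin[OF xs len v])
    have e: "entry xs ` {1..m} = I" "inj_on (entry xs) {1..m}"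
      using entry_image[OF xs(2)] inj_on_entry[OF xs(2)] xs(1) len by (simp_all only:)
    have p: "position xs ` I = {1..m}" "inj_on (position xs) I"
      using position_image[OF xs(2)] inj_on_position[OF xs(2)] xs(1) len by (simp_all only:)
    have "ltrans X {1..m} (entry xs) ?u = ltrans X I (entry xs \<circ> position xs) v"
      using ltrans_ltrans[OF I(1) p(2) _ v, of "entry xs"] e(2) unfolding p(1) by blast
    also have "\<dots> = v"
      using I(1) v by (rule ltrans_id) (simp add: entry_position xs(1))
    finally have v_eq: "v = ltrans X {1..m} (entry xs) ?u" ..
    have "hat \<gamma> (Suc n) I \<phi> v = hat \<gamma> (Suc n) {1..m} (\<phi> \<circ> entry xs) ?u"
      if "\<gamma> \<in> cochain_group (Suc n)" for \<gamma>
      using hat_natural[OF that finite_atLeastAtMost e(2) u, of \<phi>] unfolding e(1) v_eq[symmetric] .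
    then show ?thesis
      using std[OF u] coboundary_in_cochains[OF \<beta>] \<alpha>c by simp
  qed
  moreover have "\<beta> F = (\<lambda>v. 0)" if "card (\<Union>(set F)) \<noteq> m" for F
    using that by (simp add: \<beta>_def cochain_of_def averaged_family_def fun_eq_iff)
  ultimately show ?thesis
    using \<beta> by blast
qed

lemma coboundary_zero_alternation:
  "\<beta> \<in> cochain_group n \<Longrightarrow> alternation {1..Suc n} (coboundary X n \<beta>) = (\<lambda>v. 0)"
proof
  fix v :: "'x \<Rightarrow>\<^sub>0 'k"
  assume \<beta>: "\<beta> \<in> cochain_group n"
  show "alternation {1..Suc n} (coboundary X n \<beta>) v = 0"
  proof (cases "v \<in> lin X {1..Suc n}")
    case True
    then show ?thesis
      by (intro alternation_coboundary) auto
  next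
    case False
    have "alternation {1..Suc n} (coboundary X n \<beta>) \<in> linear_forms (obj X {1..Suc n})"
      using coboundary_in_cochains[OF \<beta>] by (intro alternation_linear_form) auto
    then show ?thesis
      using False linear_formsD(3) by blast
  qed
qed

lemma raise_order:
  assumes \<alpha>: "\<alpha> \<in> cocycle_group (Suc n)"
    and low: "\<forall>F. card (\<Union>(set F)) < m \<longrightarrow> \<alpha> F = (\<lambda>v. 0)"
    and alt: "alternation {1..Suc n} \<alpha> = (\<lambda>v. 0)"
  shows "\<exists>\<alpha>'. \<alpha>' \<in> cocycle_group (Suc n) \<and> (\<forall>F. card (\<Union>(set F)) < Suc m \<longrightarrow> \<alpha>' F = (\<lambda>v. 0)) \<and>
    alternation {1..Suc n} \<alpha>' = (\<lambda>v. 0) \<and>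
    (\<exists>\<beta>\<in>cochain_group n. (\<forall>F. card (\<Union>(set F)) \<noteq> m \<longrightarrow> \<beta> F = (\<lambda>v. 0)) \<and>
      \<alpha>' = (\<lambda>F v. \<alpha> F v - coboundary X n \<beta> F v))"
proof -
  obtain \<beta> where \<beta>: "\<beta> \<in> cochain_group n"
    and supp: "\<forall>F. card (\<Union>(set F)) \<noteq> m \<longrightarrow> \<beta> F = (\<lambda>v. 0)"
    and d\<beta>: "\<forall>I \<phi>. finite I \<longrightarrow> card I = m \<longrightarrow> (\<forall>v\<in>lin X I.
      hat (coboundary X n \<beta>) (Suc n) I \<phi> v = hat \<alpha> (Suc n) I \<phi> v)"
    using lowest_part_is_coboundary[OF assms] by (elim bexE conjE) (rule that)
  let ?\<alpha>' = "\<lambda>F v. \<alpha> F v - coboundary X n \<beta> F v"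
  have cocycle: "?\<alpha>' \<in> cocycle_group (Suc n)"
    using cocycles_diff[OF \<alpha> coboundary_in_cocycles[OF \<beta>]] .
  moreover have "?\<alpha>' F = (\<lambda>v. 0)" if "card (\<Union>(set F)) < Suc m" for F
  proof (rule cochain_vanishesI[OF cocycles_in_cochains[OF cocycle] _ that])
    fix I :: "nat set" and \<phi> and v :: "'x \<Rightarrow>\<^sub>0 'k"
    assume I: "finite I" "card I < Suc m" and v: "v \<in> lin X I"
    show "hat ?\<alpha>' (Suc n) I \<phi> v = 0"
    proof (cases "card I = m")
      case True
      then show ?thesis
        using d\<beta>[rule_format, OF I(1) True v] by (simp add: hat_diff)
    next
      case False
      then have "card (in_range k I \<psi>) < m" for k \<psi>
        using card_mono[OF I(1) in_range_subset[of k I \<psi>]] I(2) by simp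
      then have "hat \<alpha> (Suc n) I \<phi> v = 0" "hat \<beta> n I \<psi> v = 0" for \<psi>
        using hat_vanishes[of m \<alpha>] hat_vanishes[of m \<beta>] low supp by simp_all
      then show ?thesis
        using I(1) v by (simp add: hat_diff hat_coboundary)
    qed
  qed
  moreover have "alternation {1..Suc n} ?\<alpha>' = (\<lambda>v. 0)"
    using alt coboundary_zero_alternation[OF \<beta>] by (simp add: alternation_diff fun_eq_iff)
  ultimately show ?thesis
    using \<beta> supp by (intro exI[of _ ?\<alpha>'] conjI bexI[of _ \<beta>] allI impI refl) simp_all
qed

text \<open>
  On a set with \<open>N\<close> elements only the corrections for \<open>m \<le> N\<close> count, and the sum of their
  coboundaries telescopes to \<open>f 0 - f (N + 1)\<close>, where \<open>f (N + 1)\<close> vanishes.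
\<close>

theorem cocycle_is_coboundary:
  assumes \<alpha>: "\<alpha> \<in> cocycle_group (Suc n)" and alt: "alternation {1..Suc n} \<alpha> = (\<lambda>v. 0)"
  shows "\<exists>\<beta>\<in>cochain_group n. coboundary X n \<beta> = \<alpha>"
proof -
  define P where "P m \<gamma> \<longleftrightarrow> \<gamma> \<in> cocycle_group (Suc n) \<and>
    (\<forall>F. card (\<Union>(set F)) < m \<longrightarrow> \<gamma> F = (\<lambda>v. 0)) \<and> alternation {1..Suc n} \<gamma> = (\<lambda>v. 0) \<and>
    (m = 0 \<longrightarrow> \<gamma> = \<alpha>)" for m \<gamma>
  define Q where "Q m \<gamma> \<gamma>' \<beta> \<longleftrightarrow> \<beta> \<in> cochain_group n \<and>
    (\<forall>F. card (\<Union>(set F)) \<noteq> m \<longrightarrow> \<beta> F = (\<lambda>v. 0)) \<and>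
    \<gamma>' = (\<lambda>F v. \<gamma> F v - coboundary X n \<beta> F v)" for m \<gamma> \<gamma>' \<beta>
  have "\<exists>\<gamma>. P 0 \<gamma>"
    using assms by (auto simp: P_def)
  moreover have "\<exists>\<gamma>'. P (Suc m) \<gamma>' \<and> (\<exists>\<beta>. Q m \<gamma> \<gamma>' \<beta>)" if "P m \<gamma>" for m \<gamma>
    using raise_order[of \<gamma> n m] that unfolding P_def Q_def by blast
  ultimately obtain f where f: "\<And>m. P m (f m)" "\<And>m. \<exists>\<beta>. Q m (f m) (f (Suc m)) \<beta>"
    using dependent_nat_choice[of P "\<lambda>m \<gamma> \<gamma>'. \<exists>\<beta>. Q m \<gamma> \<gamma>' \<beta>"] by blast
  then obtain b where b: "\<And>m. Q m (f m) (f (Suc m)) (b m)"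
    by metis
  have f0: "f 0 = \<alpha>"
    using f(1)[of 0] by (simp add: P_def)
  have b_cochain: "b m \<in> cochain_group n" and b_supp: "card (\<Union>(set F)) \<noteq> m \<Longrightarrow> b m F = (\<lambda>v. 0)"
    and f_Suc: "f (Suc m) = (\<lambda>F v. f m F v - coboundary X n (b m) F v)" for m F
    using b[of m] by (simp_all add: Q_def)

  define \<beta> where "\<beta> = (\<lambda>F. b (card (\<Union>(set F))) F)"
  have \<beta>: "\<beta> \<in> cochain_group n"
    unfolding cochains_def
  proof (intro CollectI conjI ballI allI impI)
    fix F :: "nat set list" assume F: "F \<in> decompositions n"
    show "\<beta> F \<in> linear_forms (obj X (\<Union>(set F)))"
      unfolding \<beta>_def by (rule cochain_linear_form[OF b_cochain F])
    fix \<sigma> :: "nat \<Rightarrow> nat" and v :: "'x \<Rightarrow>\<^sub>0 'k"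
    assume "inj_on \<sigma> (\<Union>(set F))" "v \<in> lin X (\<Union>(set F))"
    then show "\<beta> (map ((`) \<sigma>) F) (ltrans X (\<Union>(set F)) \<sigma> v) = \<beta> F v"
      unfolding \<beta>_def using cochain_natural[OF b_cochain F] by (simp only: card_Union_image)
  next
    fix F :: "nat set list" assume "F \<notin> decompositions n"
    then show "\<beta> F = (\<lambda>v. 0)"
      unfolding \<beta>_def by (rule cochain_off_decompositions[OF b_cochain])
  qed
  have "coboundary X n \<beta> = \<alpha>"
  proof (rule cochains_eqI[OF coboundary_in_cochains[OF \<beta>] cocycles_in_cochains[OF \<alpha>]])
    fix I :: "nat set" and \<phi> and v :: "'x \<Rightarrow>\<^sub>0 'k"
    assume I: "finite I" and v: "v \<in> lin X I"
    define N where "N = card I"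
    have card: "card (in_range k I \<psi>) \<le> N" for k \<psi>
      unfolding N_def by (rule card_mono[OF I in_range_subset])
    have "hat \<beta> n I \<psi> v = (\<Sum>m\<le>N. hat (b m) n I \<psi> v)" for \<psi>
    proof -
      let ?s = "card (in_range n I \<psi>)"
      have "hat (b m) n I \<psi> v = (if m = ?s then hat \<beta> n I \<psi> v else 0)" for m
        using b_supp[of "fibres n I \<psi>" m] by (simp add: hat_def \<beta>_def Union_fibres)
      then show ?thesis
        using card[of n \<psi>] by simp
    qed
    then have "hat (coboundary X n \<beta>) (Suc n) I \<phi> v =
        (\<Sum>k\<le>Suc n. \<Sum>m\<le>N. signed k (hat (b m) n I (merge k \<circ> \<phi>) v))"
      by (simp only: hat_coboundary[OF I v] signed_sum)
    also have "\<dots> = (\<Sum>m\<le>N. hat (coboundary X n (b m)) (Suc n) I \<phi> v)"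
      unfolding hat_coboundary[OF I v] by (rule sum.swap)
    also have "\<dots> = (\<Sum>m\<le>N. hat (f m) (Suc n) I \<phi> v - hat (f (Suc m)) (Suc n) I \<phi> v)"
      by (simp add: f_Suc hat_diff)
    also have "\<dots> = hat (f 0) (Suc n) I \<phi> v - hat (f (Suc N)) (Suc n) I \<phi> v"
      by (rule sum_telescope)
    also have "hat (f (Suc N)) (Suc n) I \<phi> v = 0"
      using f(1)[of "Suc N"] card[of "Suc n" \<phi>] by (intro hat_vanishes[of "Suc N"]) (auto simp: P_def)
    finally show "hat (coboundary X n \<beta>) (Suc n) I \<phi> v = hat \<alpha> (Suc n) I \<phi> v"
      by (simp add: f0)
  qed
  then show ?thesis
    using \<beta> by blast
qed

end


section \<open>The isomorphism of algebras\<close>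

context weakly_projective_bicomodule
begin

text \<open>
  A cochain of degree 0 lives on the empty set only, where it is its own alternation.
\<close>

lemma cochain_group_0_eqI:
  assumes "\<alpha> \<in> cochain_group 0" "\<beta> \<in> cochain_group 0" "alternation {1..0} \<alpha> = alternation {1..0} \<beta>"
  shows "\<alpha> = \<beta>"
proof (rule cochains_eqI[OF assms(1,2)])
  fix I :: "nat set" and \<phi> :: "nat \<Rightarrow> nat" and v :: "'x \<Rightarrow>\<^sub>0 'k"
  assume "\<phi> ` I \<subseteq> {1..0}" "v \<in> lin X I"
  then have "I = {}"
    by auto
  moreover have "hat \<gamma> 0 {} \<phi> = hat \<gamma> 0 {} (position [])" for \<gamma>
    by (rule hat_cong) simp
  ultimately show "hat \<alpha> 0 I \<phi> v = hat \<beta> 0 I \<phi> v"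
    using fun_cong[OF assms(3), of v] by (simp add: alternation_def)
qed

lemma cohomologous_iff:
  "(\<alpha>, \<beta>) \<in> cohomologous X n \<longleftrightarrow>
    \<alpha> \<in> cocycle_group n \<and> \<beta> \<in> cocycle_group n \<and> alternation {1..n} \<alpha> = alternation {1..n} \<beta>"
proof -
  let ?d = "\<lambda>F v. \<alpha> F v - \<beta> F v"
  have "?d \<in> coboundaries X n \<longleftrightarrow> alternation {1..n} \<alpha> = alternation {1..n} \<beta>"
    if cocycles: "\<alpha> \<in> cocycle_group n" "\<beta> \<in> cocycle_group n"
  proof -
    have diff: "alternation {1..n} ?d = (\<lambda>v. 0) \<longleftrightarrow> alternation {1..n} \<alpha> = alternation {1..n} \<beta>"
      by (simp add: alternation_diff fun_eq_iff)
    have d: "?d \<in> cocycle_group n"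
      using cocycles_diff[OF cocycles] .
    show ?thesis
    proof (cases n)
      case 0
      have "?d \<in> coboundaries X n \<longleftrightarrow> ?d = (\<lambda>F v. 0)"
        by (simp add: 0)
      also have "\<dots> \<longleftrightarrow> alternation {1..n} ?d = (\<lambda>v. 0)"
        using cochain_group_0_eqI[of ?d "\<lambda>F v. 0"] cocycles_in_cochains[OF d] cochains_zero
        unfolding 0 by (auto simp: alternation_zero[abs_def] alternation_zero fun_eq_iff)
      finally show ?thesis
        by (simp only: diff)
    next
      case (Suc m)
      have "?d \<in> coboundaries X n \<longleftrightarrow> (\<exists>\<gamma>\<in>cochain_group m. coboundary X m \<gamma> = ?d)"
        unfolding Suc coboundaries.simps image_iff by (simp only: eq_commute[of ?d])
      also have "\<dots> \<longleftrightarrow> alternation {1..n} ?d = (\<lambda>v. 0)"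
      proof
        assume "\<exists>\<gamma>\<in>cochain_group m. coboundary X m \<gamma> = ?d"
        then obtain \<gamma> where \<gamma>: "\<gamma> \<in> cochain_group m" and eq: "coboundary X m \<gamma> = ?d"
          by (elim bexE)
        show "alternation {1..n} ?d = (\<lambda>v. 0)"
          unfolding Suc eq[symmetric] by (rule coboundary_zero_alternation[OF \<gamma>])
      next
        assume "alternation {1..n} ?d = (\<lambda>v. 0)"
        then show "\<exists>\<gamma>\<in>cochain_group m. coboundary X m \<gamma> = ?d"
          using d unfolding Suc by (intro cocycle_is_coboundary)
      qed
      finally show ?thesis
        by (simp only: diff)
    qed
  qed
  then show ?thesis
    by (auto simp: cohomologous_def)
qed

text \<open>
  The inverse of the map induced by alternation on cohomology. Its values are the cohomology classes,
  as being cohomologous means having the same alternation.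
\<close>

definition cohomology_class :: "nat \<Rightarrow> (('x \<Rightarrow>\<^sub>0 'k) \<Rightarrow> 'k) \<Rightarrow> ('x, 'k) cochain set" where
  "cohomology_class n f = {\<alpha> \<in> cocycle_group n. alternation {1..n} \<alpha> = f}"

lemma cohomologous_Image:
  "\<alpha> \<in> cocycle_group n \<Longrightarrow> cohomologous X n `` {\<alpha>} = cohomology_class n (alternation {1..n} \<alpha>)"
  by (auto simp: cohomology_class_def cohomologous_iff)

lemma cohomology_class_nonempty:
  assumes "f \<in> koszul X n"
  obtains \<alpha> where "\<alpha> \<in> cohomology_class n f" "\<alpha> \<in> cocycle_group n" "alternation {1..n} \<alpha> = f"
  using alternation_surjective[OF assms] by (auto simp: cohomology_class_def)

lemma alternation_cocycle_koszul: "\<alpha> \<in> cocycle_group n \<Longrightarrow> alternation {1..n} \<alpha> \<in> koszul X n"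
  using alternation_koszul cocycles_in_cochains by blast

lemma quotient_cohomologous: "cocycle_group n // cohomologous X n = cohomology_class n ` koszul X n"
proof
  show "cocycle_group n // cohomologous X n \<subseteq> cohomology_class n ` koszul X n"
    using alternation_cocycle_koszul cohomologous_Image by (auto elim!: quotientE)
  show "cohomology_class n ` koszul X n \<subseteq> cocycle_group n // cohomologous X n"
  proof
    fix a assume "a \<in> cohomology_class n ` koszul X n"
    then obtain f where f: "f \<in> koszul X n" "a = cohomology_class n f"
      by blast
    obtain \<alpha> where "\<alpha> \<in> cocycle_group n" "alternation {1..n} \<alpha> = f"
      using cohomology_class_nonempty[OF f(1)] by blast
    then show "a \<in> cocycle_group n // cohomologous X n"
      using quotientI[of \<alpha> "cocycle_group n" "cohomologous X n"] cohomologous_Image[of \<alpha> n] f(2) by simp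
  qed
qed

lemma bij_betw_cohomology_class:
  "bij_betw (cohomology_class n) (koszul X n) (cocycle_group n // cohomologous X n)"
proof -
  have "inj_on (cohomology_class n) (koszul X n)"
  proof (rule inj_onI)
    fix f g :: "('x \<Rightarrow>\<^sub>0 'k) \<Rightarrow> 'k"
    assume fg: "f \<in> koszul X n" "cohomology_class n f = cohomology_class n g"
    obtain \<alpha> where "\<alpha> \<in> cohomology_class n f"
      using cohomology_class_nonempty[OF fg(1)] by blast
    with fg(2) show "f = g"
      by (auto simp: cohomology_class_def)
  qed
  then show ?thesis
    by (simp add: bij_betw_def quotient_cohomologous)
qed

text \<open>
  An operation on cocycles that commutes with the alternation is computed on classes by any
  representatives.
\<close>

lemma operation_on_classes:
  assumes f: "f \<in> koszul X p" and g: "g \<in> koszul X q"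
    and op: "\<And>\<alpha> \<beta>. \<alpha> \<in> cocycle_group p \<Longrightarrow> \<beta> \<in> cocycle_group q \<Longrightarrow> op \<alpha> \<beta> \<in> cocycle_group n \<and>
      alternation {1..n} (op \<alpha> \<beta>) = op' (alternation {1..p} \<alpha>) (alternation {1..q} \<beta>)"
  shows "op' f g \<in> koszul X n"
    and "(\<Union>\<alpha>\<in>cohomology_class p f. \<Union>\<beta>\<in>cohomology_class q g. cohomologous X n `` {op \<alpha> \<beta>}) =
      cohomology_class n (op' f g)"
proof -
  have eq: "cohomologous X n `` {op \<alpha> \<beta>} = cohomology_class n (op' f g)"
    if "\<alpha> \<in> cohomology_class p f" "\<beta> \<in> cohomology_class q g" for \<alpha> \<beta>
    using that op[of \<alpha> \<beta>] cohomologous_Image[of "op \<alpha> \<beta>" n] by (auto simp: cohomology_class_def)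
  obtain \<alpha> where \<alpha>: "\<alpha> \<in> cohomology_class p f" "\<alpha> \<in> cocycle_group p" "alternation {1..p} \<alpha> = f"
    by (rule cohomology_class_nonempty[OF f])
  obtain \<beta> where \<beta>: "\<beta> \<in> cohomology_class q g" "\<beta> \<in> cocycle_group q" "alternation {1..q} \<beta> = g"
    by (rule cohomology_class_nonempty[OF g])
  show "op' f g \<in> koszul X n"
    using op[OF \<alpha>(2) \<beta>(2)] alternation_cocycle_koszul \<alpha>(3) \<beta>(3) by metis
  have "(\<Union>\<alpha>\<in>cohomology_class p f. \<Union>\<beta>\<in>cohomology_class q g. cohomologous X n `` {op \<alpha> \<beta>}) =
      (\<Union>\<alpha>\<in>cohomology_class p f. \<Union>\<beta>\<in>cohomology_class q g. cohomology_class n (op' f g))"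
    by (intro SUP_cong refl eq)
  also have "\<dots> = cohomology_class n (op' f g)"
    using \<alpha>(1) \<beta>(1) by blast
  finally show "(\<Union>\<alpha>\<in>cohomology_class p f. \<Union>\<beta>\<in>cohomology_class q g. cohomologous X n `` {op \<alpha> \<beta>}) =
      cohomology_class n (op' f g)" .
qed

lemma add_on_classes:
  assumes "f \<in> koszul X n" "g \<in> koszul X n"
  shows "(\<lambda>v. f v + g v) \<in> koszul X n"
    and "gadd (cohomology_algebra X) n (cohomology_class n f) (cohomology_class n g) =
      cohomology_class n (\<lambda>v. f v + g v)"
  using operation_on_classes[OF assms, of "\<lambda>\<alpha> \<beta> F v. \<alpha> F v + \<beta> F v" n "\<lambda>f g v. f v + g v"]
  by (simp_all add: cohomology_algebra_def cocycles_add alternation_add fun_eq_iff)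

lemma scale_on_classes:
  assumes "f \<in> koszul X n"
  shows "(\<lambda>v. c * f v) \<in> koszul X n"
    and "gscale (cohomology_algebra X) n c (cohomology_class n f) = cohomology_class n (\<lambda>v. c * f v)"
proof -
  have "(\<Union>\<alpha>\<in>cohomology_class n f. \<Union>\<beta>\<in>cohomology_class n f. cohomologous X n `` {\<lambda>F v. c * \<alpha> F v}) =
      (\<Union>\<alpha>\<in>cohomology_class n f. cohomologous X n `` {\<lambda>F v. c * \<alpha> F v})"
    by blast
  then show "(\<lambda>v. c * f v) \<in> koszul X n"
    "gscale (cohomology_algebra X) n c (cohomology_class n f) = cohomology_class n (\<lambda>v. c * f v)"
    using operation_on_classes[OF assms assms, of "\<lambda>\<alpha> \<beta> F v. c * \<alpha> F v" n "\<lambda>f g v. c * f v"]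
    by (simp_all add: cohomology_algebra_def cocycles_mult alternation_mult fun_eq_iff)
qed

lemma mult_on_classes:
  assumes "f \<in> koszul X p" "g \<in> koszul X q"
  shows "koszul_cup X p q f g \<in> koszul X (p + q)"
    and "gmult (cohomology_algebra X) p q (cohomology_class p f) (cohomology_class q g) =
      cohomology_class (p + q) (koszul_cup X p q f g)"
  using operation_on_classes[OF assms, of "cup X p q" "p + q" "koszul_cup X p q"]
  by (simp_all add: cohomology_algebra_def cup_in_cocycles koszul_cup_alternation cocycles_in_cochains
      del: One_nat_def)

lemma decompositions_0: "F \<in> decompositions 0 \<longleftrightarrow> F = []"
  by (auto simp: decompositions_def decomposition_def)

lemma cup_unit_in_cocycles: "cup_unit X \<in> cocycle_group 0"
proof (rule cocyclesI)
  have "ltrans X {} \<sigma> v = v" if "v \<in> lin X {}" for \<sigma> and v :: "'x \<Rightarrow>\<^sub>0 'k"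
    using that by (intro ltrans_id) auto
  then show "cup_unit X \<in> cochain_group 0"
    by (auto simp: cochains_def decompositions_0 cup_unit_def linear_extension_in_linear_forms)
  fix I :: "nat set" and \<phi> :: "nat \<Rightarrow> nat" and v :: "'x \<Rightarrow>\<^sub>0 'k"
  have "hat (cup_unit X) 0 I (merge 0 \<circ> \<phi>) = hat (cup_unit X) 0 I (merge 1 \<circ> \<phi>)"
    by (rule hat_cong) simp
  then show "(\<Sum>k\<le>Suc 0. signed k (hat (cup_unit X) 0 I (merge k \<circ> \<phi>) v)) = 0"
    by (simp add: sum.atMost_Suc)
qed

lemma alternation_cup_unit: "alternation {1..0} (cup_unit X) = linear_extension (obj X {}) (\<lambda>z. 1)"
proof (rule linear_forms_eqI)
  show "alternation {1..0} (cup_unit X) \<in> linear_forms (obj X {})"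
    using alternation_linear_form[of "cup_unit X" "{}"] cocycles_in_cochains[OF cup_unit_in_cocycles] by simp
  show "linear_extension (obj X {}) (\<lambda>z. 1) \<in> linear_forms (obj X {})"
    by (rule linear_extension_in_linear_forms)
  fix z assume z: "z \<in> obj X {}"
  then have "(basis z :: 'x \<Rightarrow>\<^sub>0 'k) \<in> lin X {}"
    by (rule free_module_basis)
  then show "alternation {1..0} (cup_unit X) (basis z) = linear_extension (obj X {}) (\<lambda>z. 1) (basis z)"
    by (simp add: alternation_def hat_eq cup_unit_def fibres_def)
qed

theorem koszul_cohomology_iso:
  "graded_algebra_iso (koszul_algebra X :: ('k, ('x \<Rightarrow>\<^sub>0 'k) \<Rightarrow> 'k) graded_algebra)
     (cohomology_algebra X) cohomology_class"
proof -
  have unit: "cohomologous X 0 `` {cup_unit X} = cohomology_class 0 (linear_extension (obj X {}) (\<lambda>z. 1))"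
    using cohomologous_Image[OF cup_unit_in_cocycles] by (simp only: alternation_cup_unit)
  have "linear_extension (obj X {}) (\<lambda>z. 1) \<in> (koszul X 0 :: (('x \<Rightarrow>\<^sub>0 'k) \<Rightarrow> 'k) set)"
    using alternation_cocycle_koszul[OF cup_unit_in_cocycles] by (simp only: alternation_cup_unit)
  moreover have "gone (cohomology_algebra X) = cohomology_class 0 (linear_extension (obj X {}) (\<lambda>z. 1))"
    by (simp add: cohomology_algebra_def unit)
  moreover have "gcarrier (cohomology_algebra X) p = cocycle_group p // cohomologous X p" for p
    by (simp add: cohomology_algebra_def)
  ultimately show ?thesis
    unfolding graded_algebra_iso_def
    using bij_betw_cohomology_class add_on_classes scale_on_classes mult_on_classes
    by (simp add: koszul_algebra_def)
qed

theorem cohomology_graded_commutative: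
  "graded_commutative (cohomology_algebra X :: ('k, ('x, 'k) cochain set) graded_algebra)"
  unfolding graded_commutative_def
proof (intro allI ballI)
  fix p q and a b :: "('x, 'k) cochain set"
  assume "a \<in> gcarrier (cohomology_algebra X) p" "b \<in> gcarrier (cohomology_algebra X) q"
  then obtain f g where f: "f \<in> koszul X p" "a = cohomology_class p f"
    and g: "g \<in> koszul X q" "b = cohomology_class q g"
    by (auto simp: cohomology_algebra_def quotient_cohomologous)
  have "koszul_cup X q p g f \<in> koszul X (p + q)"
    using mult_on_classes(1)[OF g(1) f(1)] by (simp add: add.commute)
  then have "gscale (cohomology_algebra X) (p + q) ((- 1) ^ (p * q)) (gmult (cohomology_algebra X) q p b a) =
      cohomology_class (p + q) (\<lambda>v. (- 1) ^ (p * q) * koszul_cup X q p g f v)"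
    using mult_on_classes(2)[OF g(1) f(1)] scale_on_classes(2) f(2) g(2) by (simp add: add.commute)
  also have "\<dots> = cohomology_class (p + q) (koszul_cup X p q f g)"
    by (simp add: minus_one_power_mult flip: koszul_cup_commute)
  finally show "gmult (cohomology_algebra X) p q a b =
      gscale (cohomology_algebra X) (p + q) ((- 1) ^ (p * q)) (gmult (cohomology_algebra X) q p b a)"
    using mult_on_classes(2)[OF f(1) g(1)] f(2) g(2) by simp
qed

end

theorem theorem3p6:
  fixes X :: "'x set_bicomodule"
  assumes "linearized_bicomodule X"
    and "weakly_projective TYPE('k::{comm_ring,comm_monoid_mult}) X"
    and "cosymmetric TYPE('k) X"
  shows "isomorphic_graded_algebras
           (koszul_algebra X :: ('k, ('x \<Rightarrow>\<^sub>0 'k) \<Rightarrow> 'k) graded_algebra)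
           (cohomology_algebra X :: ('k, ('x, 'k) cochain set) graded_algebra) \<and>
         graded_commutative (cohomology_algebra X :: ('k, ('x, 'k) cochain set) graded_algebra)"
proof -
  interpret weakly_projective_bicomodule X "TYPE('k)"
    using assms by unfold_locales
  show ?thesis
    unfolding isomorphic_graded_algebras_def
    using koszul_cohomology_iso cohomology_graded_commutative by blast
qed

end
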